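(* Let $a\neq b$ be fixed complex numbers, let $d$ be a positive integer, and let $Q$ be a complex polynomial with $Q(a)=Q(b)=0$. For any such polynomial $Q$ of degree at most $5$, the Composition Set $COS_{d,Q}$ is a linear subspace of $\mathcal P_d$ of dimension at most $[d/2]$. For $6\le \deg Q\le 89$ the set $COS_{d,Q}$ is a union of at most two linear subspaces of $\mathcal P_d$, and for $\deg Q\ge 90$ the set $COS_{d,Q}$ is a union of at most three linear subspaces. The dimension of each of these subspaces is at most $[d/2]$, and their double and triple intersections have dimensions at most $[d/6]+1$ and $[d/90]$, respectively.
   Context: $[\cdot]$ denotes the integer part. $\mathcal P_d$ is the complex vector space of all complex polynomials $P$ of degree at most $d$ with $P(a)=P(b)=0$. Polynomials $P,Q$ satisfy the Composition Condition on $[a,b]$ if there exist polynomials $\tilde P,\tilde Q,W$ with $W(a)=W(b)$ such that $P(x)=\tilde P(W(x))$ and $Q(x)=\tilde Q(W(x))$. $COS_{d,Q}$ is the set of all $P\in\mathcal P_d$ such that $P$ and $Q$ satisfy the Composition Condition on $[a,b]$.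
   Formalization: The polynomial Q is assumed to be nonzero; for Q = 0 the Composition Set is all of P_d, of dimension d−1, so the bound [d/2] fails for d ≥ 4. *)

theory Defs
  imports Complex_Main "HOL-Computational_Algebra.Polynomial"
begin

interpretation cpoly: vector_space "smult :: complex \<Rightarrow> complex poly \<Rightarrow> complex poly"
  by unfold_locales (simp_all add: smult_add_right smult_add_left)

text \<open>The zero polynomial has \<open>degree 0 = 0\<close>, so it belongs to this set for every \<open>d\<close>.\<close>

definition poly_space :: "complex \<Rightarrow> complex \<Rightarrow> nat \<Rightarrow> complex poly set" where
  "poly_space a b d = {P. degree P \<le> d \<and> poly P a = 0 \<and> poly P b = 0}"

definition composition_condition ::
    "complex \<Rightarrow> complex \<Rightarrow> complex poly \<Rightarrow> complex poly \<Rightarrow> bool" where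
  "composition_condition a b P Q \<longleftrightarrow>
     (\<exists>P' Q' W. poly W a = poly W b \<and> P = pcompose P' W \<and> Q = pcompose Q' W)"

definition COS :: "complex \<Rightarrow> complex \<Rightarrow> nat \<Rightarrow> complex poly \<Rightarrow> complex poly set" where
  "COS a b d Q = {P \<in> poly_space a b d. composition_condition a b P Q}"

text \<open>The constant \<open>cpoly.dim\<close> is \<open>0\<close> on infinite-dimensional spaces; the inclusion in the
  finite-dimensional \<open>poly_space a b d\<close> rules this case out.\<close>

definition linear_subspace_of :: "complex poly set \<Rightarrow> complex poly set \<Rightarrow> bool" where
  "linear_subspace_of V S \<longleftrightarrow> cpoly.subspace V \<and> V \<subseteq> S"

end

theory Submission
  imports Defs "HOL-Computational_Algebra.Computational_Algebra" "HOL-Computational_Algebra.Field_as_Ring"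
begin

text \<open>
  Let \<open>M\<close> be the set of compositional right factors \<open>W\<close> of \<open>Q\<close> with \<open>W a = W b\<close> that have no
  proper right factor with this property. Then \<open>COS\<close> is the union over \<open>W \<in> M\<close> of the spaces of
  polynomials in \<open>W\<close> vanishing at \<open>a\<close>, and these spaces depend on \<open>W\<close> only up to affine equivalence.

  Two inequivalent elements of \<open>M\<close> are polynomials in a common \<open>V\<close> with \<open>V a \<noteq> V b\<close> whose degree is the
  gcd of theirs. By Ritt's second theorem the left factors are, up to affine changes, either \<open>z^n\<close> and
  \<open>z^s R(z^n)\<close>, or two Dickson (Chebyshev) polynomials. That theorem comes from Riemann-Hurwitz counting:
  the curve \<open>A x = B y\<close> is parametrised by polynomials, which bounds the ramification of the two left
  factors so strongly that only these two configurations remain. Among three inequivalent elements of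
  \<open>M\<close>, two form a Dickson pair and the third is in power position to both, which forces every common
  multiple of the degrees to be at least \<open>2 * 3 * (3 * 5) = 90\<close>; four such elements cannot exist. The
  dimension of a space of polynomials is bounded by the number of degrees of its nonzero elements, and
  these degrees are common multiples of the degrees of the factors involved.
\<close>

text \<open>The pairs in \<open>M\<close> behave like a graph. A power position is an arrow along
  which the degree strictly grows, because the left factor of the target must vanish at 0 and on a
  whole orbit of roots of unity. A Dickson pair is an undirected edge: up to affine changes both
  members solve one polynomial Pell equation \<open>X ^ 2 - 4 = h * S ^ 2\<close>. The main rigidity
  is a pigeonhole. If the generating solution takes the values \<open>w + 1/w\<close> and
  \<open>v + 1/v\<close> at the two points, then a solution of index \<open>i\<close> that is equal
  at both points has \<open>(w/v) ^ i = 1\<close> or \<open>(w v) ^ i = 1\<close>; of three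
  solutions two use the same number and then share a closed factor. The other rigidity is that a
  Dickson form of index at least 3 determines its two exceptional values, by counting points in
  fibres, so Pell equations read off from different decompositions of one polynomial can be
  compared. Together they forbid two Dickson edges at one vertex. Several other configurations are
  excluded by uncovering hidden Dickson forms over one inner polynomial, so that the same pigeonhole
  applies.\<close>

notation pcompose (infixl "\<circ>\<^sub>p" 71)

section \<open>Right factors of a common composite\<close>

lemma degree_sum_distinct:
  fixes f :: "'i \<Rightarrow> 'a::comm_ring_1 poly"
  assumes "finite I" "I \<noteq> {}" "\<And>i. i \<in> I \<Longrightarrow> f i \<noteq> 0" "inj_on (\<lambda>i. degree (f i)) I"
  shows "sum f I \<noteq> 0 \<and> (\<exists>i\<in>I. degree (sum f I) = degree (f i) \<and> (\<forall>j\<in>I. degree (f j) \<le> degree (f i)))"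
proof -
  have "Max ((\<lambda>i. degree (f i)) ` I) \<in> (\<lambda>i. degree (f i)) ` I"
    using assms(1,2) by (intro Max_in) auto
  then obtain i where i: "i \<in> I" "degree (f i) = Max ((\<lambda>i. degree (f i)) ` I)" by force
  hence i: "i \<in> I" "\<And>j. j \<in> I \<Longrightarrow> degree (f j) \<le> degree (f i)"
    using assms(1) by auto
  have less: "degree (f j) < degree (f i)" if "j \<in> I" "j \<noteq> i" for j
    using i that assms(4) by (metis inj_onD le_neq_implies_less)
  have "coeff (sum f I) (degree (f i)) = (\<Sum>j\<in>I. coeff (f j) (degree (f i)))"
    by (simp add: coeff_sum)
  also have "\<dots> = coeff (f i) (degree (f i)) + (\<Sum>j\<in>I-{i}. coeff (f j) (degree (f i)))"
    using assms(1) i(1) by (simp add: sum.remove)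
  also have "(\<Sum>j\<in>I-{i}. coeff (f j) (degree (f i))) = 0"
    by (intro sum.neutral ballI coeff_eq_0) (use less in auto)
  finally have c: "coeff (sum f I) (degree (f i)) = coeff (f i) (degree (f i))" by simp
  have nz: "coeff (f i) (degree (f i)) \<noteq> 0" using assms(3) i(1) by simp
  have "degree (sum f I) \<le> degree (f i)"
    using assms(1) i by (intro degree_sum_le) auto
  moreover have "degree (sum f I) \<ge> degree (f i)" using c nz by (intro le_degree) simp
  ultimately show ?thesis using c nz i by (metis coeff_0 le_antisym)
qed

text \<open>\<open>S\<close> is the cofactor in \<open>A' ^ k - A ^ k = (A' - A) * S\<close>. Its
  \<open>k\<close> summands have the same top coefficient, which cannot cancel in characteristic 0;
  this controls the degree of a difference of \<open>k\<close>-th powers.\<close>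

lemma power_diff_factor_coeff:
  fixes A A' :: "complex poly"
  assumes "degree A = n" "degree A' = n" "lead_coeff A' = lead_coeff A" "k > 0"
  defines "S \<equiv> (\<Sum>i<k. A ^ (k - Suc i) * A' ^ i)"
  shows "degree S \<le> n * (k - 1)" "coeff S (n * (k - 1)) = of_nat k * lead_coeff A ^ (k - 1)"
proof -
  have d: "degree (A ^ (k - Suc i) * A' ^ i) \<le> n * (k - 1)" if "i < k" for i
  proof -
    have "degree (A ^ (k - Suc i) * A' ^ i) \<le> n * (k - Suc i) + n * i"
      using degree_mult_le[of "A ^ (k - Suc i)" "A' ^ i"] degree_power_le[of A "k - Suc i"]
        degree_power_le[of A' i] assms(1,2) by simp
    also have "\<dots> = n * (k - 1)" using that by (simp flip: distrib_left)
    finally show ?thesis .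
  qed
  show "degree S \<le> n * (k - 1)" unfolding S_def by (intro degree_sum_le) (use d in auto)
  have c: "coeff (A ^ (k - Suc i) * A' ^ i) (n * (k - 1)) = lead_coeff A ^ (k - 1)" if "i < k" for i
  proof (cases "A = 0")
    case False
    hence "lead_coeff A' \<noteq> 0" using assms(3) by simp
    hence "A' \<noteq> 0" by auto
    have "degree (A ^ (k - Suc i) * A' ^ i) = n * (k - Suc i) + n * i"
      using False \<open>A' \<noteq> 0\<close> assms(1,2) by (simp add: degree_mult_eq degree_power_eq)
    also have "\<dots> = n * (k - 1)" using that by (simp flip: distrib_left)
    finally have "coeff (A ^ (k - Suc i) * A' ^ i) (n * (k - 1)) = lead_coeff (A ^ (k - Suc i) * A' ^ i)" by simp
    also have "\<dots> = lead_coeff A ^ (k - Suc i) * lead_coeff A ^ i"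
      using assms(3) by (simp add: lead_coeff_mult lead_coeff_power)
    also have "\<dots> = lead_coeff A ^ (k - 1)" using that by (simp flip: power_add)
    finally show ?thesis .
  next
    case True
    hence "n = 0" using assms(1) by simp
    have "lead_coeff A' = 0" using True assms(3) by simp
    hence "A' = 0" by simp
    then show ?thesis using True that by (auto simp: zero_power power_0_left)
  qed
  have "coeff S (n * (k - 1)) = (\<Sum>i<k. coeff (A ^ (k - Suc i) * A' ^ i) (n * (k - 1)))"
    unfolding S_def by (simp add: coeff_sum)
  also have "\<dots> = (\<Sum>i<k. lead_coeff A ^ (k - 1))" by (intro sum.cong refl c) auto
  finally show "coeff S (n * (k - 1)) = of_nat k * lead_coeff A ^ (k - 1)" by simp
qed

lemma complex_root_exists:
  fixes z :: complex assumes "k > 0" shows "\<exists>a. a ^ k = z"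
proof -
  have "\<exists>x. poly (monom 1 k - [:z:]) x = 0"
  proof (rule fundamental_theorem_of_algebra_alt)
    show "\<not> (\<exists>a l. a \<noteq> 0 \<and> l = 0 \<and> monom 1 k - [:z:] = pCons a l)"
    proof
      assume "\<exists>a l. a \<noteq> 0 \<and> l = 0 \<and> monom 1 k - [:z:] = pCons a l"
      then obtain a where "monom 1 k - [:z:] = [:a:]" by auto
      hence "monom 1 k = [:a + z:]" by (simp add: algebra_simps)
      hence "degree (monom (1::complex) k) = 0" by simp
      thus False using assms by (simp add: degree_monom_eq)
    qed
  qed
  thus ?thesis by (auto simp: poly_monom)
qed

text \<open>The \<open>n + 1\<close> coefficients of \<open>A\<close> are found from the top down:
  adding \<open>monom c e\<close> leaves the higher coefficients of \<open>A ^ k\<close> alone and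
  shifts the next one by \<open>c * k * lead_coeff A ^ (k - 1)\<close>, so every condition is linear
  in the new coefficient.\<close>

lemma approx_root:
  fixes P :: "complex poly"
  assumes "degree P = n * k" "k > 0" "P \<noteq> 0"
  shows "\<exists>A. degree A = n \<and> A \<noteq> 0 \<and> (\<forall>i\<ge>n * k - n. coeff (A ^ k) i = coeff P i)"
proof -
  have "\<exists>A. degree A = n \<and> A \<noteq> 0 \<and> (\<forall>i\<ge>n * k - j. coeff (A ^ k) i = coeff P i)" if "j \<le> n" for j
    using that
  proof (induction j)
    case 0
    obtain a where a: "a ^ k = lead_coeff P" using complex_root_exists[OF \<open>k > 0\<close>] by blast
    have a0: "a \<noteq> 0" using a assms by (metis leading_coeff_0_iff zero_power)
    have "(monom a n) ^ k = monom (lead_coeff P) (n * k)" by (simp add: monom_power a)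
    hence "coeff (monom a n ^ k) i = coeff P i" if "i \<ge> n * k" for i
      using that assms by (auto simp: coeff_eq_0)
    thus ?case using a0 by (intro exI[of _ "monom a n"]) (auto simp: degree_monom_eq)
  next
    case (Suc j)
    then obtain A where A: "degree A = n" "A \<noteq> 0" "\<And>i. i \<ge> n * k - j \<Longrightarrow> coeff (A ^ k) i = coeff P i" by auto
    define c where "c = (coeff P (n * k - Suc j) - coeff (A ^ k) (n * k - Suc j)) / (of_nat k * lead_coeff A ^ (k - 1))"
    define e where "e = n - Suc j"
    define A' where "A' = A + monom c e"
    have lt: "degree (monom c e) < n" using Suc.prems degree_monom_le[of c e] by (simp add: e_def)
    have A': "degree A' = n"
      using lt A(1) unfolding A'_def by (simp add: degree_add_eq_left)
    have "coeff (monom c e) n = 0" using lt by (simp only: coeff_eq_0)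
    hence A'2: "lead_coeff A' = lead_coeff A"
      unfolding A' A(1) by (simp add: A'_def)
    have "lead_coeff A' \<noteq> 0" using A'2 A(2) by simp
    hence "A' \<noteq> 0" by auto
    note S = power_diff_factor_coeff[OF A(1) A' A'2 \<open>k > 0\<close>]
    define S where "S = (\<Sum>i<k. A ^ (k - Suc i) * A' ^ i)"
    have "A' ^ k - A ^ k = (A' - A) * S" unfolding S_def
      by (subst power_diff_sumr2) simp
    hence eq: "A' ^ k = A ^ k + monom c e * S" by (simp add: A'_def algebra_simps)
    have k: "n * k = n * (k - 1) + n" using \<open>k > 0\<close> by (metis Suc_diff_1 mult_Suc_right add.commute)
    have "coeff (A' ^ k) i = coeff P i" if i: "i \<ge> n * k - Suc j" for i
    proof (cases "i = n * k - Suc j")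
      case True
      have "i - e = n * (k - 1)" "i \<ge> e" using True Suc.prems k by (auto simp: e_def)
      hence "coeff (monom c e * S) i = c * (of_nat k * lead_coeff A ^ (k - 1))"
        using S(2) by (simp add: coeff_monom_mult S_def)
      also have "\<dots> = coeff P i - coeff (A ^ k) i"
        using \<open>k > 0\<close> A(2) by (simp add: c_def True)
      finally show ?thesis by (simp add: eq)
    next
      case False
      hence i: "i \<ge> n * k - j" using i Suc.prems k by linarith
      have "i - e > n * (k - 1)" "i \<ge> e" using i Suc.prems k by (auto simp: e_def)
      hence "coeff (monom c e * S) i = 0"
        using S(1) by (simp add: coeff_monom_mult S_def coeff_eq_0)
      then show ?thesis using A(3)[OF i] by (simp add: eq)
    qed
    thus ?case using A' \<open>A' \<noteq> 0\<close> by blast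
  qed
  thus ?thesis by blast
qed

text \<open>Uniqueness of approximate roots: if \<open>X\<close> and \<open>Y\<close> differ, then
  \<open>X ^ k - Y ^ k\<close> is nonzero of degree at least \<open>l * (k - 1)\<close>, which lies
  in the range where the coefficients agree.\<close>

lemma power_close_imp_eq:
  fixes X Y :: "complex poly"
  assumes "degree X = l" "degree Y = l" "lead_coeff X = lead_coeff Y" "X \<noteq> 0" "k > 0"
    and "\<And>i. i \<ge> l * k - l \<Longrightarrow> coeff (X ^ k) i = coeff (Y ^ k) i"
  shows "X = Y"
proof (rule ccontr)
  assume "X \<noteq> Y"
  define S where "S = (\<Sum>i<k. Y ^ (k - Suc i) * X ^ i)"
  have "lead_coeff Y \<noteq> 0" using assms(3,4) by (metis leading_coeff_0_iff)
  hence "Y \<noteq> 0" by auto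
  have S: "degree S \<le> l * (k - 1)" "coeff S (l * (k - 1)) = of_nat k * lead_coeff Y ^ (k - 1)"
    using power_diff_factor_coeff[OF assms(2,1,3,5)] by (auto simp: S_def)
  hence "coeff S (l * (k - 1)) \<noteq> 0" using \<open>Y \<noteq> 0\<close> assms(5) by auto
  hence "degree S = l * (k - 1)" using S(1) le_degree le_antisym by blast
  have "S \<noteq> 0" using \<open>coeff S (l * (k - 1)) \<noteq> 0\<close> by force
  hence "degree ((X - Y) * S) \<ge> l * (k - 1)"
    using \<open>X \<noteq> Y\<close> \<open>degree S = l * (k - 1)\<close> by (simp add: degree_mult_eq)
  moreover have "(X - Y) * S = X ^ k - Y ^ k" unfolding S_def
    by (subst power_diff_sumr2) simp
  ultimately have d: "degree (X ^ k - Y ^ k) \<ge> l * k - l"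
    by (simp add: diff_mult_distrib2)
  have nz: "X ^ k - Y ^ k \<noteq> 0"
    using \<open>S \<noteq> 0\<close> \<open>X \<noteq> Y\<close> unfolding \<open>(X - Y) * S = X ^ k - Y ^ k\<close>[symmetric] by simp
  have "coeff (X ^ k - Y ^ k) (degree (X ^ k - Y ^ k)) = 0" using assms(6)[OF d] by simp
  thus False using nz leading_coeff_0_iff by blast
qed

lemma pcompose_power: "(P ^ k) \<circ>\<^sub>p W = (P \<circ>\<^sub>p W) ^ k"
  for P W :: "'a::comm_semiring_1 poly"
  by (induction k) (simp_all add: pcompose_1 pcompose_mult)

lemma coeff_eq_0_from_imp:
  fixes D :: "'a::zero poly"
  assumes "\<And>i. i \<ge> b \<Longrightarrow> coeff D i = 0"
  shows "D = 0 \<or> degree D < b"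
  using assms by (metis leading_coeff_0_iff not_le)

text \<open>With \<open>degree Q = l * k\<close>, compose an approximate \<open>k\<close>-th root of
  each left factor with its right factor. Both composites are approximate \<open>k\<close>-th roots
  of \<open>Q\<close> of degree \<open>l\<close>, hence equal up to a constant, so one polynomial is
  a composite with either right factor.\<close>

lemma common_composite_lcm:
  fixes Q :: "complex poly"
  assumes "Q = A1 \<circ>\<^sub>p W1" "Q = A2 \<circ>\<^sub>p W2" "degree Q > 0"
  shows "\<exists>A B. A \<circ>\<^sub>p W1 = B \<circ>\<^sub>p W2 \<and> degree (A \<circ>\<^sub>p W1) = lcm (degree W1) (degree W2)"
proof -
  define l where "l = lcm (degree W1) (degree W2)"
  have dQ: "degree Q = degree A1 * degree W1" "degree Q = degree A2 * degree W2"
    using degree_pcompose[of A1 W1] degree_pcompose[of A2 W2] assms(1,2) by auto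
  have "degree W1 dvd degree Q" "degree W2 dvd degree Q" by (metis dQ dvd_triv_right)+
  hence "l dvd degree Q" by (simp add: l_def)
  then obtain k where k: "degree Q = l * k" by auto
  have pos: "degree W1 > 0" "degree W2 > 0" "k > 0" "l > 0" using dQ assms(3) k by (auto intro!: gr0I)
  have *: "\<exists>A. degree (A \<circ>\<^sub>p W) = l \<and> (\<forall>i\<ge>l * k - l. coeff ((A \<circ>\<^sub>p W) ^ k) i = coeff Q i) \<and> A \<circ>\<^sub>p W \<noteq> 0"
    if W: "Q = A0 \<circ>\<^sub>p W" "degree W dvd l" "degree W > 0" for A0 W
  proof -
    obtain n where n: "l = degree W * n" using W(2) by auto
    have "degree Q = degree A0 * degree W" using W by (simp add: degree_pcompose)
    hence "degree A0 * degree W = (n * k) * degree W" using k n by (metis mult.assoc mult.commute)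
    hence dA0: "degree A0 = n * k" using W(3) by (metis mult_cancel2 less_numeral_extra(3))
    have "A0 \<noteq> 0" using W assms(3) by auto
    then obtain A where A: "degree A = n" "A \<noteq> 0" "\<And>i. i \<ge> n * k - n \<Longrightarrow> coeff (A ^ k) i = coeff A0 i"
      using approx_root[OF dA0 \<open>k > 0\<close>] by blast
    define D where "D = A ^ k - A0"
    have "D = 0 \<or> degree D < n * k - n" using A(3) by (intro coeff_eq_0_from_imp) (simp add: D_def)
    hence D: "D \<circ>\<^sub>p W = 0 \<or> degree (D \<circ>\<^sub>p W) < l * k - l"
    proof
      assume "degree D < n * k - n"
      hence "degree D * degree W < (n * k - n) * degree W" using W(3) by simp
      also have "\<dots> = l * k - l" using n by (simp add: algebra_simps diff_mult_distrib)
      finally show ?thesis by (simp add: degree_pcompose)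
    qed simp
    have "D \<circ>\<^sub>p W = (A \<circ>\<^sub>p W) ^ k - Q" using W(1) by (simp add: D_def pcompose_diff pcompose_power)
    hence "coeff ((A \<circ>\<^sub>p W) ^ k) i = coeff Q i" if "i \<ge> l * k - l" for i
      using D that by (metis coeff_0 coeff_diff coeff_eq_0 diff_eq_diff_eq diff_self less_le_trans right_minus_eq)
    thus ?thesis using A(1,2) n W(3) by (intro exI[of _ A]) (auto simp: degree_pcompose pcompose_eq_0_iff)
  qed
  obtain A where A: "degree (A \<circ>\<^sub>p W1) = l" "\<And>i. i \<ge> l * k - l \<Longrightarrow> coeff ((A \<circ>\<^sub>p W1) ^ k) i = coeff Q i" "A \<circ>\<^sub>p W1 \<noteq> 0"
    using *[OF assms(1)] pos by (auto simp: l_def)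
  obtain B where B: "degree (B \<circ>\<^sub>p W2) = l" "\<And>i. i \<ge> l * k - l \<Longrightarrow> coeff ((B \<circ>\<^sub>p W2) ^ k) i = coeff Q i" "B \<circ>\<^sub>p W2 \<noteq> 0"
    using *[OF assms(2)] pos by (auto simp: l_def)
  \<comment> \<open>Both leading coefficients are \<open>k\<close>-th roots of the one of
    \<open>Q\<close>, so \<open>w\<close> is a \<open>k\<close>-th root of unity and scaling by it
    does not change the \<open>k\<close>-th power.\<close>
  define w where "w = lead_coeff (A \<circ>\<^sub>p W1) / lead_coeff (B \<circ>\<^sub>p W2)"
  have lk: "lead_coeff (X) ^ k = lead_coeff Q" if "degree X = l" "\<And>i. i \<ge> l * k - l \<Longrightarrow> coeff (X ^ k) i = coeff Q i" "X \<noteq> 0" for X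
  proof -
    have "lead_coeff X ^ k = lead_coeff (X ^ k)" by (simp add: lead_coeff_power)
    also have "degree (X ^ k) = l * k" using that by (simp add: degree_power_eq)
    finally show ?thesis using that(2)[of "l * k"] k by simp
  qed
  have w: "w ^ k = 1" "w \<noteq> 0" using lk[OF A] lk[OF B] A(3) B(3) assms(3) by (auto simp: w_def power_divide)
  have "A \<circ>\<^sub>p W1 = smult w (B \<circ>\<^sub>p W2)"
  proof (rule power_close_imp_eq)
    show "degree (A \<circ>\<^sub>p W1) = l" "degree (smult w (B \<circ>\<^sub>p W2)) = l" using A B w by auto
    show "lead_coeff (A \<circ>\<^sub>p W1) = lead_coeff (smult w (B \<circ>\<^sub>p W2))"
      using B(3) by (simp add: w_def lead_coeff_smult)
    show "coeff ((A \<circ>\<^sub>p W1) ^ k) i = coeff (smult w (B \<circ>\<^sub>p W2) ^ k) i" if "i \<ge> l * k - l" for i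
      using A(2)[OF that] B(2)[OF that] w(1) by (simp add: smult_power)
  qed (use A pos in auto)
  hence "A \<circ>\<^sub>p W1 = (smult w B) \<circ>\<^sub>p W2" by (simp add: pcompose_smult)
  thus ?thesis using A(1) by (auto simp: l_def)
qed

section \<open>The ring generated by two right factors, and a right factor of degree gcd\<close>

lemma pcompose_monom: "monom c i \<circ>\<^sub>p W = smult c (W ^ i)"
  for W :: "'a::comm_semiring_1 poly"
  by (induction i) (auto simp: monom_0 monom_Suc pcompose_pCons)

lemma pcompose_conv_sum: "P \<circ>\<^sub>p W = (\<Sum>i\<le>degree P. smult (coeff P i) (W ^ i))"
  for P W :: "'a::comm_semiring_1 poly"
proof -
  have "P = (\<Sum>i\<le>degree P. monom (coeff P i) i)" by (simp add: poly_as_sum_of_monoms)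
  hence "P \<circ>\<^sub>p W = (\<Sum>i\<le>degree P. monom (coeff P i) i) \<circ>\<^sub>p W" by simp
  thus ?thesis by (simp add: pcompose_sum pcompose_monom)
qed

lemma smult_sum_right: "smult c (sum f I) = (\<Sum>i\<in>I. smult c (f i))"
  by (induction I rule: infinite_finite_induct) (simp_all add: smult_add_right)

lemma residue_unique:
  fixes a b j j' p r :: nat
  assumes "a * p + j * r = b * p + j' * r" "coprime p r" "j < p" "j' < p"
  shows "j = j'"
proof -
  have *: "j = j'" if "a * p + j * r = b * p + j' * r" "j < p" "j' < p" "j \<le> j'" for a b j j' :: nat
  proof -
    have "j * r \<le> j' * r" using that(4) by simp
    have "(j' - j) * r = a * p - b * p"
      using that(1) \<open>j * r \<le> j' * r\<close> by (simp add: diff_mult_distrib)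
    hence "(j' - j) * r = (a - b) * p" by (simp add: diff_mult_distrib)
    hence "p dvd (j' - j) * r" by simp
    hence "p dvd j' - j" using assms(2) by (simp add: coprime_dvd_mult_left_iff)
    moreover have "j' - j < p" using that by simp
    ultimately have "j' - j = 0" using nat_dvd_not_less by blast
    thus ?thesis using that(4) by simp
  qed
  show ?thesis
  proof (cases "j \<le> j'")
    case True thus ?thesis using *[of a j b j'] assms by simp
  next
    case False thus ?thesis using *[of b j' a j] assms by simp
  qed
qed

text \<open>The multiples of \<open>r\<close> by \<open>j < p\<close> run through all residues
  modulo \<open>p\<close>; beyond \<open>r * p\<close> the remaining multiple of \<open>p\<close> is
  nonnegative.\<close>

lemma residue_exists:
  fixes p r k :: nat
  assumes "coprime p r" "p > 0" "k \<ge> r * p"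
  shows "\<exists>i j. j < p \<and> k = i * p + j * r"
proof -
  have "inj_on (\<lambda>j. j * r mod p) {..<p}"
  proof
    fix x y assume xy: "x \<in> {..<p}" "y \<in> {..<p}" "x * r mod p = y * r mod p"
    have "(y * r div p) * p + x * r = (x * r div p) * p + y * r"
      using xy(3) mult_div_mod_eq[of p "x * r"] mult_div_mod_eq[of p "y * r"]
      by (metis add.commute add.left_commute mult.commute)
    thus "x = y" using residue_unique assms(1) xy by blast
  qed
  moreover have "(\<lambda>j. j * r mod p) ` {..<p} \<subseteq> {..<p}" using assms(2) by auto
  ultimately have "(\<lambda>j. j * r mod p) ` {..<p} = {..<p}"
    by (simp add: card_image card_subset_eq)
  moreover have "k mod p \<in> {..<p}" using assms(2) by simp
  ultimately obtain j where j: "j < p" "j * r mod p = k mod p" by (metis (no_types, lifting) imageE lessThan_iff)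
  have "j * r \<le> k" using j(1) assms(3) by (metis less_imp_le_nat mult.commute mult_le_mono1 order_trans)
  hence "p dvd k - j * r" using j(2) by (metis mod_eq_dvd_iff_nat)
  then obtain i where "k - j * r = i * p" by (metis dvd_def mult.commute)
  thus ?thesis using j(1) \<open>j * r \<le> k\<close> by (intro exI[of _ i] exI[of _ j]) simp
qed

text \<open>The degrees of the left factors are crossed with \<open>p\<close> and \<open>r\<close>:
  the common composite has the least possible degree \<open>g * p * r\<close>, as produced by
  \<open>common_composite_lcm\<close>.\<close>

locale coprime_composite =
  fixes A B W1 W2 :: "complex poly" and g p r :: nat
  assumes comp: "A \<circ>\<^sub>p W1 = B \<circ>\<^sub>p W2"
    and deg1: "degree W1 = g * p" and deg2: "degree W2 = g * r"
    and degB: "degree B = p" and degA: "degree A = r"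
    and gpos: "g > 0" and ppos: "p > 0" and rpos: "r > 0"
    and cop: "coprime p r"
begin

text \<open>\<open>R\<close> is the ring generated by \<open>W1\<close> and \<open>W2\<close>; all its elements have degrees divisible by \<open>g\<close>, and all large
  multiples of \<open>g\<close> occur. Hence \<open>M\<close> below has finite codimension, the identity polynomial has degree
  \<open>g\<close> over the fraction field of \<open>R\<close>, and Gauss's lemma extracts the right factor from its minimal
  polynomial.\<close>

definition R where "R = {F. \<exists>h. F = (\<Sum>j<p. (h j \<circ>\<^sub>p W1) * W2 ^ j)}"

lemma W_nz: "W1 \<noteq> 0" "W2 \<noteq> 0" "degree W1 > 0" "degree W2 > 0"
  using deg1 deg2 gpos ppos rpos by auto

lemma R_term: "j < p \<Longrightarrow> (H \<circ>\<^sub>p W1) * W2 ^ j \<in> R"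
  unfolding R_def
  by (intro CollectI exI[of _ "\<lambda>i. if i = j then H else 0"]) (simp add: if_distrib[of "\<lambda>x. x \<circ>\<^sub>p W1"] if_distrib[of "\<lambda>x. x * _"] cong: if_cong)

lemma R_0: "0 \<in> R" using R_term[of 0 0] ppos by simp

lemma R_add: assumes "F \<in> R" "G \<in> R" shows "F + G \<in> R"
proof -
  obtain h k where "F = (\<Sum>j<p. (h j \<circ>\<^sub>p W1) * W2 ^ j)" "G = (\<Sum>j<p. (k j \<circ>\<^sub>p W1) * W2 ^ j)"
    using assms by (auto simp: R_def)
  hence "F + G = (\<Sum>j<p. ((h j + k j) \<circ>\<^sub>p W1) * W2 ^ j)"
    by (simp add: pcompose_add distrib_right sum.distrib)
  thus ?thesis unfolding R_def by (intro CollectI exI[of _ "\<lambda>j. h j + k j"])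
qed

lemma R_sum: "(\<And>i. i \<in> I \<Longrightarrow> f i \<in> R) \<Longrightarrow> sum f I \<in> R"
  by (induction I rule: infinite_finite_induct) (auto simp: R_0 R_add)

lemma R_mult_W1: assumes "F \<in> R" shows "(H \<circ>\<^sub>p W1) * F \<in> R"
proof -
  obtain h where "F = (\<Sum>j<p. (h j \<circ>\<^sub>p W1) * W2 ^ j)" using assms by (auto simp: R_def)
  hence "(H \<circ>\<^sub>p W1) * F = (\<Sum>j<p. ((H * h j) \<circ>\<^sub>p W1) * W2 ^ j)"
    by (simp add: pcompose_mult sum_distrib_left mult_ac)
  thus ?thesis unfolding R_def by (intro CollectI exI[of _ "\<lambda>j. H * h j"])
qed

lemma R_const: "[:c:] \<in> R" using R_term[of 0 "[:c:]"] ppos by simp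

lemma R_smult: "F \<in> R \<Longrightarrow> smult c F \<in> R" using R_mult_W1[of F "[:c:]"] by simp

text \<open>\<open>B \<circ>\<^sub>p W2\<close> equals \<open>A \<circ>\<^sub>p W1\<close> and so is
  a polynomial in \<open>W1\<close>; solving for its leading term expresses \<open>W2 ^ p\<close> by
  lower powers. This is why \<open>p\<close> powers of \<open>W2\<close> suffice and
  \<open>R\<close> is closed under products.\<close>

lemma R_W2_power: "W2 ^ p \<in> R"
proof -
  have "B \<circ>\<^sub>p W2 = (\<Sum>i\<le>p. smult (coeff B i) (W2 ^ i))" by (simp add: pcompose_conv_sum degB)
  also have "{..p} = insert p {..<p}" by auto
  finally have "smult (coeff B p) (W2 ^ p) = A \<circ>\<^sub>p W1 + smult (-1) (\<Sum>i<p. smult (coeff B i) (W2 ^ i))"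
    by (simp add: comp)
  also have "\<dots> \<in> R"
  proof (intro R_add R_smult R_sum)
    show "A \<circ>\<^sub>p W1 \<in> R" using R_mult_W1[OF R_const[of 1], of A] by (simp add: one_pCons)
    show "W2 ^ i \<in> R" if "i \<in> {..<p}" for i using R_term[of i "[:1:]"] that by (simp add: one_pCons)
  qed
  finally have "smult (1 / coeff B p) (smult (coeff B p) (W2 ^ p)) \<in> R" by (rule R_smult)
  moreover have "coeff B p \<noteq> 0" using degB ppos by (metis leading_coeff_neq_0 degree_0 less_numeral_extra(3))
  ultimately show ?thesis by simp
qed

lemma R_mult_W2: assumes "F \<in> R" shows "W2 * F \<in> R"
proof -
  obtain h where "F = (\<Sum>j<p. (h j \<circ>\<^sub>p W1) * W2 ^ j)" using assms by (auto simp: R_def)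
  hence "W2 * F = (\<Sum>j<p. (h j \<circ>\<^sub>p W1) * W2 ^ Suc j)" by (simp add: sum_distrib_left mult_ac)
  also have "\<dots> \<in> R"
  proof (intro R_sum)
    fix j assume "j \<in> {..<p}"
    hence "Suc j < p \<or> Suc j = p" by auto
    thus "(h j \<circ>\<^sub>p W1) * W2 ^ Suc j \<in> R"
      using R_term[of "Suc j"] R_mult_W1[OF R_W2_power, of "h j"] by metis
  qed
  finally show ?thesis .
qed

lemma R_mult: assumes "F \<in> R" "G \<in> R" shows "F * G \<in> R"
proof -
  have *: "W2 ^ j * G \<in> R" for j by (induction j) (use assms R_mult_W2 in \<open>auto simp: mult.assoc\<close>)
  obtain h where "F = (\<Sum>j<p. (h j \<circ>\<^sub>p W1) * W2 ^ j)" using assms by (auto simp: R_def)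
  hence "F * G = (\<Sum>j<p. (h j \<circ>\<^sub>p W1) * (W2 ^ j * G))" by (simp add: sum_distrib_right mult.assoc)
  also have "\<dots> \<in> R" by (intro R_sum R_mult_W1 *)
  finally show ?thesis .
qed

lemma R_diff: "F \<in> R \<Longrightarrow> G \<in> R \<Longrightarrow> F - G \<in> R"
  using R_add[OF _ R_smult[of G "-1"], of F] by simp

lemma R_power: "F \<in> R \<Longrightarrow> F ^ k \<in> R"
  by (induction k) (use R_const[of 1] in \<open>auto simp: R_mult one_pCons\<close>)

lemma R_W1: "W1 \<in> R" using R_mult_W1[OF R_const[of 1], of "[:0,1:]"] by (simp add: pcompose_pCons)
lemma R_W2: "W2 \<in> R" using R_mult_W2[OF R_const[of 1]] by simp

lemma R_agree:
  assumes "F \<in> R" "poly W1 x = poly W1 y" "poly W2 x = poly W2 y"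
  shows "poly F x = poly F y"
proof -
  obtain h where "F = (\<Sum>j<p. (h j \<circ>\<^sub>p W1) * W2 ^ j)" using assms by (auto simp: R_def)
  thus ?thesis using assms(2,3) by (simp add: poly_sum poly_pcompose)
qed

text \<open>The summand with index \<open>j\<close> has a degree of the form
  \<open>g * (i * p + j * r)\<close>, from which coprimality recovers \<open>j\<close>; so leading
  terms cannot cancel.\<close>

lemma R_degree: assumes "F \<in> R" "F \<noteq> 0" shows "g dvd degree F"
proof -
  obtain h where h: "F = (\<Sum>j<p. (h j \<circ>\<^sub>p W1) * W2 ^ j)" using assms by (auto simp: R_def)
  define I where "I = {j. j < p \<and> h j \<noteq> 0}"
  define f where "f = (\<lambda>j. (h j \<circ>\<^sub>p W1) * W2 ^ j)"
  have F: "F = sum f I" unfolding h f_def I_def by (intro sum.mono_neutral_right) auto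
  have nz: "f j \<noteq> 0" if "j \<in> I" for j
    using that W_nz by (auto simp: f_def I_def pcompose_eq_0_iff)
  have d: "degree (f j) = g * (degree (h j) * p + j * r)" if "j \<in> I" for j
    using nz[OF that] unfolding f_def
    by (subst degree_mult_eq) (auto simp: degree_pcompose degree_power_eq W_nz deg1 deg2 algebra_simps)
  have "I \<noteq> {}" using F assms(2) by auto
  moreover have "inj_on (\<lambda>j. degree (f j)) I"
  proof
    fix x y assume "x \<in> I" "y \<in> I" "degree (f x) = degree (f y)"
    thus "x = y" using residue_unique[OF _ cop, of "degree (h x)" x "degree (h y)" y] gpos
      by (auto simp: d) (auto simp: I_def)
  qed
  moreover have "finite I" by (simp add: I_def)
  ultimately obtain j where "j \<in> I" "degree F = degree (f j)"
    using degree_sum_distinct[of I f] nz F by auto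
  thus ?thesis using d by simp
qed

lemma R_exists: assumes "k \<ge> r * p" shows "\<exists>F\<in>R. F \<noteq> 0 \<and> degree F = g * k"
proof -
  obtain i j where ij: "j < p" "k = i * p + j * r" using residue_exists[OF cop ppos assms] by blast
  have "W1 ^ i * W2 ^ j \<in> R" by (intro R_mult R_power R_W1 R_W2)
  moreover have "degree (W1 ^ i * W2 ^ j) = g * k" "W1 ^ i * W2 ^ j \<noteq> 0"
    using W_nz by (auto simp: degree_mult_eq degree_power_eq deg1 deg2 ij algebra_simps)
  ultimately show ?thesis by blast
qed

definition M where "M = {F. \<exists>\<rho>. (\<forall>i<g. \<rho> i \<in> R) \<and> F = (\<Sum>i<g. \<rho> i * monom 1 i)}"

lemma M_add: assumes "F \<in> M" "G \<in> M" shows "F + G \<in> M"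
proof -
  obtain h k where "\<forall>i<g. h i \<in> R" "\<forall>i<g. k i \<in> R" "F = (\<Sum>i<g. h i * monom 1 i)" "G = (\<Sum>i<g. k i * monom 1 i)"
    using assms by (auto simp: M_def)
  thus ?thesis unfolding M_def
    by (intro CollectI exI[of _ "\<lambda>j. h j + k j"]) (auto simp: R_add distrib_right sum.distrib)
qed

lemma M_smult: assumes "F \<in> M" shows "smult c F \<in> M"
proof -
  obtain h where "\<forall>i<g. h i \<in> R" "F = (\<Sum>i<g. h i * monom 1 i)" using assms by (auto simp: M_def)
  thus ?thesis unfolding M_def
    by (intro CollectI exI[of _ "\<lambda>j. smult c (h j)"]) (auto simp: R_smult smult_sum_right)
qed

lemma M_exists: assumes "n \<ge> g * (r * p)" shows "\<exists>F\<in>M. F \<noteq> 0 \<and> degree F = n"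
proof -
  have "n div g \<ge> r * p" using assms gpos by (metis div_le_mono nonzero_mult_div_cancel_left neq0_conv)
  then obtain G where G: "G \<in> R" "G \<noteq> 0" "degree G = g * (n div g)" using R_exists by blast
  define F where "F = G * monom 1 (n mod g)"
  have "F = (\<Sum>i<g. (if i = n mod g then G else 0) * monom 1 i)"
    using gpos by (simp add: F_def if_distrib[of "\<lambda>x. x * _"] cong: if_cong)
  hence "F \<in> M" unfolding M_def using G R_0
    by (intro CollectI exI[of _ "\<lambda>i. if i = n mod g then G else 0"]) auto
  moreover have "F \<noteq> 0" using G by (simp add: F_def)
  moreover have "degree F = n" using G by (simp add: F_def degree_mult_eq degree_monom_eq)
  ultimately show ?thesis by blast
qed

text \<open>Every large degree occurs in \<open>M\<close>, so leading terms can be removed one at a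
  time: modulo \<open>M\<close> there remain at most \<open>g * (r * p)\<close>
  coefficients.\<close>

lemma M_reduce: "\<exists>m\<in>M. \<forall>i\<ge>g * (r * p). coeff (f - m) i = 0"
proof -
  have "\<exists>m\<in>M. \<forall>i\<ge>g * (r * p). coeff (f - m) i = 0" if "\<forall>i\<ge>n. coeff f i = 0" for n and f :: "complex poly"
    using that
  proof (induction n arbitrary: f)
    case 0
    have "0 \<in> M" unfolding M_def using R_0 by (intro CollectI exI[of _ "\<lambda>_. 0"]) auto
    then show ?case using 0 by (intro bexI[of _ 0]) auto
  next
    case (Suc n)
    show ?case
    proof (cases "n \<ge> g * (r * p)")
      case False
      have "0 \<in> M" unfolding M_def using R_0 by (intro CollectI exI[of _ "\<lambda>_. 0"]) auto
      then show ?thesis using Suc.prems False by (intro bexI[of _ 0]) auto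
    next
      case True
      then obtain F where F: "F \<in> M" "F \<noteq> 0" "degree F = n" using M_exists by blast
      define f' where "f' = f - smult (coeff f n / coeff F n) F"
      have "coeff F n \<noteq> 0" using F by (metis leading_coeff_neq_0)
      hence "coeff f' n = 0" by (simp add: f'_def)
      moreover have "\<forall>i\<ge>Suc n. coeff f' i = 0" using Suc.prems F by (simp add: f'_def coeff_eq_0)
      ultimately have "\<forall>i\<ge>n. coeff f' i = 0" by (metis le_antisym not_less_eq_eq)
      from Suc.IH[OF this] obtain m where m: "m \<in> M" "\<forall>i\<ge>g * (r * p). coeff (f' - m) i = 0" by blast
      have "smult (coeff f n / coeff F n) F + m \<in> M" using m F by (intro M_add M_smult)
      moreover have "f - (smult (coeff f n / coeff F n) F + m) = f' - m" by (simp add: f'_def)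
      ultimately show ?thesis using m by metis
    qed
  qed
  from this[of "Suc (degree f)" f] show ?thesis by (simp add: coeff_eq_0)
qed

end

text \<open>Dimension count: \<open>S\<close> is a linear relation from a space of unbounded degrees
  to polynomials with \<open>D\<close> coefficients, so some nonzero \<open>q\<close> is related to
  0. In the induction one fixed pair \<open>(q0, f0)\<close> kills the top coefficient of every
  \<open>f\<close>, without changing \<open>degree q\<close> once it exceeds
  \<open>degree q0\<close>.\<close>

lemma unbounded_kernel:
  fixes S :: "(complex poly \<times> complex poly) set"
  assumes closed: "\<And>q f q' f' c. (q, f) \<in> S \<Longrightarrow> (q', f') \<in> S \<Longrightarrow> (q - smult c q', f - smult c f') \<in> S"
    and unb: "\<And>N. \<exists>q f. (q, f) \<in> S \<and> degree q \<ge> N \<and> (\<forall>i\<ge>D. coeff f i = 0)"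
  shows "\<exists>q. (q, 0) \<in> S \<and> q \<noteq> 0"
proof -
  have "\<exists>q f. (q, f) \<in> S \<and> degree q \<ge> N \<and> (\<forall>i\<ge>0. coeff f i = 0)" for N
    using unb
  proof (induction D arbitrary: N)
    case 0
    then show ?case by blast
  next
    case (Suc D)
    note unb = Suc.prems
    show ?case
    proof (cases "\<exists>q f. (q, f) \<in> S \<and> coeff f D \<noteq> 0 \<and> (\<forall>i\<ge>Suc D. coeff f i = 0)")
      case False
      have "\<exists>q f. (q, f) \<in> S \<and> degree q \<ge> N \<and> (\<forall>i\<ge>D. coeff f i = 0)" for N
      proof -
        obtain q f where q: "(q, f) \<in> S" "degree q \<ge> N" "\<forall>i\<ge>Suc D. coeff f i = 0" using unb by blast
        hence "coeff f D = 0" using False by blast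
        hence "\<forall>i\<ge>D. coeff f i = 0" using q(3) by (metis le_antisym not_less_eq_eq)
        thus ?thesis using q by blast
      qed
      thus ?thesis using Suc.IH by blast
    next
      case True
      then obtain q0 f0 where q0: "(q0, f0) \<in> S" "coeff f0 D \<noteq> 0" "\<forall>i\<ge>Suc D. coeff f0 i = 0" by blast
      have "\<exists>q f. (q, f) \<in> S \<and> degree q \<ge> N \<and> (\<forall>i\<ge>D. coeff f i = 0)" for N
      proof -
        obtain q f where q: "(q, f) \<in> S" "degree q \<ge> max N (Suc (degree q0))" "\<forall>i\<ge>Suc D. coeff f i = 0"
          using unb by blast
        define c where "c = coeff f D / coeff f0 D"
        have "degree (q - smult c q0) = degree q"
          using q(2) degree_smult_le[of c q0] by (simp add: degree_add_eq_left diff_conv_add_uminus del: add_uminus_conv_diff)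
        moreover have "coeff (f - smult c f0) D = 0" using q0 by (simp add: c_def)
        moreover have "\<forall>i\<ge>Suc D. coeff (f - smult c f0) i = 0" using q(3) q0(3) by simp
        ultimately have "degree (q - smult c q0) = degree q \<and> (\<forall>i\<ge>D. coeff (f - smult c f0) i = 0)"
          by (metis le_antisym not_less_eq_eq)
        thus ?thesis using closed[OF q(1) q0(1), of c] q(2) by (metis max.bounded_iff)
      qed
      thus ?thesis using Suc.IH by blast
    qed
  qed
  then obtain q f where "(q, f) \<in> S" "degree q \<ge> 1" "\<forall>i\<ge>0. coeff f i = 0" by blast
  moreover from this have "f = 0" by (intro poly_eqI) simp
  ultimately show ?thesis by (metis degree_0 not_one_le_zero)
qed

context coprime_composite
begin

text \<open>Multiplication by \<open>monom 1 g\<close> sends \<open>R\<close>, whose degrees are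
  unbounded, to polynomials modulo \<open>M\<close>, a space of finite dimension. A nonzero
  \<open>q\<close> in the kernel gives an equation of degree \<open>g\<close> over \<open>R\<close>
  for the identity polynomial.\<close>

lemma integral_relation: "\<exists>q\<in>R. q \<noteq> 0 \<and> q * monom 1 g \<in> M"
proof -
  define S where "S = {(q, f). q \<in> R \<and> (\<exists>m\<in>M. q * monom 1 g = m + f)}"
  have "\<exists>q. (q, 0) \<in> S \<and> q \<noteq> 0"
  proof (rule unbounded_kernel)
    fix q f q' f' c assume "(q, f) \<in> S" "(q', f') \<in> S"
    then obtain m m' where *: "q \<in> R" "q' \<in> R" "m \<in> M" "m' \<in> M" "q * monom 1 g = m + f" "q' * monom 1 g = m' + f'"
      by (auto simp: S_def)
    have "m + smult (-c) m' \<in> M" using * by (intro M_add M_smult)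
    moreover have "(q - smult c q') * monom 1 g = (m + smult (-c) m') + (f - smult c f')"
      using * by (simp add: left_diff_distrib smult_add_right)
    moreover have "q - smult c q' \<in> R" using * by (intro R_diff R_smult)
    ultimately show "(q - smult c q', f - smult c f') \<in> S" unfolding S_def by blast
  next
    fix N
    obtain q where q: "q \<in> R" "degree q = g * (N + r * p)" using R_exists[of "N + r * p"] by auto
    have "N \<le> g * (N + r * p)" using gpos by (metis le_add1 le_trans mult_le_mono1 nat_mult_1 Suc_leI One_nat_def)
    moreover obtain m where "m \<in> M" "\<forall>i\<ge>g * (r * p). coeff (q * monom 1 g - m) i = 0" using M_reduce by blast
    ultimately show "\<exists>q f. (q, f) \<in> S \<and> degree q \<ge> N \<and> (\<forall>i\<ge>g * (r * p). coeff f i = 0)"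
      using q unfolding S_def by (intro exI[of _ q] exI[of _ "q * monom 1 g - m"]) auto
  qed
  thus ?thesis unfolding S_def by auto
qed

text \<open>The nonzero terms \<open>coeff S i * monom 1 i\<close> have degrees congruent to
  \<open>i\<close> modulo \<open>g\<close> and cannot cancel: the identity polynomial satisfies no
  nontrivial equation of degree below \<open>g\<close> over \<open>R\<close>.\<close>

lemma R_poly_remainder_0:
  assumes "\<And>i. coeff S i \<in> R" "\<And>i. i \<ge> g \<Longrightarrow> coeff S i = 0" "poly S [:0, 1:] = 0"
  shows "S = 0"
proof (rule ccontr)
  assume "S \<noteq> 0"
  define I where "I = {i. coeff S i \<noteq> 0}"
  have sub: "I \<subseteq> {..degree S}" by (auto simp: I_def le_degree)
  have "I \<noteq> {}" using \<open>S \<noteq> 0\<close> leading_coeff_0_iff[of S] unfolding I_def by blast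
  moreover have "finite I" using sub finite_subset by blast
  moreover have deg: "degree (coeff S i * monom 1 i) = degree (coeff S i) + i" if "i \<in> I" for i
    using that by (simp add: I_def degree_mult_eq degree_monom_eq)
  have "inj_on (\<lambda>i. degree (coeff S i * monom 1 i)) I"
  proof
    fix i j assume ij: "i \<in> I" "j \<in> I" "degree (coeff S i * monom 1 i) = degree (coeff S j * monom 1 j)"
    hence "(degree (coeff S i) + i) mod g = (degree (coeff S j) + j) mod g" by (simp only: deg)
    moreover have "g dvd degree (coeff S i)" "g dvd degree (coeff S j)"
      using ij assms(1) by (auto simp: I_def intro: R_degree)
    moreover have "i < g" "j < g" using ij assms(2) by (auto simp: I_def) (metis not_less)+
    ultimately show "i = j" by (auto elim!: dvdE)
  qed
  ultimately have "(\<Sum>i\<in>I. coeff S i * monom 1 i) \<noteq> 0"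
    using degree_sum_distinct[of I "\<lambda>i. coeff S i * monom 1 i"] by (auto simp: I_def)
  moreover have "(\<Sum>i\<in>I. coeff S i * monom 1 i) = poly S [:0, 1:]"
    unfolding poly_altdef monom_altdef smult_1_left
    by (intro sum.mono_neutral_left sub) (auto simp: I_def)
  ultimately show False using assms(3) by simp
qed

text \<open>Each step multiplies by the leading coefficient \<open>q\<close> instead of dividing by
  it, which keeps the coefficients of the remainder in \<open>R\<close>.\<close>

lemma R_poly_pseudo_division:
  assumes P: "\<And>i. coeff P i \<in> R" "degree P \<le> g" "coeff P g = q" and q: "q \<in> R"
    and G: "\<And>i. coeff G i \<in> R"
  shows "\<exists>k \<Psi> S. [:q:] ^ k * G = P * \<Psi> + S \<and> (\<forall>i. coeff S i \<in> R) \<and> (\<forall>i\<ge>g. coeff S i = 0)"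
proof -
  have "\<exists>k \<Psi> S. [:q:] ^ k * G = P * \<Psi> + S \<and> (\<forall>i. coeff S i \<in> R) \<and> (\<forall>i\<ge>g. coeff S i = 0)"
    if "\<And>i. coeff G i \<in> R" "\<And>i. i \<ge> n \<Longrightarrow> coeff G i = 0" for n G
    using that
  proof (induction n arbitrary: G)
    case 0
    then show ?case by (intro exI[of _ 0] exI[of _ 0] exI[of _ G]) auto
  next
    case (Suc n)
    show ?case
    proof (cases "Suc n \<le> g")
      case True
      then show ?thesis using Suc.prems by (intro exI[of _ 0] exI[of _ 0] exI[of _ G]) auto
    next
      case False
      define H where "H = monom (coeff G n) (n - g)"
      define G' where "G' = [:q:] * G - P * H"
      have c: "coeff G' i = q * coeff G i - (if n - g \<le> i then coeff G n * coeff P (i - (n - g)) else 0)" for i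
        by (simp add: G'_def H_def mult.commute[of P] coeff_monom_mult)
      have "coeff G' i \<in> R" for i
        unfolding c using Suc.prems(1) P(1) q by (auto intro!: R_diff R_mult R_0)
      moreover have "coeff G' i = 0" if "i \<ge> n" for i
      proof (cases "i = n")
        case True
        then show ?thesis using False P(3) by (simp add: c)
      next
        case neq: False
        hence "i - (n - g) > degree P" using that False P(2) by linarith
        then show ?thesis using Suc.prems(2)[of i] neq that by (simp add: c coeff_eq_0)
      qed
      ultimately obtain k \<Psi> S where *: "[:q:] ^ k * G' = P * \<Psi> + S" "\<forall>i. coeff S i \<in> R" "\<forall>i\<ge>g. coeff S i = 0"
        using Suc.IH[of G'] by blast
      have "[:q:] ^ Suc k * G = [:q:] ^ k * (G' + P * H)" unfolding G'_def by (simp only: power_Suc2 mult.assoc diff_add_cancel)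
      also have "\<dots> = [:q:] ^ k * G' + P * ([:q:] ^ k * H)" by (simp add: algebra_simps)
      also have "\<dots> = P * (\<Psi> + [:q:] ^ k * H) + S" unfolding *(1) by (simp add: algebra_simps)
      finally show ?thesis using * by blast
    qed
  qed
  from this[of G "Suc (degree G)"] G show ?thesis by (simp add: coeff_eq_0)
qed

text \<open>Gauss's lemma: \<open>G\<close> is primitive because its leading coefficient is a unit,
  so the primitive part of \<open>P\<close> has a unit as leading coefficient too, and
  \<open>q\<close> is the content of \<open>P\<close> up to a unit.\<close>

lemma gauss_divides_content:
  fixes P \<Psi> G :: "complex poly poly"
  assumes "[:q:] ^ k * G = P * \<Psi>" "is_unit (lead_coeff G)" "lead_coeff P = q" "q \<noteq> 0"
  shows "q dvd coeff P i"
proof -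
  define a b where "a = lead_coeff (primitive_part P)" and "b = lead_coeff (primitive_part \<Psi>)"
  have "is_unit (content G)" using assms(2) content_dvd_coeff dvd_trans by blast
  hence cG: "content G = 1" using is_unit_content_iff by blast
  have "normalize (q ^ k) = content (smult (q ^ k) G)" by (simp add: cG)
  also have "smult (q ^ k) G = P * \<Psi>" using assms(1) by (simp add: poly_const_pow)
  finally have c: "normalize (q ^ k) = content P * content \<Psi>" by (simp add: content_mult)
  have a: "q = content P * a" using assms(3) unfolding a_def
    by (metis content_times_primitive_part lead_coeff_smult)
  have b: "lead_coeff \<Psi> = content \<Psi> * b" unfolding b_def
    by (metis content_times_primitive_part lead_coeff_smult)
  have "q ^ k * lead_coeff G = lead_coeff P * lead_coeff \<Psi>"
    using arg_cong[OF assms(1), of lead_coeff] assms(4) by (simp add: lead_coeff_mult poly_const_pow)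
  also have "\<dots> = normalize (q ^ k) * (a * b)" unfolding assms(3) c b by (subst a) (simp add: mult_ac)
  finally have "unit_factor (q ^ k) * (q ^ k * lead_coeff G) = (unit_factor (q ^ k) * normalize (q ^ k)) * (a * b)"
    by (simp add: mult.assoc)
  hence "q ^ k * (unit_factor (q ^ k) * lead_coeff G) = q ^ k * (a * b)"
    by (simp only: unit_factor_mult_normalize mult.left_commute)
  hence "unit_factor (q ^ k) * lead_coeff G = a * b" using assms(4) by simp
  moreover have "is_unit (unit_factor (q ^ k) * lead_coeff G)"
    using assms(2,4) by (simp add: is_unit_mult_iff)
  ultimately have "is_unit a" by (metis is_unit_mult_iff)
  hence "q dvd content P" using a by (metis dvd_refl mult.commute mult_unit_dvd_iff')
  thus ?thesis using content_dvd_coeff dvd_trans by blast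
qed

text \<open>\<open>P\<close> is the minimal equation of the identity polynomial over
  \<open>R\<close>. Dividing it by its leading coefficient \<open>q\<close> gives a monic equation
  with polynomial coefficients, whose constant term is, up to sign, the desired
  \<open>V\<close>.\<close>

lemma generator_exists: "\<exists>V q. degree V = g \<and> q \<in> R \<and> q \<noteq> 0 \<and> q * V \<in> R"
proof -
  obtain q \<rho> where q: "q \<in> R" "q \<noteq> 0" "\<And>i. i < g \<Longrightarrow> \<rho> i \<in> R"
    "q * monom 1 g = (\<Sum>i<g. \<rho> i * monom 1 i)"
    using integral_relation by (auto simp: M_def)
  define P where "P = monom q g - (\<Sum>i<g. monom (\<rho> i) i)"
  have cP: "coeff P i = (if i = g then q else if i < g then - \<rho> i else 0)" for i
    by (auto simp: P_def coeff_sum)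
  have "degree P \<le> g" by (rule degree_le) (simp add: cP)
  moreover have "degree P \<ge> g" by (rule le_degree) (simp add: cP q)
  ultimately have dP: "degree P = g" by simp
  have PR: "coeff P i \<in> R" for i
    using q R_smult[of "\<rho> i" "-1"] by (auto simp: cP R_0)
  have P0: "poly P [:0, 1:] = 0"
    using q(4) by (simp add: P_def poly_sum poly_monom monom_altdef)
  \<comment> \<open>\<open>G\<close> is \<open>W1(T) - W1(x)\<close> as a polynomial in
    \<open>T\<close>: it vanishes at the identity polynomial, has coefficients in \<open>R\<close>,
    and its leading coefficient is a nonzero constant, as Gauss's lemma requires.\<close>
  define G where "G = map_poly (\<lambda>c. [:c:]) W1 - [:W1:]"
  have cG: "coeff G i = [:coeff W1 i:] - (if i = 0 then W1 else 0)" for i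
    by (simp add: G_def coeff_map_poly coeff_pCons split: nat.splits)
  have GR: "coeff G i \<in> R" for i unfolding cG by (auto intro!: R_diff R_const R_W1 R_0)
  have G0: "poly G [:0, 1:] = 0"
    by (simp add: G_def flip: pcompose_altdef)
  obtain k \<Psi> S where S: "[:q:] ^ k * G = P * \<Psi> + S" "\<forall>i. coeff S i \<in> R" "\<forall>i\<ge>g. coeff S i = 0"
    using R_poly_pseudo_division[OF PR _ _ q(1) GR] dP cP by auto
  have "poly ([:q:] ^ k * G) [:0, 1:] = poly (P * \<Psi> + S) [:0, 1:]" by (simp only: S(1))
  hence "poly S [:0, 1:] = 0" by (simp add: P0 G0)
  hence "S = 0" using R_poly_remainder_0 S by blast
  have dG: "degree G = degree W1"
  proof (rule antisym)
    show "degree G \<le> degree W1" using W_nz by (intro degree_le) (auto simp: cG coeff_eq_0)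
    show "degree G \<ge> degree W1" using W_nz by (intro le_degree) (auto simp: cG)
  qed
  have "is_unit (lead_coeff G)" using W_nz by (simp add: dG cG is_unit_poly_iff dvd_field_iff)
  hence dvd: "q dvd coeff P i" for i
    using gauss_divides_content[of q k G P \<Psi>] S(1) \<open>S = 0\<close> q(2) by (simp add: dP cP)
  have "\<exists>\<sigma>. \<forall>i<g. \<rho> i = q * \<sigma> i"
  proof (intro choice_iff[THEN iffD1] allI)
    show "\<exists>y. i < g \<longrightarrow> \<rho> i = q * y" for i
    proof (cases "i < g")
      case True
      hence "q dvd \<rho> i" using dvd[of i] by (simp add: cP)
      thus ?thesis by (auto elim: dvdE)
    qed simp
  qed
  then obtain \<sigma> where \<sigma>: "\<And>i. i < g \<Longrightarrow> \<rho> i = q * \<sigma> i" by blast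
  have "q * monom 1 g = q * (\<Sum>i<g. \<sigma> i * monom 1 i)"
    unfolding q(4) sum_distrib_left by (intro sum.cong) (auto simp: \<sigma> mult.assoc)
  hence mon: "monom 1 g = (\<Sum>i<g. \<sigma> i * monom 1 i)" using q(2) by simp
  define I where "I = {i. i < g \<and> \<sigma> i \<noteq> 0}"
  have mon: "monom 1 g = (\<Sum>i\<in>I. \<sigma> i * monom 1 i)"
    unfolding mon I_def by (intro sum.mono_neutral_right) auto
  have "finite I" by (simp add: I_def)
  have "monom (1::complex) g \<noteq> 0" by simp
  hence "I \<noteq> {}" using mon by auto
  have deg: "degree (\<sigma> i * monom 1 i) = degree (\<sigma> i) + i" if "i \<in> I" for i
    using that by (simp add: I_def degree_mult_eq degree_monom_eq)
  have gd: "g dvd degree (\<sigma> i)" if "i \<in> I" for i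
  proof -
    have "\<rho> i \<noteq> 0" "\<rho> i \<in> R" using that \<sigma>[of i] q(2) q(3)[of i] by (auto simp: I_def)
    hence "g dvd degree (\<rho> i)" "g dvd degree q" using R_degree q(1,2) by blast+
    moreover have "degree (\<rho> i) = degree q + degree (\<sigma> i)"
      using that q(2) \<sigma>[of i] by (simp add: I_def degree_mult_eq)
    ultimately show ?thesis by (metis dvd_add_right_iff)
  qed
  have "inj_on (\<lambda>i. degree (\<sigma> i * monom 1 i)) I"
  proof
    fix i j assume ij: "i \<in> I" "j \<in> I" "degree (\<sigma> i * monom 1 i) = degree (\<sigma> j * monom 1 j)"
    hence "(degree (\<sigma> i) + i) mod g = (degree (\<sigma> j) + j) mod g" by (simp only: deg)
    thus "i = j" using gd[OF ij(1)] gd[OF ij(2)] ij(1,2) by (auto simp: I_def elim!: dvdE)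
  qed
  then obtain i where i: "i \<in> I" "degree (monom (1::complex) g) = degree (\<sigma> i * monom 1 i)"
    using degree_sum_distinct[of I "\<lambda>i. \<sigma> i * monom 1 i"] \<open>finite I\<close> \<open>I \<noteq> {}\<close>
    unfolding mon by (auto simp: I_def)
  \<comment> \<open>The term that carries the degree \<open>g\<close> of the left-hand side has an
    index divisible by \<open>g\<close> and less than \<open>g\<close>, so it is the constant
    term.\<close>
  hence eq: "g = degree (\<sigma> i) + i" by (simp add: deg degree_monom_eq)
  hence "g dvd i" using gd[OF i(1)] by (metis dvd_add_right_iff dvd_refl)
  hence "i = 0" using i(1) by (auto simp: I_def dest: dvd_imp_le)
  hence "degree (\<sigma> 0) = g" using eq by simp
  moreover have "q * \<sigma> 0 \<in> R" using \<sigma>[of 0] q(3)[of 0] gpos by simp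
  ultimately show ?thesis using q by blast
qed

text \<open>Every nonzero \<open>F\<close> with \<open>q ^ k * F\<close> in \<open>R\<close> has
  degree divisible by \<open>g = degree V\<close>. Subtracting a multiple of a power of
  \<open>V\<close> lowers the degree and stays in this class for a larger \<open>k\<close>, so
  \<open>F\<close> is a polynomial in \<open>V\<close>.\<close>

lemma right_factor_gcd: "\<exists>V U1 U2. degree V = g \<and> W1 = U1 \<circ>\<^sub>p V \<and> W2 = U2 \<circ>\<^sub>p V"
proof -
  obtain V q where V: "degree V = g" "q \<in> R" "q \<noteq> 0" "q * V \<in> R" using generator_exists by blast
  have *: "\<exists>U. F = U \<circ>\<^sub>p V" if "degree F < n" "q ^ k * F \<in> R" for F k n
    using that
  proof (induction n arbitrary: F k)
    case 0
    then show ?case by simp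
  next
    case (Suc n)
    show ?case
    proof (cases "degree F = 0")
      case True
      then obtain c where "F = [:c:]" by (metis degree_eq_zeroE)
      thus ?thesis by (intro exI[of _ "[:c:]"]) simp
    next
      case False
      hence "F \<noteq> 0" by auto
      have "g dvd degree (q ^ k * F)" "g dvd degree (q ^ k)"
        using R_degree[OF Suc.prems(2)] R_degree[OF R_power[OF V(2)], of k] V(3) \<open>F \<noteq> 0\<close> by auto
      moreover have "degree (q ^ k * F) = degree (q ^ k) + degree F"
        using V(3) \<open>F \<noteq> 0\<close> by (simp add: degree_mult_eq)
      ultimately have "g dvd degree F" by (metis dvd_add_right_iff)
      then obtain j where j: "degree F = g * j" by auto
      have "V \<noteq> 0" using V(1) gpos by auto
      define c where "c = lead_coeff F / lead_coeff (V ^ j)"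
      define F' where "F' = F - smult c (V ^ j)"
      have dV: "degree (V ^ j) = degree F" using V(1) j \<open>V \<noteq> 0\<close> by (simp add: degree_power_eq)
      have nz: "lead_coeff (V ^ j) \<noteq> 0" using \<open>V \<noteq> 0\<close> by simp
      have "coeff F' i = 0" if "i \<ge> degree F" for i
        using nz that unfolding F'_def c_def
        by (cases "i = degree F") (auto simp: dV coeff_eq_0)
      hence "F' = 0 \<or> degree F' < degree F" by (rule coeff_eq_0_from_imp)
      hence "degree F' < n" using Suc.prems(1) False by auto
      moreover have "q ^ (k + j) * F' \<in> R"
      proof -
        have "q ^ (k + j) * F' = q ^ j * (q ^ k * F) - smult c (q ^ k * (q * V) ^ j)"
          by (simp add: F'_def right_diff_distrib power_add power_mult_distrib mult_ac)
        also have "\<dots> \<in> R"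
          by (rule R_diff[OF R_mult[OF R_power[OF V(2)] Suc.prems(2)]
                R_smult[OF R_mult[OF R_power[OF V(2)] R_power[OF V(4)]]]])
        finally show ?thesis .
      qed
      ultimately obtain U where "F' = U \<circ>\<^sub>p V" using Suc.IH by blast
      hence "F = (U + monom c j) \<circ>\<^sub>p V" by (simp add: F'_def pcompose_add pcompose_monom algebra_simps)
      thus ?thesis by blast
    qed
  qed
  obtain U1 where "W1 = U1 \<circ>\<^sub>p V" using *[of W1 "Suc (degree W1)" 0] R_W1 by auto
  moreover obtain U2 where "W2 = U2 \<circ>\<^sub>p V" using *[of W2 "Suc (degree W2)" 0] R_W2 by auto
  ultimately show ?thesis using V(1) by blast
qed

text \<open>For \<open>g = 1\<close> both \<open>q\<close> and \<open>q * monom 1 1\<close> lie in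
  \<open>R\<close>. Elements of \<open>R\<close> do not separate points at which \<open>W1\<close>
  and \<open>W2\<close> agree, so \<open>q\<close> vanishes there: \<open>(W1, W2)\<close> is
  injective off a finite set.\<close>

lemma agree_generic:
  assumes "g = 1"
  shows "\<exists>q. q \<noteq> 0 \<and> (\<forall>x y. poly W1 x = poly W1 y \<and> poly W2 x = poly W2 y \<and> x \<noteq> y \<longrightarrow> poly q x = 0)"
proof -
  obtain q \<rho> where "q \<in> R" "q \<noteq> 0" "\<forall>i<g. \<rho> i \<in> R" "q * monom 1 g = (\<Sum>i<g. \<rho> i * monom 1 i)"
    using integral_relation unfolding M_def by blast
  hence q: "q \<in> R" "q \<noteq> 0" "\<rho> 0 \<in> R" "q * monom 1 1 = \<rho> 0" using assms by auto
  have "poly q x = 0" if "poly W1 x = poly W1 y" "poly W2 x = poly W2 y" "x \<noteq> y" for x y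
  proof -
    have "poly (q * monom 1 1) x = poly (q * monom 1 1) y" using R_agree[OF _ that(1,2)] q by metis
    moreover have "poly q x = poly q y" using R_agree[OF q(1) that(1,2)] .
    ultimately show ?thesis using that(3) by (simp add: poly_monom)
  qed
  thus ?thesis using q(2) by blast
qed

end

text \<open>Engstrom's theorem. Passing to a common composite of degree lcm makes the degrees of the
  left factors coprime, on which all degree arguments in \<open>R\<close> rest.\<close>

theorem gcd_right_factor:
  fixes Q :: "complex poly"
  assumes "Q = A1 \<circ>\<^sub>p W1" "Q = A2 \<circ>\<^sub>p W2" "degree Q > 0"
  shows "\<exists>V U1 U2. degree V = gcd (degree W1) (degree W2) \<and> W1 = U1 \<circ>\<^sub>p V \<and> W2 = U2 \<circ>\<^sub>p V"
proof -
  obtain A B where AB: "A \<circ>\<^sub>p W1 = B \<circ>\<^sub>p W2" "degree (A \<circ>\<^sub>p W1) = lcm (degree W1) (degree W2)"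
    using common_composite_lcm[OF assms] by blast
  have pos: "degree W1 > 0" "degree W2 > 0"
    using assms degree_pcompose[of A1 W1] degree_pcompose[of A2 W2] by (auto intro!: gr0I)
  define g where "g = gcd (degree W1) (degree W2)"
  have "g \<noteq> 0" using pos by (simp add: g_def)
  then obtain p r where "degree W1 = p * g" "degree W2 = r * g" "coprime p r"
    using gcd_coprime_exists[of "degree W1" "degree W2"] unfolding g_def by blast
  hence pr: "degree W1 = g * p" "degree W2 = g * r" "coprime p r" by simp_all
  have gp: "g > 0" "p > 0" "r > 0" using pos pr by auto
  have l: "lcm (degree W1) (degree W2) = g * p * r"
    using pr gp by (simp add: lcm_mult_left lcm_coprime)
  have "degree A * (g * p) = r * (g * p)" using AB(2) l pr degree_pcompose[of A W1] by (simp add: mult_ac)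
  hence dA: "degree A = r" using gp by simp
  have "degree B * (g * r) = p * (g * r)" using AB l pr degree_pcompose[of B W2] by (simp add: mult_ac)
  hence dB: "degree B = p" using gp by simp
  interpret coprime_composite A B W1 W2 g p r
    by unfold_locales (use AB pr gp dA dB in auto)
  show ?thesis using right_factor_gcd by (simp add: g_def)
qed

section \<open>Ramification and Ritt's second theorem\<close>

lemma order_power: "p \<noteq> 0 \<Longrightarrow> order x (p ^ n) = n * order x (p :: 'a::idom poly)"
  by (induction n) (simp_all add: order_mult)

definition ramif :: "complex poly \<Rightarrow> complex \<Rightarrow> nat" where
  "ramif P t = order t (P - [:poly P t:])"

lemma diff_const_nonzero: "degree P > 0 \<Longrightarrow> P - [:c:] \<noteq> 0" for P :: "complex poly"
  by (metis degree_pCons_0 eq_iff_diff_eq_0 less_numeral_extra(3))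

lemma degree_diff_const: "degree (P - [:c:]) = degree P" for P :: "complex poly"
proof (cases "degree P = 0")
  case True
  then obtain a where "P = [:a:]" by (metis degree_eq_zeroE)
  thus ?thesis by simp
next
  case False
  thus ?thesis by (simp add: degree_add_eq_left diff_conv_add_uminus del: add_uminus_conv_diff)
qed

lemma degree_add_const: "degree (P + [:b:]) = degree P" for P :: "complex poly"
proof -
  have "P + [:b:] = P - [:-b:]" by simp
  thus ?thesis by (simp only: degree_diff_const)
qed

lemma finite_fiber: "degree P > 0 \<Longrightarrow> finite {t. poly P t = c}" for P :: "complex poly"
  using poly_roots_finite[OF diff_const_nonzero[of P c]] by simp

lemma ramif_pos: "degree P > 0 \<Longrightarrow> ramif P t \<ge> 1"
  using order_gt_0_iff[OF diff_const_nonzero[of P "poly P t"], of t] by (simp add: ramif_def Suc_le_eq)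

lemma count_proots_fiber:
  "degree P > 0 \<Longrightarrow> poly P t = c \<Longrightarrow> count (proots (P - [:c:])) t = ramif P t"
  using diff_const_nonzero[of P c] by (simp add: ramif_def)

lemma sum_ramif_fiber: "degree P > 0 \<Longrightarrow> (\<Sum>t | poly P t = c. ramif P t) = degree P"
proof -
  assume *: "degree P > 0"
  have "degree P = size (proots (P - [:c:]))" by (simp add: size_proots_complex degree_diff_const)
  also have "\<dots> = (\<Sum>t\<in>set_mset (proots (P - [:c:])). count (proots (P - [:c:])) t)"
    by (simp only: size_multiset_overloaded_eq)
  also have "\<dots> = (\<Sum>t | poly P t = c. ramif P t)"
    using diff_const_nonzero[OF *, of c] by (intro sum.cong) (auto simp: ramif_def)
  finally show ?thesis by simp
qed

lemma ramif_pcompose: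
  assumes "degree A > 0" "degree U > 0"
  shows "ramif (A \<circ>\<^sub>p U) t = ramif A (poly U t) * ramif U t"
proof -
  define x where "x = poly U t"
  define D where "D = A - [:poly A x:]"
  have "D \<noteq> 0" using diff_const_nonzero assms by (simp add: D_def)
  then obtain S where S: "D = [:-x, 1:] ^ order x D * S" "\<not> [:-x, 1:] dvd S" using order_decomp by blast
  have "poly S x \<noteq> 0" using S(2) by (simp add: poly_eq_0_iff_dvd)
  hence S0: "S \<circ>\<^sub>p U \<noteq> 0" "order t (S \<circ>\<^sub>p U) = 0"
    by (metis poly_0 poly_pcompose x_def, simp add: order_0I poly_pcompose x_def)
  have "A \<circ>\<^sub>p U - [:poly (A \<circ>\<^sub>p U) t:] = D \<circ>\<^sub>p U"
    by (simp add: D_def pcompose_diff poly_pcompose x_def)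
  also have "\<dots> = (U - [:x:]) ^ order x D * (S \<circ>\<^sub>p U)"
  proof -
    have "[:-x, 1:] \<circ>\<^sub>p U = U - [:x:]"
      by (simp add: pcompose_pCons diff_conv_add_uminus add.commute del: add_uminus_conv_diff)
    thus ?thesis by (subst S(1)) (simp add: pcompose_mult pcompose_power)
  qed
  finally show ?thesis
    using diff_const_nonzero[OF assms(2), of x] S0
    by (simp add: ramif_def order_mult order_power flip: x_def D_def)
qed

lemma order_pderiv_ramif:
  assumes "degree P > 0" shows "order t (pderiv P) = ramif P t - 1"
proof -
  have "pderiv (P - [:poly P t:]) = pderiv P" by (simp add: pderiv_diff pderiv_pCons)
  thus ?thesis using order_pderiv[OF diff_const_nonzero[OF assms, of "poly P t"], of t]
    by (simp add: ramif_def)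
qed

lemma pderiv_nonzero: "degree P > 0 \<Longrightarrow> pderiv P \<noteq> 0" for P :: "complex poly"
  by (simp add: pderiv_eq_0_iff)

lemma sum_ramif_all:
  assumes "degree P > 0" "finite S" "{t. poly (pderiv P) t = 0} \<subseteq> S"
  shows "(\<Sum>t\<in>S. ramif P t - 1) = degree P - 1"
proof -
  have "degree P - 1 = size (proots (pderiv P))" by (simp add: size_proots_complex degree_pderiv)
  also have "\<dots> = (\<Sum>t\<in>set_mset (proots (pderiv P)). count (proots (pderiv P)) t)"
    by (simp only: size_multiset_overloaded_eq)
  also have "\<dots> = (\<Sum>t | poly (pderiv P) t = 0. ramif P t - 1)"
    using pderiv_nonzero[OF assms(1)] order_pderiv_ramif[OF assms(1)] by (intro sum.cong) auto
  also have "\<dots> = (\<Sum>t\<in>S. ramif P t - 1)"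
  proof (intro sum.mono_neutral_left assms ballI)
    fix t assume "t \<in> S - {t. poly (pderiv P) t = 0}"
    thus "ramif P t - 1 = 0" using order_pderiv_ramif[OF assms(1), of t] by (simp add: order_0I)
  qed
  finally show ?thesis by simp
qed

lemma sum_ramif_le:
  assumes "degree P > 0" "finite S"
  shows "(\<Sum>t\<in>S. ramif P t - 1) \<le> degree P - 1"
proof -
  have fin: "finite {t. poly (pderiv P) t = 0}" using poly_roots_finite pderiv_nonzero[OF assms(1)] by blast
  have "(\<Sum>t\<in>S. ramif P t - 1) \<le> (\<Sum>t\<in>S \<union> {t. poly (pderiv P) t = 0}. ramif P t - 1)"
    using assms fin by (intro sum_mono2) auto
  also have "\<dots> = degree P - 1" using assms fin by (intro sum_ramif_all) auto
  finally show ?thesis .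
qed

text \<open>Riemann-Hurwitz for a polynomial map, in the form used by all later counts: the fibres
  over \<open>C\<close> together miss at most \<open>degree P - 1\<close> points.\<close>

lemma sum_card_fibers_ge:
  fixes P :: "complex poly"
  assumes "degree P > 0" "finite C"
  shows "card C * degree P + 1 \<le> (\<Sum>c\<in>C. card {t. poly P t = c}) + degree P"
proof -
  have fib: "(\<Sum>t | poly P t = c. ramif P t - 1) + card {t. poly P t = c} = degree P" for c
  proof -
    have "(\<Sum>t | poly P t = c. ramif P t - 1) + card {t. poly P t = c}
        = (\<Sum>t | poly P t = c. (ramif P t - 1) + 1)" by (simp add: sum.distrib del: One_nat_def)
    also have "\<dots> = (\<Sum>t | poly P t = c. ramif P t)"
    proof (rule sum.cong[OF refl])
      show "ramif P t - 1 + 1 = ramif P t" for t using ramif_pos[OF assms(1), of t] by simp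
    qed
    finally show ?thesis using sum_ramif_fiber[OF assms(1)] by simp
  qed
  have "(\<Sum>c\<in>C. \<Sum>t | poly P t = c. ramif P t - 1) = (\<Sum>t\<in>(\<Union>c\<in>C. {t. poly P t = c}). ramif P t - 1)"
    using assms finite_fiber by (intro sum.UNION_disjoint[symmetric]) auto
  also have "\<dots> \<le> degree P - 1" using assms finite_fiber by (intro sum_ramif_le) auto
  finally have "(\<Sum>c\<in>C. \<Sum>t | poly P t = c. ramif P t - 1) \<le> degree P - 1" .
  moreover have "(\<Sum>c\<in>C. \<Sum>t | poly P t = c. ramif P t - 1) + (\<Sum>c\<in>C. card {t. poly P t = c}) = card C * degree P"
    unfolding sum.distrib[symmetric] fib by simp
  ultimately show ?thesis using assms(1) by linarith
qed

text \<open>The product \<open>\<Prod>\<^sub>t (poly W2 t - y)\<close> over the fibre \<open>W1 t = x\<close> is, by exchanging the two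
  products of linear factors, also a polynomial in \<open>x\<close> for fixed \<open>y\<close>.\<close>

lemma fiber_product_poly:
  fixes W1 W2 :: "complex poly"
  assumes "degree W1 > 0" "degree W2 > 0"
  shows "\<exists>H. \<forall>x. (\<Prod>t\<in>#proots (W1 - [:x:]). poly W2 t - y) = poly H x"
proof -
  define N where "N = proots (W2 - [:y:])"
  define w1 w2 where "w1 = lead_coeff W1" and "w2 = lead_coeff W2"
  have lc: "lead_coeff (P - [:c:]) = lead_coeff P" if "degree P > 0" for P :: "complex poly" and c
    using that by (simp add: degree_diff_const coeff_pCons split: nat.splits)
  have w: "w1 \<noteq> 0" using assms by (auto simp: w1_def)
  have d2: "poly W2 t - y = w2 * (\<Prod>s\<in>#N. t - s)" for t
  proof -
    have "poly W2 t - y = poly (smult w2 (\<Prod>s\<in>#N. [:-s, 1:])) t"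
      using complex_poly_decompose_multiset[of "W2 - [:y:]"] lc[OF assms(2), of y]
      by (simp add: N_def w2_def)
    thus ?thesis by (simp add: poly_prod_mset)
  qed
  have d1: "(\<Prod>t\<in>#proots (W1 - [:x:]). t - s) = poly (smult ((-1) ^ degree W1 / w1) [:poly W1 s, -1:]) x" for x s
  proof -
    have "poly W1 s - x = poly (smult w1 (\<Prod>t\<in>#proots (W1 - [:x:]). [:-t, 1:])) s"
      using complex_poly_decompose_multiset[of "W1 - [:x:]"] lc[OF assms(1), of x]
      by (simp add: w1_def)
    also have "\<dots> = w1 * (\<Prod>t\<in>#proots (W1 - [:x:]). (-1) * (t - s))" by (simp add: poly_prod_mset)
    also have "(\<Prod>t\<in>#proots (W1 - [:x:]). (-1) * (t - s)) = (-1) ^ degree W1 * (\<Prod>t\<in>#proots (W1 - [:x:]). t - s)"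
      by (subst prod_mset.distrib) (simp add: size_proots_complex degree_diff_const)
    finally have "(-1) ^ degree W1 / w1 * (poly W1 s - x) = (\<Prod>t\<in>#proots (W1 - [:x:]). t - s)"
      using w by (simp flip: power_mult_distrib)
    thus ?thesis by (simp add: algebra_simps diff_divide_distrib)
  qed
  define H where "H = smult (w2 ^ degree W1) (\<Prod>s\<in>#N. smult ((-1) ^ degree W1 / w1) [:poly W1 s, -1:])"
  have "(\<Prod>t\<in>#proots (W1 - [:x:]). poly W2 t - y) = poly H x" for x
  proof -
    have "(\<Prod>t\<in>#proots (W1 - [:x:]). poly W2 t - y) = (\<Prod>t\<in>#proots (W1 - [:x:]). w2 * (\<Prod>s\<in>#N. t - s))"
      by (simp add: d2)
    also have "\<dots> = w2 ^ degree W1 * (\<Prod>t\<in>#proots (W1 - [:x:]). \<Prod>s\<in>#N. t - s)"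
      by (subst prod_mset.distrib) (simp add: size_proots_complex degree_diff_const)
    also have "(\<Prod>t\<in>#proots (W1 - [:x:]). \<Prod>s\<in>#N. t - s) = (\<Prod>s\<in>#N. \<Prod>t\<in>#proots (W1 - [:x:]). t - s)"
      by (rule prod_mset.swap)
    finally show ?thesis by (simp only: H_def poly_prod_mset poly_smult[of _ "prod_mset _"] d1)
  qed
  thus ?thesis by blast
qed

text \<open>For generic \<open>x\<close> the fibre of \<open>W1\<close> is simple and
  \<open>W2\<close> is injective on it, so its \<open>p\<close> values exhaust the roots of
  \<open>B - [:poly A x:]\<close>. Written as products, both sides depend polynomially on
  \<open>x\<close>, so the equality extends to all fibres with multiplicities.\<close>

lemma (in coprime_composite) fiber_multiset:
  assumes "g = 1"
  shows "image_mset (poly W2) (proots (W1 - [:x:])) = proots (B - [:poly A x:])"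
proof -
  have d1: "degree W1 = p" "degree W1 > 0" "degree W2 > 0" "degree B > 0" "degree A > 0"
    using deg1 deg2 degB degA assms ppos rpos by auto
  have AB: "poly A (poly W1 t) = poly B (poly W2 t)" for t by (metis comp poly_pcompose)
  define b where "b = lead_coeff B"
  have b: "b \<noteq> 0" using d1 by (auto simp: b_def)
  obtain q where q: "q \<noteq> 0" "\<And>x y. poly W1 x = poly W1 y \<Longrightarrow> poly W2 x = poly W2 y \<Longrightarrow> x \<noteq> y \<Longrightarrow> poly q x = 0"
    using agree_generic[OF assms] by blast
  define Bad where "Bad = poly W1 ` {t. poly q t = 0} \<union> poly W1 ` {t. poly (pderiv W1) t = 0}"
  have fin: "finite Bad" unfolding Bad_def
    using q(1) pderiv_nonzero[OF d1(2)] by (auto intro!: finite_imageI poly_roots_finite)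
  have lcB: "B - [:c:] = smult b (\<Prod>s\<in>#proots (B - [:c:]). [:-s, 1:])" for c
  proof -
    have "lead_coeff (B - [:c:]) = b" using d1
      by (simp add: b_def degree_diff_const coeff_pCons split: nat.splits)
    thus ?thesis using complex_poly_decompose_multiset[of "B - [:c:]"] by simp
  qed
  have generic: "image_mset (poly W2) (proots (W1 - [:x:])) = proots (B - [:poly A x:])" if x: "x \<notin> Bad" for x
  proof -
    define T where "T = {t. poly W1 t = x}"
    have fT: "finite T" unfolding T_def using finite_fiber d1 by simp
    have c1: "count (proots (W1 - [:x:])) t = count (mset_set T) t" for t
    proof (cases "t \<in> T")
      case True
      hence "poly (pderiv W1) t \<noteq> 0" using x by (auto simp: T_def Bad_def)
      hence "ramif W1 t = 1" using order_pderiv_ramif[OF d1(2), of t] ramif_pos[OF d1(2), of t]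
        by (simp add: order_0I)
      thus ?thesis using True count_proots_fiber[OF d1(2), of t x] fT by (simp add: T_def)
    next
      case False
      thus ?thesis using diff_const_nonzero[OF d1(2), of x] fT by (simp add: T_def order_0I)
    qed
    hence M: "proots (W1 - [:x:]) = mset_set T" by (intro multiset_eqI)
    have inj: "inj_on (poly W2) T"
    proof (rule inj_onI, rule ccontr)
      fix t u assume "t \<in> T" "u \<in> T" "poly W2 t = poly W2 u" "t \<noteq> u"
      hence "poly q t = 0" using q(2)[of t u] by (simp add: T_def)
      thus False using x \<open>t \<in> T\<close> by (auto simp: T_def Bad_def)
    qed
    have "mset_set (poly W2 ` T) \<subseteq># proots (B - [:poly A x:])"
    proof (rule mset_subset_eqI)
      fix y
      show "count (mset_set (poly W2 ` T)) y \<le> count (proots (B - [:poly A x:])) y"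
      proof (cases "y \<in> poly W2 ` T")
        case True
        hence "poly B y = poly A x" using AB by (auto simp: T_def)
        hence "count (proots (B - [:poly A x:])) y \<ge> 1"
          using count_proots_fiber[OF d1(4) \<open>poly B y = poly A x\<close>] ramif_pos[OF d1(4), of y] by linarith
        thus ?thesis using True fT by simp
      qed (use fT in simp)
    qed
    moreover have "size (mset_set (poly W2 ` T)) = p"
      using inj M size_proots_complex[of "W1 - [:x:]"] by (simp add: card_image degree_diff_const d1(1))
    moreover have "size (proots (B - [:poly A x:])) = p"
      by (simp add: size_proots_complex degree_diff_const degB)
    ultimately have "mset_set (poly W2 ` T) = proots (B - [:poly A x:])"
      by (metis mset_subset_size order_less_irrefl subset_mset.le_neq_trans)
    thus ?thesis using M inj by (simp add: image_mset_mset_set)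
  qed
  have all: "poly B y - poly A x = b * (-1) ^ p * (\<Prod>t\<in>#proots (W1 - [:x:]). poly W2 t - y)" for x y
  proof -
    obtain H where H: "\<And>x. (\<Prod>t\<in>#proots (W1 - [:x:]). poly W2 t - y) = poly H x"
      using fiber_product_poly[OF d1(2,3)] by blast
    define D where "D = smult (b * (-1) ^ p) H - ([:poly B y:] - A)"
    have "poly D x = 0" if "x \<notin> Bad" for x
    proof -
      have "poly B y - poly A x = poly (B - [:poly A x:]) y" by simp
      also have "\<dots> = b * (\<Prod>s\<in>#proots (B - [:poly A x:]). y - s)"
        by (subst lcB) (simp add: poly_prod_mset)
      also have "\<dots> = b * (\<Prod>t\<in>#proots (W1 - [:x:]). (-1) * (poly W2 t - y))"
        by (simp add: image_mset.compositionality comp_def flip: generic[OF that])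
      also have "\<dots> = b * (-1) ^ p * poly H x"
        by (subst prod_mset.distrib) (simp add: size_proots_complex degree_diff_const d1(1) H)
      finally show ?thesis by (simp add: D_def)
    qed
    hence "- Bad \<subseteq> {x. poly D x = 0}" by auto
    moreover have "infinite (- Bad)" using fin infinite_UNIV_char_0 by (simp add: Compl_eq_Diff_UNIV Diff_infinite_finite)
    ultimately have "D = 0" using poly_roots_finite finite_subset by blast
    hence "poly D x = 0" for x by simp
    thus ?thesis using H by (simp add: D_def)
  qed
  have "B - [:poly A x:] = smult b (\<Prod>t\<in>#proots (W1 - [:x:]). [:-poly W2 t, 1:])"
  proof (rule poly_eq_poly_eq_iff[THEN iffD1, OF ext])
    fix y
    have "poly (smult b (\<Prod>t\<in>#proots (W1 - [:x:]). [:-poly W2 t, 1:])) y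
       = b * (\<Prod>t\<in>#proots (W1 - [:x:]). (-1) * (poly W2 t - y))" by (simp add: poly_prod_mset)
    also have "\<dots> = b * (-1) ^ p * (\<Prod>t\<in>#proots (W1 - [:x:]). poly W2 t - y)"
      by (subst prod_mset.distrib) (simp add: size_proots_complex degree_diff_const d1(1))
    finally show "poly (B - [:poly A x:]) y = poly (smult b (\<Prod>t\<in>#proots (W1 - [:x:]). [:-poly W2 t, 1:])) y"
      using all[of y x] by (simp del: poly_smult)
  qed
  hence "proots (B - [:poly A x:]) = proots (\<Prod>t\<in>#proots (W1 - [:x:]). [:-poly W2 t, 1:])"
    using b by simp
  also have "\<dots> = (\<Sum>t\<in>#proots (W1 - [:x:]). proots [:-poly W2 t, 1:])"
  proof -
    have nz: "0 \<notin># image_mset (\<lambda>t. [:-poly W2 t, 1:]) (proots (W1 - [:x:]))" by auto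
    show ?thesis using proots_prod_mset[OF nz] by (simp add: image_mset.compositionality comp_def)
  qed
  also have "\<dots> = image_mset (poly W2) (proots (W1 - [:x:]))" by simp
  finally show ?thesis by simp
qed

lemma (in coprime_composite) sum_ramif_fiber_pair:
  assumes "g = 1" "poly A x = poly B y"
  shows "(\<Sum>t | poly W1 t = x \<and> poly W2 t = y. ramif W1 t) = ramif B y"
proof -
  have d1: "degree W1 > 0" "degree B > 0"
    using deg1 degB assms ppos by auto
  have "ramif B y = count (proots (B - [:poly A x:])) y"
    using count_proots_fiber[OF d1(2)] assms by simp
  also have "\<dots> = (\<Sum>t\<in>poly W2 -` {y} \<inter> set_mset (proots (W1 - [:x:])). count (proots (W1 - [:x:])) t)"
    by (simp flip: fiber_multiset[OF assms(1)] add: count_image_mset)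
  also have "\<dots> = (\<Sum>t | poly W1 t = x \<and> poly W2 t = y. ramif W1 t)"
    using diff_const_nonzero[OF d1(1), of x] by (intro sum.cong) (auto simp: ramif_def)
  finally show ?thesis by simp
qed

lemma (in coprime_composite) swapped: "coprime_composite B A W2 W1 g r p"
  using comp deg1 deg2 degA degB gpos ppos rpos cop
  by (intro coprime_composite.intro) (auto simp: coprime_commute)

section \<open>Combinatorial classification of ramification data\<close>

lemma two_le_add_minus_gcd:
  fixes a b :: int
  assumes "a \<ge> 2" "b \<ge> 2" "a \<noteq> b"
  shows "a + b - 2 * gcd a b \<ge> 2"
proof -
  define g where "g = gcd a b"
  have g: "g \<ge> 1" using assms by (simp add: g_def int_one_le_iff_zero_less)
  obtain a' b' where ab: "a = g * a'" "b = g * b'" unfolding g_def by (meson dvdE gcd_dvd1 gcd_dvd2)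
  have "a' \<noteq> b'" using ab assms by auto
  have "a' \<ge> 1" "b' \<ge> 1" using ab g assms by (smt (verit) mult_nonneg_nonpos)+
  hence "a' + b' - 2 \<ge> 1" using \<open>a' \<noteq> b'\<close> by linarith
  show ?thesis
  proof (cases "g = 1")
    case True
    thus ?thesis using assms unfolding g_def[symmetric] by linarith
  next
    case False
    hence "g * (a' + b' - 2) \<ge> 2 * 1" using g \<open>a' + b' - 2 \<ge> 1\<close> by (intro mult_mono) auto
    moreover have "a + b - 2 * g = g * (a' + b' - 2)" using ab by (simp add: algebra_simps)
    ultimately show ?thesis by (simp add: g_def)
  qed
qed

lemma sum_ge_two_terms:
  fixes t :: "'x \<Rightarrow> 'y \<Rightarrow> int"
  assumes "finite X" "finite Y" "\<And>x y. x \<in> X \<Longrightarrow> y \<in> Y \<Longrightarrow> t x y \<ge> 0"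
    and "x \<in> X" "y \<in> Y" "x' \<in> X" "y' \<in> Y" "(x, y) \<noteq> (x', y')"
  shows "t x y + t x' y' \<le> (\<Sum>x\<in>X. \<Sum>y\<in>Y. t x y)"
proof -
  have "t x y + t x' y' = (\<Sum>z\<in>{(x, y), (x', y')}. t (fst z) (snd z))" using assms(8) by simp
  also have "\<dots> \<le> (\<Sum>z\<in>X \<times> Y. t (fst z) (snd z))" using assms by (intro sum_mono2) auto
  also have "\<dots> = (\<Sum>x\<in>X. \<Sum>y\<in>Y. t x y)" by (simp add: sum.cartesian_product case_prod_unfold)
  finally show ?thesis .
qed

text \<open>\<open>al\<close> and \<open>be\<close> are the ramification indices of two polynomials of coprime degrees \<open>n\<close> and \<open>m\<close>
  over the points of \<open>C\<close>; the last two inequalities express that their fibre product is rational.\<close>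

locale ramification_data =
  fixes C :: "'c set" and X :: "'c \<Rightarrow> 'x set" and Y :: "'c \<Rightarrow> 'y set"
    and al :: "'x \<Rightarrow> int" and be :: "'y \<Rightarrow> int" and n m :: int
  assumes finC: "finite C"
    and finX: "\<And>c. c \<in> C \<Longrightarrow> finite (X c)" and finY: "\<And>c. c \<in> C \<Longrightarrow> finite (Y c)"
    and al1: "\<And>c x. c \<in> C \<Longrightarrow> x \<in> X c \<Longrightarrow> al x \<ge> 1"
    and be1: "\<And>c y. c \<in> C \<Longrightarrow> y \<in> Y c \<Longrightarrow> be y \<ge> 1"
    and sum_al: "\<And>c. c \<in> C \<Longrightarrow> (\<Sum>x\<in>X c. al x) = n"
    and sum_be: "\<And>c. c \<in> C \<Longrightarrow> (\<Sum>y\<in>Y c. be y) = m"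
    and sum_r: "(\<Sum>c\<in>C. \<Sum>x\<in>X c. al x - 1) = n - 1"
    and sum_s: "(\<Sum>c\<in>C. \<Sum>y\<in>Y c. be y - 1) = m - 1"
    and RH_m: "(\<Sum>c\<in>C. \<Sum>x\<in>X c. \<Sum>y\<in>Y c. be y - gcd (al x) (be y)) \<le> m - 1"
    and RH_n: "(\<Sum>c\<in>C. \<Sum>x\<in>X c. \<Sum>y\<in>Y c. al x - gcd (al x) (be y)) \<le> n - 1"
    and cop: "coprime n m"
begin

definition "r c = n - int (card (X c))"
definition "s c = m - int (card (Y c))"
definition "l c = int (card {x\<in>X c. al x = 1})"
definition "F c = (\<Sum>x\<in>X c. \<Sum>y\<in>Y c. be y - gcd (al x) (be y))"

lemma swapped: "ramification_data C Y X be al m n"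
proof -
  have eq: "(\<Sum>c\<in>C. \<Sum>y\<in>Y c. \<Sum>x\<in>X c. f x y) = (\<Sum>c\<in>C. \<Sum>x\<in>X c. \<Sum>y\<in>Y c. f x y)" for f :: "'x \<Rightarrow> 'y \<Rightarrow> int"
    by (intro sum.cong refl sum.swap)
  show ?thesis
    using finC finX finY al1 be1 sum_al sum_be sum_r sum_s RH_m RH_n cop
    by unfold_locales (auto simp: eq gcd.commute[of "be _"] coprime_commute)
qed

lemma r_eq: "c \<in> C \<Longrightarrow> (\<Sum>x\<in>X c. al x - 1) = r c"
  by (simp add: sum_subtractf sum_al r_def)

lemma s_eq: "c \<in> C \<Longrightarrow> (\<Sum>y\<in>Y c. be y - 1) = s c"
  by (simp add: sum_subtractf sum_be s_def)

lemma sum_r': "(\<Sum>c\<in>C. r c) = n - 1" using sum_r by (simp add: r_eq)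
lemma sum_s': "(\<Sum>c\<in>C. s c) = m - 1" using sum_s by (simp add: s_eq)
lemma sum_F: "(\<Sum>c\<in>C. F c) \<le> m - 1" using RH_m by (simp add: F_def)

lemma r_nonneg: "c \<in> C \<Longrightarrow> r c \<ge> 0"
  unfolding r_eq[symmetric] using al1 by (intro sum_nonneg) fastforce

lemma s_nonneg: "c \<in> C \<Longrightarrow> s c \<ge> 0"
  unfolding s_eq[symmetric] using be1 by (intro sum_nonneg) fastforce

lemma term_nonneg: "c \<in> C \<Longrightarrow> y \<in> Y c \<Longrightarrow> be y - gcd (al x) (be y) \<ge> 0"
  using be1[of c y] by (smt (verit) gcd_le2_int)

text \<open>A point with \<open>al x = 1\<close> leaves every \<open>be y - 1\<close> undiminished
  and so contributes the full \<open>s c\<close>.\<close>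

lemma F_split: "c \<in> C \<Longrightarrow>
  F c = l c * s c + (\<Sum>x\<in>{x\<in>X c. al x \<noteq> 1}. \<Sum>y\<in>Y c. be y - gcd (al x) (be y))"
proof -
  assume c: "c \<in> C"
  have "X c = {x\<in>X c. al x = 1} \<union> {x\<in>X c. al x \<noteq> 1}" by auto
  hence "F c = (\<Sum>x\<in>{x\<in>X c. al x = 1} \<union> {x\<in>X c. al x \<noteq> 1}. \<Sum>y\<in>Y c. be y - gcd (al x) (be y))"
    unfolding F_def by simp
  also have "\<dots> = (\<Sum>x\<in>{x\<in>X c. al x = 1}. \<Sum>y\<in>Y c. be y - gcd (al x) (be y))
      + (\<Sum>x\<in>{x\<in>X c. al x \<noteq> 1}. \<Sum>y\<in>Y c. be y - gcd (al x) (be y))"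
    using finX[OF c] by (intro sum.union_disjoint) auto
  also have "(\<Sum>x\<in>{x\<in>X c. al x = 1}. \<Sum>y\<in>Y c. be y - gcd (al x) (be y)) = (\<Sum>x\<in>{x\<in>X c. al x = 1}. s c)"
    by (intro sum.cong refl) (simp add: s_eq[OF c])
  finally show ?thesis by (simp add: l_def)
qed

lemma F_ge: "c \<in> C \<Longrightarrow> F c \<ge> l c * s c"
  unfolding F_split using term_nonneg by (simp add: sum_nonneg)

lemma F_nonneg: "c \<in> C \<Longrightarrow> F c \<ge> 0"
  using F_ge[of c] s_nonneg[of c] by (smt (verit) l_def mult_nonneg_nonneg of_nat_0_le_iff)

lemma l_ge: assumes c: "c \<in> C" shows "l c \<ge> n - 2 * r c"
proof -
  have "l c = (\<Sum>x\<in>X c. if al x = 1 then 1 else 0)"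
    using finX[OF c] by (simp add: l_def sum.If_cases Int_def)
  \<comment> \<open>Pointwise, \<open>2 - al x\<close> is 1 at a simple point and at most 0 at any
    other point.\<close>
  also have "\<dots> \<ge> (\<Sum>x\<in>X c. al x - 2 * (al x - 1))"
    using al1[OF c] by (intro sum_mono) fastforce
  also have "(\<Sum>x\<in>X c. al x - 2 * (al x - 1)) = n - 2 * r c"
    using c by (simp add: sum_subtractf sum_al r_def flip: sum_distrib_left)
  finally show ?thesis .
qed

text \<open>The ramification of Dickson polynomials. It is not symmetric: on the \<open>X\<close>
  side each of the two fibres has exactly one simple point, as for a Dickson polynomial of odd
  degree, so the classification also mentions the swapped version.\<close>

definition dihedral where
  "dihedral \<longleftrightarrow> (\<exists>c1\<in>C. \<exists>c2\<in>C. c1 \<noteq> c2 \<and>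
     (\<forall>c\<in>{c1, c2}. (\<forall>x\<in>X c. al x \<le> 2) \<and> (\<forall>y\<in>Y c. be y \<le> 2) \<and> card {x\<in>X c. al x = 1} = 1) \<and>
     (\<forall>c\<in>C - {c1, c2}. r c = 0 \<and> s c = 0))"

text \<open>Simple points give \<open>F c \<ge> s c\<close>, while the totals satisfy the opposite
  inequality; so equality holds for every \<open>c\<close>. Hence exactly one simple point lies over
  each \<open>c\<close> with \<open>s c > 0\<close>, and at all other points \<open>be y\<close>
  divides \<open>al x\<close>.\<close>

lemma all_simple:
  assumes simple: "\<And>c. c \<in> C \<Longrightarrow> s c > 0 \<Longrightarrow> l c \<ge> 1" and m: "m \<ge> 2" and n: "n \<ge> 2"
  shows "(\<exists>c\<in>C. card (Y c) = 1 \<and> card {x\<in>X c. al x = 1} = 1 \<and>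
            (\<forall>x\<in>X c. \<forall>y\<in>Y c. al x \<noteq> 1 \<longrightarrow> be y dvd al x)) \<or> dihedral"
proof -
  have Fs: "F c \<ge> s c" if "c \<in> C" for c
  proof (cases "s c > 0")
    case True
    hence "l c * s c \<ge> 1 * s c" using simple[OF that] by (intro mult_right_mono) auto
    thus ?thesis using F_ge[OF that] by simp
  next
    case False
    thus ?thesis using F_nonneg[OF that] by simp
  qed
  have FsE: "F c = s c" if "c \<in> C" for c
  proof (rule ccontr)
    assume "F c \<noteq> s c"
    hence "(\<Sum>c\<in>C. s c) < (\<Sum>c\<in>C. F c)" using Fs that finC by (intro sum_strict_mono_ex1) (auto intro!: bexI[of _ c] simp: less_le)
    thus False using sum_F sum_s' by simp
  qed
  have l1: "l c = 1" and rest: "(\<Sum>x\<in>{x\<in>X c. al x \<noteq> 1}. \<Sum>y\<in>Y c. be y - gcd (al x) (be y)) = 0"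
    if c: "c \<in> C" "s c > 0" for c
  proof -
    let ?R = "\<Sum>x\<in>{x\<in>X c. al x \<noteq> 1}. \<Sum>y\<in>Y c. be y - gcd (al x) (be y)"
    have "?R \<ge> 0" using term_nonneg[OF c(1)] by (intro sum_nonneg) auto
    moreover have "l c * s c + ?R = s c" using F_split[OF c(1)] FsE[OF c(1)] by simp
    moreover have "l c * s c \<ge> 1 * s c" using simple[OF c] c(2) by (intro mult_right_mono) auto
    ultimately show "l c = 1" "?R = 0" using c(2) by (smt (verit) mult_cancel_right1)+
  qed
  have dvd: "be y dvd al x" if c: "c \<in> C" "s c > 0" and xy: "x \<in> X c" "y \<in> Y c" "al x \<noteq> 1" for c x y
  proof -
    have "\<forall>x\<in>{x\<in>X c. al x \<noteq> 1}. (\<Sum>y\<in>Y c. be y - gcd (al x) (be y)) = 0"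
      using rest[OF c] finX[OF c(1)] term_nonneg[OF c(1)]
      by (subst (asm) sum_nonneg_eq_0_iff) (auto intro!: sum_nonneg)
    hence "(\<Sum>y\<in>Y c. be y - gcd (al x) (be y)) = 0" using xy by auto
    hence "be y - gcd (al x) (be y) = 0"
      using finY[OF c(1)] term_nonneg[OF c(1)] xy(2) by (subst (asm) sum_nonneg_eq_0_iff) auto
    thus ?thesis by (metis eq_iff_diff_eq_0 gcd_dvd1)
  qed
  define CB where "CB = {c\<in>C. s c > 0}"
  have CB: "finite CB" "CB \<subseteq> C" using finC by (auto simp: CB_def)
  have eq1: "(\<Sum>x\<in>{x\<in>X c. al x \<noteq> 1}. al x) = n - 1" if "c \<in> CB" for c
  proof -
    have c: "c \<in> C" "l c = 1" using that l1 by (auto simp: CB_def)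
    have "n = (\<Sum>x\<in>{x\<in>X c. al x = 1} \<union> {x\<in>X c. al x \<noteq> 1}. al x)"
      unfolding sum_al[OF c(1), symmetric] by (intro sum.cong) auto
    also have "\<dots> = (\<Sum>x\<in>{x\<in>X c. al x = 1}. al x) + (\<Sum>x\<in>{x\<in>X c. al x \<noteq> 1}. al x)"
      using finX[OF c(1)] by (intro sum.union_disjoint) auto
    also have "(\<Sum>x\<in>{x\<in>X c. al x = 1}. al x) = l c" by (simp add: l_def)
    finally show ?thesis using c by simp
  qed
  have eq2: "(\<Sum>x\<in>{x\<in>X c. al x \<noteq> 1}. al x - 1) = r c" if "c \<in> CB" for c
  proof -
    have c: "c \<in> C" using that by (auto simp: CB_def)
    show ?thesis unfolding r_eq[OF c, symmetric]
      using finX[OF c] by (intro sum.mono_neutral_left) auto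
  qed
  \<comment> \<open>All other indices are at least 2, so \<open>2 * r c \<ge> n - 1\<close>. As
    \<open>r\<close> sums to \<open>n - 1\<close>, at most two such \<open>c\<close> exist, and if
    there are two, no \<open>al\<close> over them exceeds 2.\<close>
  have ge: "2 * r c - (n - 1) = (\<Sum>x\<in>{x\<in>X c. al x \<noteq> 1}. al x - 2)" if "c \<in> CB" for c
    unfolding eq1[OF that, symmetric] eq2[OF that, symmetric]
    by (simp add: sum_distrib_left flip: sum_subtractf)
  have nonneg: "(\<Sum>x\<in>{x\<in>X c. al x \<noteq> 1}. al x - 2) \<ge> 0" if "c \<in> CB" for c
    using al1[of c] that by (intro sum_nonneg) (fastforce simp: CB_def)
  have ge': "2 * r c \<ge> n - 1" if "c \<in> CB" for c using ge[OF that] nonneg[OF that] by simp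
  have "int (card CB) * (n - 1) \<le> (\<Sum>c\<in>CB. 2 * r c)" using sum_bounded_below[of CB "n - 1" "\<lambda>c. 2 * r c"] ge' by simp
  also have "\<dots> \<le> (\<Sum>c\<in>C. 2 * r c)" using CB finC r_nonneg by (intro sum_mono2) auto
  also have "\<dots> = 2 * (n - 1)" using sum_r' by (simp flip: sum_distrib_left)
  finally have "int (card CB) * (n - 1) \<le> 2 * (n - 1)" .
  hence "int (card CB) \<le> 2" using n mult_right_le_imp_le[of "int (card CB)" "n - 1" 2] by simp
  have sCB: "(\<Sum>c\<in>CB. s c) = m - 1"
  proof -
    have "(\<Sum>c\<in>CB. s c) = (\<Sum>c\<in>C. s c)" using CB finC s_nonneg
      by (intro sum.mono_neutral_left) (auto simp: CB_def not_less intro: antisym)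
    thus ?thesis using sum_s' by simp
  qed
  hence "CB \<noteq> {}" using m by auto
  hence "card CB > 0" using CB by (simp add: card_gt_0_iff)
  hence "card CB = 1 \<or> card CB = 2" using \<open>int (card CB) \<le> 2\<close> by linarith
  thus ?thesis
  proof
    assume "card CB = 1"
    then obtain c where c: "CB = {c}" by (auto simp: card_1_singleton_iff)
    hence "s c = m - 1" "c \<in> C" "s c > 0" using sCB by (auto simp: CB_def)
    thus ?thesis using l1[of c] dvd[of c] by (intro disjI1 bexI[of _ c]) (auto simp: s_def l_def)
  next
    assume "card CB = 2"
    then obtain c1 c2 where c: "CB = {c1, c2}" "c1 \<noteq> c2" by (auto simp: card_2_iff)
    have cC: "c1 \<in> C" "c2 \<in> C" using c CB by auto
    have "C = {c1, c2} \<union> (C - {c1, c2})" using cC by auto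
    hence "(\<Sum>c\<in>C. r c) = (\<Sum>c\<in>{c1, c2}. r c) + (\<Sum>c\<in>C - {c1, c2}. r c)"
      using finC by (metis Diff_disjoint finite_Diff finite.emptyI finite.insertI sum.union_disjoint)
    hence sum: "r c1 + r c2 + (\<Sum>c\<in>C - {c1, c2}. r c) = n - 1" using c(2) sum_r' by simp
    have r12: "2 * r c1 \<ge> n - 1" "2 * r c2 \<ge> n - 1" using ge' c by auto
    have "(\<Sum>c\<in>C - {c1, c2}. r c) \<ge> 0" using r_nonneg by (intro sum_nonneg) auto
    hence tight: "(\<Sum>c\<in>C - {c1, c2}. r c) = 0" "2 * r c1 = n - 1" "2 * r c2 = n - 1"
      using sum r12 by linarith+
    have out: "\<forall>c\<in>C - {c1, c2}. r c = 0 \<and> s c = 0"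
    proof
      fix d assume d: "d \<in> C - {c1, c2}"
      have "r d = 0" using tight(1) finC r_nonneg d by (subst (asm) sum_nonneg_eq_0_iff) auto
      moreover have "s d = 0"
      proof -
        have "d \<notin> CB" "d \<in> C" using d c(1) by blast+
        thus ?thesis using s_nonneg[of d] by (simp add: CB_def)
      qed
      ultimately show "r d = 0 \<and> s d = 0" ..
    qed
    have inn: "(\<forall>x\<in>X d. al x \<le> 2) \<and> (\<forall>y\<in>Y d. be y \<le> 2) \<and> card {x\<in>X d. al x = 1} = 1" if d: "d \<in> {c1, c2}" for d
    proof -
      have dB: "d \<in> CB" "d \<in> C" "s d > 0" using d c(1) CB_def by blast+
      have "(\<Sum>x\<in>{x\<in>X d. al x \<noteq> 1}. al x - 2) = 0" using ge[OF dB(1)] tight d by auto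
      moreover have "al x - 2 \<ge> 0" if "x \<in> {x\<in>X d. al x \<noteq> 1}" for x using al1[OF dB(2), of x] that by auto
      ultimately have al2: "\<forall>x\<in>{x\<in>X d. al x \<noteq> 1}. al x - 2 = 0"
        using finX[OF dB(2)] by (subst (asm) sum_nonneg_eq_0_iff) auto
      have "{x\<in>X d. al x \<noteq> 1} \<noteq> {}"
      proof
        assume "{x\<in>X d. al x \<noteq> 1} = {}"
        hence "n - 1 = 0" using eq1[OF dB(1)] by (simp only: sum.empty)
        thus False using n by simp
      qed
      then obtain x where x: "x \<in> X d" "al x \<noteq> 1" by auto
      hence "al x = 2" using al2 by auto
      hence "\<forall>y\<in>Y d. be y \<le> 2" using dvd[OF dB(2,3) x(1) _ x(2)] by (auto intro: zdvd_imp_le)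
      moreover have "\<forall>x\<in>X d. al x \<le> 2" using al2 by force
      moreover have "card {x\<in>X d. al x = 1} = 1" using l1[OF dB(2,3)] by (simp add: l_def)
      ultimately show ?thesis by blast
    qed
    show ?thesis unfolding dihedral_def using cC c(2) inn out by blast
  qed
qed

text \<open>Having no simple point, the fibre over \<open>c0\<close> uses up most of the
  ramification of \<open>X\<close>: only \<open>card (X c0) - 1\<close> is left for the other fibres
  together, so each of them has at least \<open>N\<close> simple points. Every unit of
  \<open>s\<close> outside \<open>c0\<close> then costs \<open>N\<close> in
  \<open>RH_m\<close>.\<close>

lemma F_bound:
  assumes c0: "c0 \<in> C" and l0: "l c0 = 0"
  shows "2 * int (card (X c0)) \<le> n" and "(\<Sum>c\<in>C - {c0}. s c) = int (card (Y c0)) - 1"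
    and "F c0 + (n - 2 * int (card (X c0)) + 2) * (int (card (Y c0)) - 1) \<le> m - 1"
proof -
  have "{x\<in>X c0. al x = 1} = {}" using l0 finX[OF c0] by (simp add: l_def)
  hence "\<forall>x\<in>X c0. al x \<ge> 2" using al1[OF c0] by force
  hence "(\<Sum>x\<in>X c0. 2) \<le> (\<Sum>x\<in>X c0. al x)" by (intro sum_mono) auto
  thus "2 * int (card (X c0)) \<le> n" using sum_al[OF c0] by simp
  show s: "(\<Sum>c\<in>C - {c0}. s c) = int (card (Y c0)) - 1"
    using sum.remove[OF finC c0, of s] sum_s' by (simp add: s_def)
  have rr: "(\<Sum>c\<in>C - {c0}. r c) = int (card (X c0)) - 1"
    using sum.remove[OF finC c0, of r] sum_r' by (simp add: r_def)
  define N where "N = n - 2 * int (card (X c0)) + 2"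
  have "N * s c \<le> F c" if c: "c \<in> C - {c0}" for c
  proof -
    have "r c \<le> (\<Sum>c\<in>C - {c0}. r c)" using c finC r_nonneg by (intro member_le_sum) auto
    hence "l c \<ge> N" using l_ge[of c] c rr by (simp add: N_def)
    hence "N * s c \<le> l c * s c" using s_nonneg[of c] c by (intro mult_right_mono) auto
    thus ?thesis using F_ge[of c] c by simp
  qed
  hence "(\<Sum>c\<in>C - {c0}. N * s c) \<le> (\<Sum>c\<in>C - {c0}. F c)" by (intro sum_mono) auto
  hence "N * (int (card (Y c0)) - 1) \<le> (\<Sum>c\<in>C - {c0}. F c)" using s by (simp flip: sum_distrib_left)
  thus "F c0 + (n - 2 * int (card (X c0)) + 2) * (int (card (Y c0)) - 1) \<le> m - 1"
    using sum.remove[OF finC c0, of F] sum_F by (simp add: N_def)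
qed

end

text \<open>If one map has a simple point over every ramified value of the other,
  \<open>all_simple\<close> decides. Otherwise there are bad fibres \<open>c0\<close> and
  \<open>c1\<close> for the two maps; the budgets of \<open>F_bound\<close> force them to coincide
  and \<open>Y c0\<close> to be a single point.\<close>

theorem (in ramification_data) classification:
  assumes mn: "2 \<le> m" "m < n"
  shows "(\<exists>c\<in>C. card (Y c) = 1) \<or> dihedral \<or> ramification_data.dihedral C Y X be al m n"
proof -
  interpret sw: ramification_data C Y X be al m n by (rule swapped)
  have swr: "sw.r = s" "sw.s = r" by (auto simp: sw.r_def sw.s_def r_def s_def fun_eq_iff)
  show ?thesis
  proof (cases "\<forall>c\<in>C. s c > 0 \<longrightarrow> l c \<ge> 1")
    case True
    thus ?thesis using all_simple mn by auto
  next
    case notl: False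
    show ?thesis
    proof (cases "\<forall>c\<in>C. r c > 0 \<longrightarrow> sw.l c \<ge> 1")
      case True
      hence "(\<exists>c\<in>C. card (X c) = 1 \<and> card {y\<in>Y c. be y = 1} = 1 \<and>
            (\<forall>y\<in>Y c. \<forall>x\<in>X c. be y \<noteq> 1 \<longrightarrow> al x dvd be y)) \<or> sw.dihedral"
        using mn by (intro sw.all_simple) (auto simp: swr)
      thus ?thesis
      proof
        assume "\<exists>c\<in>C. card (X c) = 1 \<and> card {y\<in>Y c. be y = 1} = 1 \<and>
            (\<forall>y\<in>Y c. \<forall>x\<in>X c. be y \<noteq> 1 \<longrightarrow> al x dvd be y)"
        then obtain c x where c: "c \<in> C" "X c = {x}" "card {y\<in>Y c. be y = 1} = 1"
          "\<And>y. y \<in> Y c \<Longrightarrow> be y \<noteq> 1 \<Longrightarrow> al x dvd be y" by (auto simp: card_1_singleton_iff)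
        have alx: "al x = n" using sum_al[OF c(1)] c(2) by simp
        have "be y = 1" if y: "y \<in> Y c" for y
        proof (rule ccontr)
          assume "be y \<noteq> 1"
          hence "n \<le> be y" using c(4)[OF y] be1[OF c(1) y] alx by (auto intro: zdvd_imp_le)
          moreover have "be y \<le> m" unfolding sum_be[OF c(1), symmetric]
            using y finY[OF c(1)] be1[OF c(1)] by (intro member_le_sum) force+
          ultimately show False using mn by simp
        qed
        hence "{y\<in>Y c. be y = 1} = Y c" by auto
        thus ?thesis using c by auto
      qed auto
    next
      case False
      from notl obtain c0 where c0: "c0 \<in> C" "s c0 > 0" "l c0 = 0" by (auto simp: l_def)
      from False obtain c1 where c1: "c1 \<in> C" "r c1 > 0" "sw.l c1 = 0" by (auto simp: sw.l_def)
      note B = F_bound[OF c0(1,3)]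
      note B' = sw.F_bound[OF c1(1,3), unfolded swr]
      define p where "p = int (card (X c0))"
      define q where "q = int (card (Y c0))"
      have q: "q \<ge> 1" using sum_be[OF c0(1)] mn finY[OF c0(1)] by (cases "Y c0 = {}") (auto simp: q_def card_gt_0_iff Suc_le_eq simp flip: of_nat_Suc)
      have p: "p \<ge> 1" using sum_al[OF c0(1)] mn finX[OF c0(1)] by (cases "X c0 = {}") (auto simp: p_def card_gt_0_iff Suc_le_eq simp flip: of_nat_Suc)
      have F0: "F c0 + (n - 2 * p + 2) * (q - 1) \<le> m - 1" using B(3) by (simp add: p_def q_def)
      have p2: "2 * p \<le> n" using B(1) by (simp add: p_def)
      show ?thesis
      proof (cases "c1 = c0")
        case False
        \<comment> \<open>If the bad fibres differ, \<open>c0\<close> leaves at most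
          \<open>(m - 1) / 2\<close> for \<open>s c1\<close>, whereas \<open>c1\<close>, without
          simple points of \<open>Y\<close>, needs at least \<open>m / 2\<close>.\<close>
        have "s c1 \<le> (\<Sum>c\<in>C - {c0}. s c)" using False c1 finC s_nonneg by (intro member_le_sum) auto
        hence "m - int (card (Y c1)) \<le> q - 1" using B(2) by (simp add: s_def q_def)
        moreover have "2 * (q - 1) \<le> m - 1"
        proof -
          have "2 * (q - 1) \<le> (n - 2 * p + 2) * (q - 1)" using p2 q by (intro mult_right_mono) auto
          also have "\<dots> \<le> m - 1" using F0 F_nonneg[OF c0(1)] by linarith
          finally show ?thesis .
        qed
        moreover have False if "m - z \<le> q - 1" "2 * (q - 1) \<le> m - 1" "2 * z \<le> m" for z
          using that by presburger
        ultimately have False using B'(1) by blast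
        thus ?thesis ..
      next
        case True
        have q2: "2 * q \<le> m" using B'(1) True by (simp add: q_def)
        have F0': "sw.F c0 + (m - 2 * q + 2) * (p - 1) \<le> n - 1" using B'(3) True by (simp add: p_def q_def)
        have swF: "sw.F c0 = (\<Sum>x\<in>X c0. \<Sum>y\<in>Y c0. al x - gcd (al x) (be y))"
          unfolding sw.F_def by (subst sum.swap) (simp add: gcd.commute)
        show ?thesis
        proof (cases "q = 1")
          case True
          thus ?thesis using c0 by (auto simp: q_def)
        next
          case False
          hence q': "q \<ge> 2" using q by simp
          show ?thesis
          proof (cases "p = 1")
            case True
            then obtain x where x: "X c0 = {x}" by (auto simp: p_def card_1_singleton_iff)
            hence alx: "al x = n" using sum_al[OF c0(1)] by simp
            have "(\<Sum>y\<in>Y c0. n - be y) \<le> (\<Sum>y\<in>Y c0. n - gcd n (be y))"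
              using be1[OF c0(1)] by (intro sum_mono diff_left_mono gcd_le2_int) fastforce
            hence "q * n - m \<le> sw.F c0"
              by (simp add: swF x alx sum_subtractf sum_be[OF c0(1)] q_def)
            moreover have "2 * n \<le> q * n" using q' mn by (intro mult_right_mono) auto
            moreover have "sw.F c0 \<le> n - 1" using F0' True by simp
            ultimately have False using mn by linarith
            thus ?thesis ..
          next
            case False
            hence p': "p \<ge> 2" using p by simp
            define t where "t x y = al x + be y - 2 * gcd (al x) (be y)" for x y
            have FF: "F c0 + sw.F c0 = (\<Sum>x\<in>X c0. \<Sum>y\<in>Y c0. t x y)"
              unfolding F_def swF t_def sum.distrib[symmetric] by (intro sum.cong refl) simp
            \<comment> \<open>Adding \<open>F0\<close> and \<open>F0'\<close> bounds the sum of
              \<open>t\<close> by \<open>2 - (n - 2 * p) * (q - 2) - (m - 2 * q) * (p - 2)\<close>.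
              One pair with unequal indices already costs 2, so at most one exists.\<close>
            have "0 \<le> (n - 2 * p) * (q - 2)" "0 \<le> (m - 2 * q) * (p - 2)"
              using p2 q2 p' q' by auto
            hence le2: "(\<Sum>x\<in>X c0. \<Sum>y\<in>Y c0. t x y) \<le> 2"
              using F0 F0' by (simp flip: FF add: algebra_simps)
            have al2: "al x \<ge> 2" if "x \<in> X c0" for x
            proof -
              have "{x\<in>X c0. al x = 1} = {}" using c0 finX[OF c0(1)] by (simp add: l_def)
              thus ?thesis using al1[OF c0(1) that] that by force
            qed
            have be2: "be y \<ge> 2" if "y \<in> Y c0" for y
            proof -
              have "{y\<in>Y c0. be y = 1} = {}" using c1 True finY[OF c0(1)] by (simp add: sw.l_def)
              thus ?thesis using be1[OF c0(1) that] that by force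
            qed
            have t2: "t x y \<ge> 2" if "x \<in> X c0" "y \<in> Y c0" "al x \<noteq> be y" for x y
              using two_le_add_minus_gcd al2 be2 that by (simp add: t_def)
            have t0: "t x y \<ge> 0" if "x \<in> X c0" "y \<in> Y c0" for x y
              using t2[OF that] that al2[of x] by (cases "al x = be y") (auto simp: t_def)
            have two: False if "x \<in> X c0" "y \<in> Y c0" "x' \<in> X c0" "y' \<in> Y c0" "(x, y) \<noteq> (x', y')"
              "al x \<noteq> be y" "al x' \<noteq> be y'" for x y x' y'
              using sum_ge_two_terms[of "X c0" "Y c0" t x y x' y'] t0 t2 that le2
                finX[OF c0(1)] finY[OF c0(1)] by (smt (verit))
            have other: "\<exists>z'\<in>Z. z' \<noteq> z" if "card Z \<ge> 2" for z and Z :: "'z set"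
            proof (rule ccontr)
              assume "\<not> (\<exists>z'\<in>Z. z' \<noteq> z)"
              hence "Z \<subseteq> {z}" by auto
              hence "card Z \<le> 1" using card_mono[of "{z}" Z] by simp
              thus False using that by simp
            qed
            \<comment> \<open>If \<open>(x, y)\<close> were the only unequal pair, then
              \<open>al x' = be y\<close> and \<open>al x = be y'\<close>, which makes
              \<open>(x', y')\<close> unequal as well. With all indices equal, their common value
              divides both coprime degrees.\<close>
            have eq: "al x = be y" if xy: "x \<in> X c0" "y \<in> Y c0" for x y
            proof (rule ccontr)
              assume neq: "al x \<noteq> be y"
              obtain x' where x': "x' \<in> X c0" "x' \<noteq> x" using other[of "X c0" x] p' by (auto simp: p_def)
              obtain y' where y': "y' \<in> Y c0" "y' \<noteq> y" using other[of "Y c0" y] q' by (auto simp: q_def)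
              have "al x' = be y" using two[of x y x' y] neq xy x' by auto
              moreover have "al x = be y'" using two[of x y x y'] neq xy y' by auto
              ultimately have "al x' \<noteq> be y'" using neq by auto
              thus False using two[of x y x' y'] neq xy x' y' by auto
            qed
            obtain x where x: "x \<in> X c0" using p' by (cases "X c0 = {}") (auto simp: p_def)
            obtain y where y: "y \<in> Y c0" using q' by (cases "Y c0 = {}") (auto simp: q_def)
            have "n = (\<Sum>z\<in>X c0. al x)" unfolding sum_al[OF c0(1), symmetric]
              using eq[OF _ y] x by (intro sum.cong) auto
            hence "al x dvd n" by simp
            moreover have "m = (\<Sum>z\<in>Y c0. al x)" unfolding sum_be[OF c0(1), symmetric]
              using eq[OF x] by (intro sum.cong) auto
            hence "al x dvd m" by simp
            ultimately have "is_unit (al x)" using cop coprime_common_divisor by blast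
            thus ?thesis using al2[OF x] by auto
          qed
        qed
      qed
    qed
  qed
qed

section \<open>Ritt's second theorem from Riemann-Hurwitz\<close>

lemma le_gcd_mult:
  fixes a b e :: nat
  assumes "b dvd a * e" "e > 0" "b > 0"
  shows "b \<le> gcd a b * e"
proof -
  have "b dvd gcd (a * e) (b * e)" using assms by simp
  hence "b dvd gcd a b * e" by (simp add: gcd_mult_distrib_nat mult.commute)
  thus ?thesis using assms by (intro dvd_imp_le) auto
qed

context coprime_composite
begin

lemma ramif_composite:
  "ramif A (poly W1 t) * ramif W1 t = ramif B (poly W2 t) * ramif W2 t"
proof -
  have "degree A > 0" "degree B > 0" using degA degB ppos rpos by auto
  thus ?thesis using ramif_pcompose[of A W1 t] ramif_pcompose[of B W2 t] W_nz by (simp add: comp)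
qed

lemma fiber_values: "poly A (poly W1 t) = poly B (poly W2 t)"
  by (metis comp poly_pcompose)

text \<open>Each \<open>ramif W1 t\<close> is a multiple of \<open>ramif B y\<close> divided by the
  gcd, and these indices add up to \<open>ramif B y\<close>.\<close>

lemma card_fiber_pair_le:
  assumes "g = 1" "poly A x = poly B y"
  shows "card {t. poly W1 t = x \<and> poly W2 t = y} \<le> gcd (ramif A x) (ramif B y)"
proof -
  define T where "T = {t. poly W1 t = x \<and> poly W2 t = y}"
  have dB: "degree B > 0" "degree W1 > 0" using degB ppos W_nz by auto
  have b: "ramif B y > 0" using ramif_pos[OF dB(1), of y] by simp
  have "card T * ramif B y = (\<Sum>t\<in>T. ramif B y)" by simp
  also have "\<dots> \<le> (\<Sum>t\<in>T. gcd (ramif A x) (ramif B y) * ramif W1 t)"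
  proof (intro sum_mono)
    fix t assume "t \<in> T"
    hence "ramif B y dvd ramif A x * ramif W1 t" using ramif_composite[of t] by (auto simp: T_def)
    thus "ramif B y \<le> gcd (ramif A x) (ramif B y) * ramif W1 t"
      using ramif_pos[OF dB(2), of t] b by (intro le_gcd_mult) auto
  qed
  also have "\<dots> = gcd (ramif A x) (ramif B y) * ramif B y"
    using sum_ramif_fiber_pair[OF assms] by (simp add: T_def flip: sum_distrib_left)
  finally show ?thesis using b by (simp add: T_def)
qed

text \<open>The ramification of \<open>W1\<close>, at most \<open>p - 1\<close> in total, is grouped
  by the pairs \<open>(x, y)\<close>: a pair contributes \<open>ramif B y\<close> minus its number
  of points, and that number is at most the gcd.\<close>

lemma riemann_hurwitz:
  assumes "g = 1" "finite C"
  shows "(\<Sum>c\<in>C. \<Sum>x | poly A x = c. \<Sum>y | poly B y = c.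
           int (ramif B y) - gcd (int (ramif A x)) (int (ramif B y))) \<le> int p - 1"
proof -
  have d: "degree A > 0" "degree B > 0" "degree W1 > 0" "degree W2 > 0" "degree (A \<circ>\<^sub>p W1) > 0"
    using degA degB ppos rpos W_nz by (auto simp: degree_pcompose)
  define f where "f = A \<circ>\<^sub>p W1"
  have trm: "int (ramif B y) - gcd (int (ramif A x)) (int (ramif B y))
      \<le> (\<Sum>t | poly W1 t = x \<and> poly W2 t = y. int (ramif W1 t) - 1)" if "poly A x = c" "poly B y = c" for x y c
    using sum_ramif_fiber_pair[OF assms(1), of x y] card_fiber_pair_le[OF assms(1), of x y] that
    by (simp add: sum_subtractf gcd_int_int_eq flip: of_nat_sum)
  have "(\<Sum>c\<in>C. \<Sum>x | poly A x = c. \<Sum>y | poly B y = c.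
           int (ramif B y) - gcd (int (ramif A x)) (int (ramif B y)))
     \<le> (\<Sum>c\<in>C. \<Sum>x | poly A x = c. \<Sum>y | poly B y = c.
           \<Sum>t | poly W1 t = x \<and> poly W2 t = y. int (ramif W1 t) - 1)"
    by (intro sum_mono) (use trm in auto)
  also have "\<dots> = (\<Sum>c\<in>C. \<Sum>x | poly A x = c. \<Sum>t | poly W1 t = x. int (ramif W1 t) - 1)"
  proof (rule sum.cong[OF refl], rule sum.cong[OF refl])
    fix c x assume "x \<in> {x. poly A x = c}"
    hence "poly W2 ` {t. poly W1 t = x} \<subseteq> {y. poly B y = c}" using fiber_values by auto
    from sum.group[OF finite_fiber finite_fiber this, of "\<lambda>t. int (ramif W1 t) - 1"] d
    show "(\<Sum>y | poly B y = c. \<Sum>t | poly W1 t = x \<and> poly W2 t = y. int (ramif W1 t) - 1)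
        = (\<Sum>t | poly W1 t = x. int (ramif W1 t) - 1)" by simp
  qed
  also have "\<dots> = (\<Sum>c\<in>C. \<Sum>t | poly f t = c. int (ramif W1 t) - 1)"
  proof (rule sum.cong[OF refl])
    fix c
    have "poly W1 ` {t. poly f t = c} \<subseteq> {x. poly A x = c}" by (auto simp: f_def poly_pcompose)
    from sum.group[OF finite_fiber finite_fiber this, of "\<lambda>t. int (ramif W1 t) - 1"] d
    have "(\<Sum>x | poly A x = c. \<Sum>t | poly f t = c \<and> poly W1 t = x. int (ramif W1 t) - 1)
        = (\<Sum>t | poly f t = c. int (ramif W1 t) - 1)" by (simp add: f_def)
    moreover have "{t. poly f t = c \<and> poly W1 t = x} = {t. poly W1 t = x}" if "poly A x = c" for x
      using that by (auto simp: f_def poly_pcompose)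
    ultimately show "(\<Sum>x | poly A x = c. \<Sum>t | poly W1 t = x. int (ramif W1 t) - 1)
        = (\<Sum>t | poly f t = c. int (ramif W1 t) - 1)" by simp
  qed
  also have "\<dots> = (\<Sum>t\<in>(\<Union>c\<in>C. {t. poly f t = c}). int (ramif W1 t) - 1)"
    using assms(2) finite_fiber[of f] d(5) by (intro sum.UNION_disjoint[symmetric]) (auto simp: f_def)
  also have "\<dots> = int (\<Sum>t\<in>(\<Union>c\<in>C. {t. poly f t = c}). ramif W1 t - 1)"
    unfolding of_nat_sum using ramif_pos[OF d(3)] by (intro sum.cong refl) (simp add: of_nat_diff)
  also have "\<dots> \<le> int (degree W1 - 1)"
    unfolding of_nat_le_iff using assms(2) finite_fiber[of f] d(5)
    by (intro sum_ramif_le d) (auto simp: f_def)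
  also have "\<dots> = int p - 1" using deg1 assms(1) ppos by simp
  finally show ?thesis .
qed

end

lemma sum_ramif_all_fibers:
  assumes "degree P > 0" "finite C" "{x. poly (pderiv P) x = 0} \<subseteq> {x. poly P x \<in> C}"
  shows "(\<Sum>c\<in>C. \<Sum>x | poly P x = c. int (ramif P x) - 1) = int (degree P) - 1"
proof -
  have U: "(\<Union>c\<in>C. {x. poly P x = c}) = {x. poly P x \<in> C}" by auto
  have fin: "finite (\<Union>c\<in>C. {x. poly P x = c})" using assms finite_fiber by auto
  have "(\<Sum>c\<in>C. \<Sum>x | poly P x = c. int (ramif P x) - 1) = (\<Sum>x\<in>(\<Union>c\<in>C. {x. poly P x = c}). int (ramif P x) - 1)"
    using assms finite_fiber by (intro sum.UNION_disjoint[symmetric]) auto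
  also have "\<dots> = int (\<Sum>x\<in>(\<Union>c\<in>C. {x. poly P x = c}). ramif P x - 1)"
    unfolding of_nat_sum using ramif_pos[OF assms(1)] by (intro sum.cong refl) (simp add: of_nat_diff)
  also have "(\<Sum>x\<in>(\<Union>c\<in>C. {x. poly P x = c}). ramif P x - 1) = degree P - 1"
    using assms fin by (intro sum_ramif_all) (auto simp: U)
  finally show ?thesis using assms(1) by simp
qed

text \<open>Says that only exponents congruent to \<open>degree W\<close> modulo \<open>n\<close>
  occur in \<open>W (u + z) - f\<close>, that is, this polynomial has the form
  \<open>z ^ s * R (z ^ n)\<close>.\<close>

definition rotation_symmetric :: "nat \<Rightarrow> complex \<Rightarrow> complex \<Rightarrow> complex poly \<Rightarrow> bool" where
  "rotation_symmetric n u f W \<longleftrightarrow>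
     (\<forall>\<epsilon>. \<epsilon> ^ n = 1 \<longrightarrow> (\<forall>z. poly W (u + \<epsilon> * z) - f = \<epsilon> ^ degree W * (poly W (u + z) - f)))"

definition cyclic_pair :: "complex poly \<Rightarrow> complex poly \<Rightarrow> bool" where
  "cyclic_pair W1 W2 \<longleftrightarrow> (\<exists>c u e f. c \<noteq> 0 \<and> W1 = smult c ([:-u, 1:] ^ degree W1) + [:e:] \<and>
     rotation_symmetric (degree W1) u f W2)"

text \<open>A pair of Dickson polynomials, encoded by the common radicand \<open>h\<close> of two
  Pell equations; this form can be read off from ramification without knowing the
  polynomials.\<close>

definition dihedral_pair :: "complex poly \<Rightarrow> complex poly \<Rightarrow> bool" where
  "dihedral_pair W1 W2 \<longleftrightarrow> (\<exists>u v x y h S1 S2. u \<noteq> v \<and> x \<noteq> y \<and>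
     (W1 - [:u:]) * (W1 - [:v:]) = h * S1 ^ 2 \<and> (W2 - [:x:]) * (W2 - [:y:]) = h * S2 ^ 2)"

lemma dihedral_pair_commute: "dihedral_pair W1 W2 \<longleftrightarrow> dihedral_pair W2 W1"
  unfolding dihedral_pair_def by blast

lemma single_fiber_poly:
  fixes P :: "complex poly"
  assumes "degree P > 0" "{t. poly P t = c} = {u}"
  shows "P = smult (lead_coeff P) ([:-u, 1:] ^ degree P) + [:c:]"
proof -
  have nz: "P - [:c:] \<noteq> 0" using diff_const_nonzero assms(1) by blast
  have lc: "lead_coeff (P - [:c:]) = lead_coeff P"
    using assms(1) by (simp add: degree_diff_const coeff_pCons split: nat.splits)
  have "order u (P - [:c:]) = degree P"
    using sum_ramif_fiber[OF assms(1), of c] assms(2) by (auto simp: ramif_def)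
  hence "smult (lead_coeff P) ([:-u, 1:] ^ degree P) = P - [:c:]"
    using complex_poly_decompose[of "P - [:c:]"] lc assms(2) by simp
  thus ?thesis by simp
qed

lemma power_eq_imp_smult_eq:
  fixes F G :: "complex poly"
  assumes "F ^ k = G ^ k" "k > 0" "degree F = degree G" "lead_coeff F = lead_coeff G"
  shows "F = G"
proof (cases "F = 0")
  case True
  thus ?thesis using assms by (auto simp: zero_power)
next
  case False
  thus ?thesis using power_close_imp_eq[of F "degree G" G k] assms by auto
qed

context coprime_composite
begin

text \<open>\<open>B\<close> is a \<open>p\<close>-th power up to constants, so over
  \<open>c\<close> every \<open>x\<close> of index not divisible by \<open>p\<close> costs at least
  \<open>p / 2\<close> of a budget of \<open>p - 1\<close>. Exactly one such \<open>x0\<close>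
  exists, its index is coprime to \<open>p\<close>, and \<open>W1\<close> is totally ramified over
  it, hence a power. Then \<open>(W2 - y0) ^ p\<close> is a polynomial in \<open>W1\<close> and
  invariant under rotation.\<close>

lemma single_fiber_imp_cyclic:
  assumes g: "g = 1" and p2: "p \<ge> 2" and Y: "card {y. poly B y = c} = 1"
  shows "cyclic_pair W1 W2"
proof -
  have d: "degree A > 0" "degree B > 0" "degree W1 > 0" "degree W2 > 0" "degree W1 = p" "degree W2 = r"
    using degA degB ppos rpos W_nz deg1 deg2 g by auto
  obtain y0 where y0: "{y. poly B y = c} = {y0}" using Y by (auto simp: card_1_singleton_iff)
  hence By0: "poly B y0 = c" by blast
  have rB: "ramif B y0 = p" using sum_ramif_fiber[OF d(2), of c] y0 degB by simp
  define X where "X = {x. poly A x = c}"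
  have fX: "finite X" using finite_fiber d(1) by (simp add: X_def)
  have RH: "(\<Sum>x\<in>X. int p - gcd (int (ramif A x)) (int p)) \<le> int p - 1"
    using riemann_hurwitz[OF g, of "{c}"] y0 rB by (simp add: X_def)
  have half: "2 * (int p - gcd (int a) (int p)) \<ge> int p" if "\<not> p dvd a" for a
  proof -
    obtain k where k: "p = gcd a p * k" by (meson dvdE gcd_dvd2)
    have "k \<noteq> 0" "k \<noteq> 1" using k that ppos by (metis mult_0_right neq0_conv, metis gcd_dvd1 mult.right_neutral)
    hence "gcd a p * 2 \<le> gcd a p * k" by (intro mult_le_mono2) simp
    hence "2 * gcd a p \<le> p" using k by simp
    thus ?thesis by (simp add: gcd_int_int_eq)
  qed
  have nn: "int p - gcd (int a) (int p) \<ge> 0" for a using ppos by (simp add: gcd_int_int_eq gcd_le2_nat)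
  have unique: "x = x'" if "x \<in> X" "x' \<in> X" "\<not> p dvd ramif A x" "\<not> p dvd ramif A x'" for x x'
  proof (rule ccontr)
    assume "x \<noteq> x'"
    hence "(int p - gcd (int (ramif A x)) (int p)) + (int p - gcd (int (ramif A x')) (int p))
      = (\<Sum>x\<in>{x, x'}. int p - gcd (int (ramif A x)) (int p))" by simp
    also have "\<dots> \<le> (\<Sum>x\<in>X. int p - gcd (int (ramif A x)) (int p))"
      using that fX nn by (intro sum_mono2) auto
    finally show False using RH half[OF that(3)] half[OF that(4)] by (smt (verit))
  qed
  have sumA: "(\<Sum>x\<in>X. ramif A x) = r" using sum_ramif_fiber[OF d(1), of c] degA by (simp add: X_def)
  have "\<exists>x\<in>X. \<not> p dvd ramif A x"
  proof (rule ccontr)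
    assume "\<not> ?thesis"
    hence "p dvd r" unfolding sumA[symmetric] by (intro dvd_sum) auto
    thus False using cop p2 by (metis coprime_absorb_left dvd_refl nat_dvd_1_iff_1 numeral_le_one_iff semiring_norm(69))
  qed
  then obtain x0 where x0: "x0 \<in> X" "\<not> p dvd ramif A x0" by blast
  have req: "r = ramif A x0 + (\<Sum>x\<in>X - {x0}. ramif A x)" using sum.remove[OF fX x0(1), of "ramif A"] sumA by simp
  have pdvd: "p dvd (\<Sum>x\<in>X - {x0}. ramif A x)" using unique[OF _ x0(1) _ x0(2)] by (intro dvd_sum) auto
  have cop0: "coprime p (ramif A x0)"
  proof -
    from pdvd obtain k where "(\<Sum>x\<in>X - {x0}. ramif A x) = k * p" by (metis dvd_def mult.commute)
    hence "r = k * p + ramif A x0" using req by simp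
    hence "gcd p r = gcd p (ramif A x0)" by (simp add: gcd_add_mult)
    thus ?thesis using cop by (simp add: coprime_iff_gcd_eq_1)
  qed
  have vals: "poly W2 t = y0" if "poly W1 t = x0" for t
    using fiber_values[of t] that x0(1) y0 by (auto simp: X_def)
  have ramp: "p dvd ramif W1 t" if "poly W1 t = x0" for t
  proof -
    have "p dvd ramif A x0 * ramif W1 t" using ramif_composite[of t] vals[OF that] that rB by simp
    thus ?thesis using cop0 by (simp add: coprime_dvd_mult_right_iff)
  qed
  have ge: "p \<le> ramif W1 t" if "poly W1 t = x0" for t
    using ramp[OF that] ramif_pos[OF d(3), of t] by (intro dvd_imp_le) auto
  have sumW: "(\<Sum>t | poly W1 t = x0. ramif W1 t) = p" using sum_ramif_fiber[OF d(3)] d(5) by simp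
  have "card {t. poly W1 t = x0} * p \<le> p"
    using sum_bounded_below[of "{t. poly W1 t = x0}" p "ramif W1"] ge sumW by simp
  moreover have "{t. poly W1 t = x0} \<noteq> {}"
  proof
    assume "{t. poly W1 t = x0} = {}"
    hence "p = 0" using sumW by (simp only: sum.empty)
    thus False using ppos by simp
  qed
  ultimately have "card {t. poly W1 t = x0} = 1"
    using finite_fiber[OF d(3), of x0] ppos by (auto simp: card_eq_0_iff Suc_le_eq le_Suc_eq)
  then obtain u where u: "{t. poly W1 t = x0} = {u}" by (auto simp: card_1_singleton_iff)
  have W1: "W1 = smult (lead_coeff W1) ([:-u, 1:] ^ degree W1) + [:x0:]"
    by (rule single_fiber_poly[OF d(3) u])
  have B: "B = smult (lead_coeff B) ([:-y0, 1:] ^ p) + [:c:]"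
    using single_fiber_poly[OF d(2) y0] degB by simp
  define b where "b = lead_coeff B"
  have "b \<noteq> 0" using d(2) by (auto simp: b_def)
  have pw: "b * (poly W2 t - y0) ^ p = poly A (poly W1 t) - c" for t
  proof -
    have "poly B (poly W2 t) = b * (poly W2 t - y0) ^ p + c"
      by (subst B) (simp add: b_def)
    thus ?thesis by (simp add: fiber_values)
  qed
  have "rotation_symmetric (degree W1) u y0 W2"
    unfolding rotation_symmetric_def
  proof (intro allI impI)
    fix \<epsilon> z :: complex assume eps: "\<epsilon> ^ degree W1 = 1"
    have "\<epsilon> \<noteq> 0" using eps d by (metis power_0_left zero_neq_one neq0_conv)
    \<comment> \<open>\<open>W2 - y0\<close> and its rotated version have \<open>p\<close>-th powers
      equal to each other; the root of unity between them is identified as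
      \<open>\<epsilon> ^ r\<close> by the leading coefficients.\<close>
    define F where "F = (W2 \<circ>\<^sub>p [:u, \<epsilon>:]) - [:y0:]"
    define G where "G = smult (\<epsilon> ^ r) ((W2 \<circ>\<^sub>p [:u, 1:]) - [:y0:])"
    have W1inv: "poly W1 (u + \<epsilon> * z) = poly W1 (u + z)" for z
      by (subst (1 2) W1) (simp add: power_mult_distrib eps)
    have "F ^ p = G ^ p"
    proof (rule poly_eq_poly_eq_iff[THEN iffD1, OF ext])
      fix z
      have "b * poly (F ^ p) z = b * (poly W2 (u + \<epsilon> * z) - y0) ^ p" by (simp add: F_def poly_pcompose mult.commute)
      also have "\<dots> = b * (poly W2 (u + z) - y0) ^ p" by (simp add: pw W1inv)
      also have "\<dots> = b * poly (G ^ p) z" using eps d(5)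
        by (simp add: G_def poly_pcompose power_mult_distrib power_mult[symmetric] mult.commute[of r])
           (simp add: power_mult)
      finally show "poly (F ^ p) z = poly (G ^ p) z" using \<open>b \<noteq> 0\<close> by simp
    qed
    moreover have "degree F = r" using d(6) \<open>\<epsilon> \<noteq> 0\<close> by (simp add: F_def degree_diff_const degree_pcompose)
    moreover have "degree G = r" using d(6) \<open>\<epsilon> \<noteq> 0\<close> by (simp add: G_def degree_diff_const degree_pcompose)
    moreover have "lead_coeff F = lead_coeff G"
    proof -
      have l: "lead_coeff (P - [:y0:]) = lead_coeff P" if "degree P > 0" for P :: "complex poly"
        using that by (simp add: degree_diff_const coeff_pCons split: nat.splits)
      have pos: "degree (W2 \<circ>\<^sub>p [:u, \<epsilon>:]) > 0" using d \<open>\<epsilon> \<noteq> 0\<close> by (simp add: degree_pcompose)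
      have "lead_coeff F = lead_coeff W2 * \<epsilon> ^ r" unfolding F_def l[OF pos]
        using d \<open>\<epsilon> \<noteq> 0\<close> by (subst lead_coeff_comp) auto
      have pos': "degree (W2 \<circ>\<^sub>p [:u, 1:]) > 0" using d by (simp add: degree_pcompose)
      have "lead_coeff G = \<epsilon> ^ r * lead_coeff W2" unfolding G_def lead_coeff_smult l[OF pos']
        using d by (subst lead_coeff_comp) auto
      thus ?thesis using \<open>lead_coeff F = _\<close> by simp
    qed
    ultimately have "F = G" using power_eq_imp_smult_eq ppos by metis
    hence "poly F z = poly G z" by simp
    thus "poly W2 (u + \<epsilon> * z) - y0 = \<epsilon> ^ degree W2 * (poly W2 (u + z) - y0)"
      by (simp add: F_def G_def poly_pcompose d(6) mult.commute)
  qed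
  moreover have "lead_coeff W1 \<noteq> 0" using W_nz by simp
  ultimately show ?thesis unfolding cyclic_pair_def using W1 by blast
qed

lemma odd_ramif_iff:
  assumes "g = 1" "ramif A (poly W1 t) = 1" "ramif B (poly W2 t) \<le> 2"
  shows "odd (ramif W1 t) \<longleftrightarrow> ramif B (poly W2 t) = 1"
proof
  assume odd: "odd (ramif W1 t)"
  have "ramif W1 t = ramif B (poly W2 t) * ramif W2 t" using ramif_composite[of t] assms(2) by simp
  hence "odd (ramif B (poly W2 t))" using odd by simp
  thus "ramif B (poly W2 t) = 1" using assms(3) by (auto simp: le_Suc_eq numeral_2_eq_2)
next
  assume 1: "ramif B (poly W2 t) = 1"
  have d: "degree W1 > 0" using W_nz by simp
  define T where "T = {s. poly W1 s = poly W1 t \<and> poly W2 s = poly W2 t}"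
  have "finite T" using finite_subset[OF _ finite_fiber[OF d, of "poly W1 t"], of T] by (auto simp: T_def)
  hence "ramif W1 t \<le> (\<Sum>s\<in>T. ramif W1 s)" by (intro member_le_sum) (auto simp: T_def)
  also have "\<dots> = 1" unfolding T_def using sum_ramif_fiber_pair[OF assms(1) fiber_values[of t]] 1 by simp
  finally have "ramif W1 t = 1" using ramif_pos[OF d, of t] by simp
  thus "odd (ramif W1 t)" by simp
qed

end

lemma odd_part_decomposition:
  fixes F :: "complex poly"
  assumes "F \<noteq> 0"
  shows "\<exists>S. F = (\<Prod>t | poly F t = 0 \<and> odd (order t F). [:-t, 1:]) * S ^ 2"
proof -
  define Z where "Z = {t. poly F t = 0}"
  have fin: "finite Z" using assms poly_roots_finite by (simp add: Z_def)
  obtain s where s: "s ^ 2 = lead_coeff F" using complex_root_exists[of 2] by auto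
  define S where "S = smult s (\<Prod>t\<in>Z. [:-t, 1:] ^ (order t F div 2))"
  have "[:-t, 1:] ^ order t F = (if odd (order t F) then [:-t, 1:] else 1) * ([:-t, 1:] ^ (order t F div 2)) ^ 2" for t
    by (simp flip: power_mult power_Suc) (metis odd_two_times_div_two_succ Suc_eq_plus1 mult.commute dvd_div_mult_self)
  hence "(\<Prod>t\<in>Z. [:-t, 1:] ^ order t F) = (\<Prod>t\<in>Z. if odd (order t F) then [:-t, 1:] else 1)
      * (\<Prod>t\<in>Z. [:-t, 1:] ^ (order t F div 2)) ^ 2"
    by (simp add: prod.distrib prod_power_distrib)
  also have "(\<Prod>t\<in>Z. if odd (order t F) then [:-t, 1:] else 1) = (\<Prod>t | t \<in> Z \<and> odd (order t F). [:-t, 1:])"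
    using fin by (simp add: prod.inter_filter)
  finally have "F = (\<Prod>t | t \<in> Z \<and> odd (order t F). [:-t, 1:]) * S ^ 2"
    using complex_poly_decompose[of F] s by (simp add: Z_def S_def smult_power mult_ac)
  thus ?thesis unfolding Z_def by auto
qed

lemma order_fiber_product:
  assumes "degree P > 0" "u \<noteq> v"
  shows "order t ((P - [:u:]) * (P - [:v:])) = (if poly P t \<in> {u, v} then ramif P t else 0)"
proof -
  have nz: "P - [:u:] \<noteq> 0" "P - [:v:] \<noteq> 0" using diff_const_nonzero assms by blast+
  have "order t (P - [:w:]) = (if poly P t = w then ramif P t else 0)" for w
    by (auto simp: ramif_def order_0I)
  thus ?thesis using nz assms(2) by (auto simp: order_mult)
qed

text \<open>Two fibres have \<open>2 * degree P\<close> points with multiplicity; spending the total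
  ramification \<open>degree P - 1\<close> on double points leaves two simple ones.\<close>

lemma card_simple_points:
  assumes "degree P > 0" "c1 \<noteq> c2" "\<And>x. poly P x \<in> {c1, c2} \<Longrightarrow> ramif P x \<le> 2"
    and "(\<Sum>c\<in>{c1, c2}. \<Sum>x | poly P x = c. int (ramif P x) - 1) = int (degree P) - 1"
  shows "card {x. poly P x \<in> {c1, c2} \<and> ramif P x = 1} = 2"
proof -
  have simple: "int (card {x. poly P x = c \<and> ramif P x = 1})
      = int (degree P) - 2 * (\<Sum>x | poly P x = c. int (ramif P x) - 1)" if c: "c \<in> {c1, c2}" for c
  proof -
    have "int (card {x. poly P x = c \<and> ramif P x = 1}) = (\<Sum>x | poly P x = c \<and> ramif P x = 1. 1)" by simp
    also have "\<dots> = (\<Sum>x | poly P x = c. if ramif P x = 1 then 1 else 0)"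
      using finite_fiber[OF assms(1), of c] by (simp add: sum.inter_filter[symmetric])
    also have "\<dots> = (\<Sum>x | poly P x = c. int (ramif P x) - 2 * (int (ramif P x) - 1))"
    proof (rule sum.cong[OF refl])
      fix x assume "x \<in> {x. poly P x = c}"
      hence "ramif P x = 1 \<or> ramif P x = 2" using assms(3)[of x] c ramif_pos[OF assms(1), of x] by force
      thus "(if ramif P x = 1 then 1 else 0) = int (ramif P x) - 2 * (int (ramif P x) - 1)" by auto
    qed
    also have "\<dots> = int (\<Sum>x | poly P x = c. ramif P x) - 2 * (\<Sum>x | poly P x = c. int (ramif P x) - 1)"
      by (simp add: sum_subtractf flip: sum_distrib_left)
    finally show ?thesis using sum_ramif_fiber[OF assms(1), of c] by simp
  qed
  have "{x. poly P x \<in> {c1, c2} \<and> ramif P x = 1} = {x. poly P x = c1 \<and> ramif P x = 1} \<union> {x. poly P x = c2 \<and> ramif P x = 1}"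
    by auto
  moreover have "card ({x. poly P x = c1 \<and> ramif P x = 1} \<union> {x. poly P x = c2 \<and> ramif P x = 1})
     = card {x. poly P x = c1 \<and> ramif P x = 1} + card {x. poly P x = c2 \<and> ramif P x = 1}"
    using assms(2) finite_fiber[OF assms(1)] by (intro card_Un_disjoint) auto
  ultimately have "int (card {x. poly P x \<in> {c1, c2} \<and> ramif P x = 1}) = 2"
    using simple[of c1] simple[of c2] assms(2,4) by simp
  thus ?thesis by simp
qed

context coprime_composite
begin

text \<open>\<open>u\<close>, \<open>v\<close> and \<open>x\<close>, \<open>y\<close> are the simple
  points of \<open>A\<close> and \<open>B\<close> over \<open>c1\<close> and \<open>c2\<close>. A
  zero of either product has odd order exactly where \<open>W1\<close> hits \<open>u\<close> or
  \<open>v\<close> while \<open>W2\<close> hits \<open>x\<close> or \<open>y\<close>; so both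
  products have the same odd part.\<close>

lemma dihedral_fibers_imp_dihedral_pair:
  assumes g: "g = 1" and A2: "\<And>x. poly A x \<in> {c1, c2} \<Longrightarrow> ramif A x \<le> 2"
    and B2: "\<And>y. poly B y \<in> {c1, c2} \<Longrightarrow> ramif B y \<le> 2"
    and cA: "card {x. poly A x \<in> {c1, c2} \<and> ramif A x = 1} = 2"
    and cB: "card {y. poly B y \<in> {c1, c2} \<and> ramif B y = 1} = 2"
  shows "dihedral_pair W1 W2"
proof -
  have d: "degree W1 > 0" "degree W2 > 0" using W_nz by auto
  have r1: "r = r" and sw: "coprime_composite B A W2 W1 1 r p" using swapped g by auto
  interpret sw: coprime_composite B A W2 W1 1 r p by (rule sw)
  obtain u v where uv: "{x. poly A x \<in> {c1, c2} \<and> ramif A x = 1} = {u, v}" "u \<noteq> v"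
    using cA by (auto simp: card_2_iff)
  obtain x y where xy: "{y. poly B y \<in> {c1, c2} \<and> ramif B y = 1} = {x, y}" "x \<noteq> y"
    using cB by (auto simp: card_2_iff)
  have U: "poly W1 t \<in> {u, v} \<longleftrightarrow> poly A (poly W1 t) \<in> {c1, c2} \<and> ramif A (poly W1 t) = 1" for t
    unfolding uv(1)[symmetric] by blast
  have V: "poly W2 t \<in> {x, y} \<longleftrightarrow> poly A (poly W1 t) \<in> {c1, c2} \<and> ramif B (poly W2 t) = 1" for t
    unfolding xy(1)[symmetric] fiber_values by blast
  have o1: "poly W1 t \<in> {u, v} \<and> odd (ramif W1 t) \<longleftrightarrow> poly W1 t \<in> {u, v} \<and> poly W2 t \<in> {x, y}" for t
    unfolding U V using odd_ramif_iff[OF g, of t] B2[of "poly W2 t"] fiber_values[of t] by auto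
  have o2: "poly W2 t \<in> {x, y} \<and> odd (ramif W2 t) \<longleftrightarrow> poly W1 t \<in> {u, v} \<and> poly W2 t \<in> {x, y}" for t
    unfolding U V using sw.odd_ramif_iff[OF refl, of t] A2[of "poly W1 t"] by auto
  define F1 where "F1 = (W1 - [:u:]) * (W1 - [:v:])"
  define F2 where "F2 = (W2 - [:x:]) * (W2 - [:y:])"
  have "F1 \<noteq> 0" "F2 \<noteq> 0" using diff_const_nonzero d unfolding F1_def F2_def by (metis mult_eq_0_iff)+
  obtain S1 where S1: "F1 = (\<Prod>t | poly F1 t = 0 \<and> odd (order t F1). [:-t, 1:]) * S1 ^ 2"
    using odd_part_decomposition[OF \<open>F1 \<noteq> 0\<close>] by blast
  obtain S2 where S2: "F2 = (\<Prod>t | poly F2 t = 0 \<and> odd (order t F2). [:-t, 1:]) * S2 ^ 2"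
    using odd_part_decomposition[OF \<open>F2 \<noteq> 0\<close>] by blast
  have "{t. poly F1 t = 0 \<and> odd (order t F1)} = {t. poly W1 t \<in> {u, v} \<and> odd (ramif W1 t)}"
    unfolding F1_def order_fiber_product[OF d(1) uv(2)] by auto
  also have "\<dots> = {t. poly W2 t \<in> {x, y} \<and> odd (ramif W2 t)}" using o1 o2 by blast
  also have "\<dots> = {t. poly F2 t = 0 \<and> odd (order t F2)}"
    unfolding F2_def order_fiber_product[OF d(2) xy(2)] by auto
  finally have eq: "{t. poly F1 t = 0 \<and> odd (order t F1)} = {t. poly F2 t = 0 \<and> odd (order t F2)}" .
  have "\<exists>h. F1 = h * S1 ^ 2 \<and> F2 = h * S2 ^ 2" using S1[unfolded eq] S2 by blast
  thus ?thesis unfolding dihedral_pair_def F1_def F2_def using uv(2) xy(2) by blast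
qed

lemma ritt_ordered:
  assumes g: "g = 1" and pr: "2 \<le> p" "p < r"
  shows "cyclic_pair W1 W2 \<or> dihedral_pair W1 W2"
proof -
  have d: "degree A > 0" "degree B > 0" using degA degB ppos rpos by auto
  interpret sw: coprime_composite B A W2 W1 1 r p using swapped g by simp
  \<comment> \<open>All critical values of both maps, so that \<open>C\<close> carries their whole
    ramification.\<close>
  define C where "C = poly A ` {x. poly (pderiv A) x = 0} \<union> poly B ` {y. poly (pderiv B) y = 0}"
  have finC: "finite C" unfolding C_def
    using pderiv_nonzero d by (auto intro!: finite_imageI poly_roots_finite)
  define X where "X c = {x. poly A x = c}" for c
  define Y where "Y c = {y. poly B y = c}" for c
  interpret rd: ramification_data C X Y "\<lambda>x. int (ramif A x)" "\<lambda>y. int (ramif B y)" "int r" "int p"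
  proof
    show "(\<Sum>c\<in>C. \<Sum>x\<in>X c. int (ramif A x) - 1) = int r - 1"
      using sum_ramif_all_fibers[OF d(1) finC] degA by (auto simp: X_def C_def)
    show "(\<Sum>c\<in>C. \<Sum>y\<in>Y c. int (ramif B y) - 1) = int p - 1"
      using sum_ramif_all_fibers[OF d(2) finC] degB by (auto simp: Y_def C_def)
    show "(\<Sum>c\<in>C. \<Sum>x\<in>X c. \<Sum>y\<in>Y c. int (ramif B y) - gcd (int (ramif A x)) (int (ramif B y))) \<le> int p - 1"
      using riemann_hurwitz[OF g finC] by (simp add: X_def Y_def)
    have "(\<Sum>c\<in>C. \<Sum>x\<in>X c. \<Sum>y\<in>Y c. int (ramif A x) - gcd (int (ramif A x)) (int (ramif B y)))
       = (\<Sum>c\<in>C. \<Sum>y\<in>Y c. \<Sum>x\<in>X c. int (ramif A x) - gcd (int (ramif B y)) (int (ramif A x)))"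
      unfolding gcd.commute[of "int (ramif A _)"] by (rule sum.cong[OF refl], rule sum.swap)
    thus "(\<Sum>c\<in>C. \<Sum>x\<in>X c. \<Sum>y\<in>Y c. int (ramif A x) - gcd (int (ramif A x)) (int (ramif B y))) \<le> int r - 1"
      using sw.riemann_hurwitz[OF refl finC] by (simp add: X_def Y_def)
    show "(\<Sum>x\<in>X c. int (ramif A x)) = int r" for c
      using sum_ramif_fiber[OF d(1), of c] degA unfolding X_def of_nat_sum[symmetric] by simp
    show "(\<Sum>y\<in>Y c. int (ramif B y)) = int p" for c
      using sum_ramif_fiber[OF d(2), of c] degB unfolding Y_def of_nat_sum[symmetric] by simp
    show "coprime (int r) (int p)" using cop by (simp add: coprime_commute)
  qed (use finC finite_fiber d ramif_pos in \<open>auto simp: X_def Y_def\<close>)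
  interpret rs: ramification_data C Y X "\<lambda>y. int (ramif B y)" "\<lambda>x. int (ramif A x)" "int p" "int r"
    by (rule rd.swapped)
  have dih: "dihedral_pair W1 W2"
    if c: "c1 \<in> C" "c2 \<in> C" "c1 \<noteq> c2"
      and le2: "\<forall>c\<in>{c1, c2}. (\<forall>x\<in>X c. int (ramif A x) \<le> 2) \<and> (\<forall>y\<in>Y c. int (ramif B y) \<le> 2)"
      and out: "\<forall>c\<in>C - {c1, c2}. rd.r c = 0 \<and> rd.s c = 0" for c1 c2
  proof (rule dihedral_fibers_imp_dihedral_pair[OF g])
    show A2: "ramif A x \<le> 2" if "poly A x \<in> {c1, c2}" for x using le2 that by (force simp: X_def)
    show B2: "ramif B y \<le> 2" if "poly B y \<in> {c1, c2}" for y using le2 that by (force simp: Y_def)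
    have "(\<Sum>c\<in>{c1, c2}. rd.r c) = int r - 1"
      unfolding rd.sum_r'[symmetric] using c out finC by (intro sum.mono_neutral_left) auto
    hence "(\<Sum>c\<in>{c1, c2}. \<Sum>x | poly A x = c. int (ramif A x) - 1) = int (degree A) - 1"
      using c rd.r_eq[of c1] rd.r_eq[of c2] degA by (simp add: X_def)
    thus "card {x. poly A x \<in> {c1, c2} \<and> ramif A x = 1} = 2" by (intro card_simple_points d c A2)
    have "(\<Sum>c\<in>{c1, c2}. rd.s c) = int p - 1"
      unfolding rd.sum_s'[symmetric] using c out finC by (intro sum.mono_neutral_left) auto
    hence "(\<Sum>c\<in>{c1, c2}. \<Sum>x | poly B x = c. int (ramif B x) - 1) = int (degree B) - 1"
      using c rd.s_eq[of c1] rd.s_eq[of c2] degB by (simp add: Y_def)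
    thus "card {x. poly B x \<in> {c1, c2} \<and> ramif B x = 1} = 2" by (intro card_simple_points d c B2)
  qed
  have "(\<exists>c\<in>C. card (Y c) = 1) \<or> rd.dihedral \<or> rs.dihedral"
    using rd.classification pr by simp
  moreover have "cyclic_pair W1 W2" if "card (Y c) = 1" for c
    using single_fiber_imp_cyclic[OF g pr(1)] that by (simp add: Y_def)
  moreover have "dihedral_pair W1 W2" if "rd.dihedral"
    using that unfolding rd.dihedral_def by (meson dih)
  moreover have "dihedral_pair W1 W2" if "rs.dihedral"
  proof -
    have "rs.r = rd.s" "rs.s = rd.r" by (auto simp: rs.r_def rs.s_def rd.r_def rd.s_def fun_eq_iff)
    thus ?thesis using that unfolding rs.dihedral_def by (metis (no_types, lifting) dih)
  qed
  ultimately show ?thesis by blast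
qed

end

theorem ritt_second:
  fixes Q :: "complex poly"
  assumes "Q = A1 \<circ>\<^sub>p W1" "Q = A2 \<circ>\<^sub>p W2" "degree Q > 0"
    and "coprime (degree W1) (degree W2)" "degree W1 \<ge> 2" "degree W2 \<ge> 2"
  shows "cyclic_pair W1 W2 \<or> cyclic_pair W2 W1 \<or> dihedral_pair W1 W2"
proof -
  obtain A B where AB: "A \<circ>\<^sub>p W1 = B \<circ>\<^sub>p W2" "degree (A \<circ>\<^sub>p W1) = lcm (degree W1) (degree W2)"
    using common_composite_lcm[OF assms(1-3)] by blast
  have l: "lcm (degree W1) (degree W2) = degree W1 * degree W2" using assms(4) by (simp add: lcm_coprime)
  have "degree A * degree W1 = degree W2 * degree W1" using AB(2) l degree_pcompose[of A W1] by (simp add: mult_ac)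
  hence dA: "degree A = degree W2" using assms(5) by simp
  have "degree B * degree W2 = degree W1 * degree W2" using AB l degree_pcompose[of B W2] by simp
  hence dB: "degree B = degree W1" using assms(6) by simp
  interpret c1: coprime_composite A B W1 W2 1 "degree W1" "degree W2"
    by unfold_locales (use AB dA dB assms in auto)
  interpret c2: coprime_composite B A W2 W1 1 "degree W2" "degree W1" using c1.swapped .
  have "degree W1 \<noteq> degree W2"
  proof
    assume "degree W1 = degree W2"
    hence "degree W1 = 1" using assms(4) by simp
    thus False using assms(5) by simp
  qed
  thus ?thesis using c1.ritt_ordered[OF refl assms(5)] c2.ritt_ordered[OF refl assms(6)]
    dihedral_pair_commute[of W1 W2] by (meson linorder_neqE_nat)
qed

section \<open>Dickson polynomials and Pell equations\<close>

fun dickson :: "nat \<Rightarrow> complex poly" where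
  "dickson 0 = [:2:]"
| "dickson (Suc 0) = [:0, 1:]"
| "dickson (Suc (Suc n)) = [:0, 1:] * dickson (Suc n) - dickson n"

text \<open>At \<open>x = w + 1/w\<close>, \<open>dickson\<close> is \<open>w ^ n + 1/w ^ n\<close>
  and \<open>dickson2\<close> is \<open>(w ^ n - 1/w ^ n) / (w - 1/w)\<close>: the Chebyshev
  polynomials \<open>2 T_n(x/2)\<close> and \<open>U_(n-1)(x/2)\<close>. The index shift lets both
  with the same \<open>n\<close> form one Pell solution.\<close>

fun dickson2 :: "nat \<Rightarrow> complex poly" where
  "dickson2 0 = 0"
| "dickson2 (Suc 0) = 1"
| "dickson2 (Suc (Suc n)) = [:0, 1:] * dickson2 (Suc n) - dickson2 n"

lemma poly_dickson: "w * u = 1 \<Longrightarrow> poly (dickson n) (w + u) = w ^ n + u ^ n"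
proof (induction n rule: dickson.induct)
  case (3 n)
  have "poly (dickson (Suc (Suc n))) (w + u) = (w + u) * (w * w ^ n + u * u ^ n) - (w ^ n + u ^ n)" using 3 by simp
  also have "\<dots> = w * (w * w ^ n) + u * (u * u ^ n)"
  proof -
    have "(w + u) * (w * x + u * y) - (x + y) = w * (w * x) + u * (u * y)" for x y using 3(3) by algebra
    thus ?thesis .
  qed
  finally show ?case by simp
qed simp_all

lemma poly_dickson2: "w * u = 1 \<Longrightarrow> (w - u) * poly (dickson2 n) (w + u) = w ^ n - u ^ n"
proof (induction n rule: dickson2.induct)
  case (3 n)
  have rec: "poly (dickson2 (Suc (Suc n))) z = z * poly (dickson2 (Suc n)) z - poly (dickson2 n) z" for z by simp
  have "(w - u) * poly (dickson2 (Suc (Suc n))) (w + u)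
    = (w + u) * ((w - u) * poly (dickson2 (Suc n)) (w + u)) - (w - u) * poly (dickson2 n) (w + u)"
    unfolding rec by algebra
  also have "\<dots> = (w + u) * (w * w ^ n - u * u ^ n) - (w ^ n - u ^ n)" using 3 by simp
  also have "\<dots> = w * (w * w ^ n) - u * (u * u ^ n)"
  proof -
    have "(w + u) * (w * x - u * y) - (x - y) = w * (w * x) - u * (u * y)" for x y using 3(3) by algebra
    thus ?thesis .
  qed
  finally show ?case by simp
qed simp_all

lemma joukowsky_surj: "\<exists>w u. w * u = 1 \<and> z = w + (u :: complex)"
proof -
  obtain s where s: "s ^ 2 = z ^ 2 - 4" using complex_root_exists[of 2] by auto
  have "(z + s) * (z - s) = 4" using s by (simp add: power2_eq_square algebra_simps)
  thus ?thesis by (intro exI[of _ "(z + s) / 2"] exI[of _ "(z - s) / 2"]) (simp add: field_simps)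
qed

lemma poly_eq_joukowsky:
  assumes "\<And>w u. w * u = 1 \<Longrightarrow> poly P (w + u) = poly Q (w + u)"
  shows "P = (Q :: complex poly)"
  by (rule poly_eq_poly_eq_iff[THEN iffD1, OF ext]) (use assms joukowsky_surj in metis)

lemma degree_dickson_aux: "degree (dickson n) \<le> n \<and> coeff (dickson n) n = (if n = 0 then 2 else 1)"
proof (induction n rule: dickson.induct)
  case (3 n)
  have "degree ([:0, 1:] * dickson (Suc n)) \<le> Suc (Suc n)"
    using 3 degree_mult_le[of "[:0,1:]" "dickson (Suc n)"] by simp
  hence "degree (dickson (Suc (Suc n))) \<le> Suc (Suc n)"
    unfolding dickson.simps using 3 by (intro degree_diff_le) auto
  moreover have "coeff (dickson n) (Suc (Suc n)) = 0" using 3 by (intro coeff_eq_0) auto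
  ultimately show ?case using 3 by simp
qed auto

lemma degree_dickson: "degree (dickson n) = n"
  using degree_dickson_aux[of n] by (intro antisym le_degree) auto

lemma degree_dickson2_aux: "degree (dickson2 (Suc n)) \<le> n \<and> coeff (dickson2 (Suc n)) n = 1"
proof (induction n rule: less_induct)
  case (less n)
  consider "n = 0" | "n = 1" | k where "n = Suc (Suc k)" by (metis One_nat_def not0_implies_Suc)
  thus ?case
  proof cases
    case 3
    have IH: "degree (dickson2 (Suc (Suc k))) \<le> Suc k" "coeff (dickson2 (Suc (Suc k))) (Suc k) = 1"
      "degree (dickson2 (Suc k)) \<le> k"
      using less.IH[of "Suc k"] less.IH[of k] 3 by auto
    have "degree ([:0, 1:] * dickson2 (Suc (Suc k))) \<le> Suc (Suc k)"
      using IH degree_mult_le[of "[:0,1:]" "dickson2 (Suc (Suc k))"] by simp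
    hence "degree (dickson2 (Suc (Suc (Suc k)))) \<le> Suc (Suc k)"
      unfolding dickson2.simps(3)[of "Suc k"] using IH by (intro degree_diff_le) auto
    moreover have "coeff (dickson2 (Suc k)) (Suc (Suc k)) = 0" using IH by (intro coeff_eq_0) auto
    ultimately show ?thesis using IH 3 by (simp del: dickson2.simps add: dickson2.simps(3)[of "Suc k"])
  qed auto
qed

lemma dickson2_nonzero: "n > 0 \<Longrightarrow> dickson2 n \<noteq> 0"
  using degree_dickson2_aux[of "n - 1"] by auto

lemma degree_dickson2: "degree (dickson2 n) = n - 1"
proof (cases n)
  case (Suc k)
  thus ?thesis using degree_dickson2_aux[of k] by (intro antisym le_degree) auto
qed simp

lemma dickson_pell: "dickson n ^ 2 - 4 = [:-4, 0, 1:] * dickson2 n ^ 2"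
proof (rule poly_eq_joukowsky)
  fix w u :: complex assume w: "w * u = 1"
  define x y E where "x = w ^ n" and "y = u ^ n" and "E = poly (dickson2 n) (w + u)"
  have "x * y = 1" using w by (simp add: x_def y_def flip: power_mult_distrib)
  moreover have "(w - u) * E = x - y" using poly_dickson2[OF w] by (simp add: x_def y_def E_def)
  ultimately have "(x + y) ^ 2 - 4 = ((w + u) ^ 2 - 4) * E ^ 2" using w by algebra
  thus "poly (dickson n ^ 2 - 4) (w + u) = poly ([:-4, 0, 1:] * dickson2 n ^ 2) (w + u)"
    using poly_dickson[OF w, of n] by (simp add: x_def y_def E_def power2_eq_square algebra_simps)
qed

lemma dickson_pcompose: "dickson m \<circ>\<^sub>p dickson n = dickson (n * m)"
proof (rule poly_eq_joukowsky)
  fix w u :: complex assume w: "w * u = 1"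
  have "w ^ n * u ^ n = 1" using w by (simp flip: power_mult_distrib)
  thus "poly (dickson m \<circ>\<^sub>p dickson n) (w + u) = poly (dickson (n * m)) (w + u)"
    using w by (simp add: poly_pcompose poly_dickson power_mult)
qed

lemma poly_dickson_neg: "poly (dickson n) (- z) = (-1) ^ n * poly (dickson n) z"
  by (induction n rule: dickson.induct) (simp_all add: algebra_simps)

text \<open>Both sides are invariant under inversion, so equality means that \<open>w ^ k\<close> is
  \<open>v ^ k\<close> or its inverse. Coincidences of Dickson values thereby become conditions on
  roots of unity.\<close>

lemma dickson_eq_iff:
  assumes "w * w' = 1" "v * v' = 1"
  shows "poly (dickson k) (w + w') = poly (dickson k) (v + v') \<longleftrightarrow> (w * v') ^ k = 1 \<or> (w * v) ^ k = 1"
proof -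
  define x x' y y' where "x = w ^ k" and "x' = w' ^ k" and "y = v ^ k" and "y' = v' ^ k"
  have xy: "x * x' = 1" "y * y' = 1" using assms by (auto simp: x_def x'_def y_def y'_def simp flip: power_mult_distrib)
  have "x + x' = y + y' \<longleftrightarrow> (x * y' - 1) * (x * y - 1) = 0"
  proof
    assume "x + x' = y + y'" thus "(x * y' - 1) * (x * y - 1) = 0" using xy by algebra
  next
    assume "(x * y' - 1) * (x * y - 1) = 0" thus "x + x' = y + y'" using xy by algebra
  qed
  also have "\<dots> \<longleftrightarrow> (w * v') ^ k = 1 \<or> (w * v) ^ k = 1"
    by (simp add: x_def y_def y'_def power_mult_distrib)
  finally show ?thesis using assms by (simp add: poly_dickson x_def x'_def y_def y'_def)
qed

lemma root_of_unity_gcd: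
  fixes x :: complex
  assumes "x ^ i = 1" "x ^ j = 1" shows "x ^ gcd i j = 1"
proof (cases "i = 0")
  case False
  then obtain k l where "i * k = j * l + gcd i j" using bezout_nat by blast
  hence "(x ^ i) ^ k = (x ^ j) ^ l * x ^ gcd i j" by (simp flip: power_mult power_add)
  thus ?thesis using assms by simp
qed (use assms in simp)

section \<open>Polynomial Pell equations\<close>

definition pell :: "complex poly \<Rightarrow> complex poly \<Rightarrow> bool" where
  "pell h X \<longleftrightarrow> (\<exists>S. X ^ 2 - 4 = h * S ^ 2)"

lemma pell_dickson:
  assumes "pell h Z" shows "pell h (dickson n \<circ>\<^sub>p Z)"
proof -
  obtain P where P: "Z ^ 2 - 4 = h * P ^ 2" using assms by (auto simp: pell_def)
  have "(dickson n \<circ>\<^sub>p Z) ^ 2 - 4 = (dickson n ^ 2 - 4) \<circ>\<^sub>p Z"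
    by (simp add: pcompose_diff pcompose_power) (metis numeral_poly pcompose_const)
  also have "\<dots> = (Z ^ 2 - 4) * (dickson2 n \<circ>\<^sub>p Z) ^ 2"
  proof -
    have "[:-4, 0, 1:] \<circ>\<^sub>p Z = Z ^ 2 - 4" by (simp add: pcompose_pCons power2_eq_square numeral_poly)
    thus ?thesis unfolding dickson_pell pcompose_mult pcompose_power by simp
  qed
  finally have "(dickson n \<circ>\<^sub>p Z) ^ 2 - 4 = h * (P * (dickson2 n \<circ>\<^sub>p Z)) ^ 2" using P by (simp add: power_mult_distrib mult.assoc)
  thus ?thesis unfolding pell_def by blast
qed

text \<open>Multiplication of the norm-one units \<open>(X + S * sqrt h) / 2\<close> and
  \<open>(Z - P * sqrt h) / 2\<close>. The quadratic relation eliminates \<open>S\<close> and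
  \<open>P\<close>: for \<open>X = a + 1/a\<close> and \<open>Z = b + 1/b\<close> it is solved by
  \<open>a/b + b/a\<close>.\<close>

lemma pell_pairs_commute:
  fixes X Z h S P :: "complex poly"
  assumes X: "X ^ 2 - 4 = h * S ^ 2" and Z: "Z ^ 2 - 4 = h * P ^ 2"
  shows "\<exists>X'. 2 * X' = X * Z - h * S * P \<and> pell h X' \<and> X' ^ 2 - X * Z * X' + X ^ 2 + Z ^ 2 - 4 = 0"
proof -
  define X' where "X' = smult (1/2) (X * Z - h * S * P)"
  define S' where "S' = smult (1/2) (S * Z - X * P)"
  have two: "(2::complex poly) * smult (1/2) Q = Q" for Q by (simp add: numeral_poly)
  have X': "2 * X' = X * Z - h * S * P" and S': "2 * S' = S * Z - X * P" unfolding X'_def S'_def by (rule two)+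
  have hS: "h * S ^ 2 = X ^ 2 - 4" "h * P ^ 2 = Z ^ 2 - 4" using X Z by auto
  have "4 * (X' ^ 2 - h * S' ^ 2) = (2 * X') ^ 2 - h * (2 * S') ^ 2" by (simp add: power_mult_distrib algebra_simps)
  also have "\<dots> = (X ^ 2 - h * S ^ 2) * (Z ^ 2 - h * P ^ 2)" unfolding X' S' by algebra
  also have "\<dots> = 4 * 4" unfolding hS by simp
  finally have "X' ^ 2 - h * S' ^ 2 = 4" by (metis mult_left_cancel zero_neq_numeral)
  hence "pell h X'" unfolding pell_def by (intro exI[of _ S']) (simp add: algebra_simps)
  moreover have "(X * Z - 2 * X') ^ 2 = (X ^ 2 - 4) * (Z ^ 2 - 4)"
    unfolding X' hS[symmetric] by algebra
  hence "4 * (X' ^ 2 - X * Z * X' + X ^ 2 + Z ^ 2 - 4) = 0" by algebra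
  hence "X' ^ 2 - X * Z * X' + X ^ 2 + Z ^ 2 - 4 = 0" by (metis mult_eq_0_iff zero_neq_numeral)
  ultimately show ?thesis using X' by blast
qed

text \<open>With \<open>X'\<close> of index \<open>i\<close>, the relation is quadratic in
  \<open>X\<close> and its roots are the neighbours of index \<open>i + 1\<close> and
  \<open>i - 1\<close> with the same sign; for \<open>i = 0\<close> it degenerates to a
  square.\<close>

lemma dickson_step:
  fixes X Z :: "complex poly"
  assumes "X' ^ 2 - X * Z * X' + X ^ 2 + Z ^ 2 - 4 = 0" "X' = smult s (dickson i \<circ>\<^sub>p Z)" "s = 1 \<or> s = -1"
  shows "\<exists>j. X = smult s (dickson j \<circ>\<^sub>p Z)"
proof (cases i)
  case 0
  have "X = smult s Z"
    using assms(3)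
  proof
    assume "s = 1"
    hence "X' = 2" using assms(2) 0 by (simp add: numeral_poly)
    hence "(X - Z) ^ 2 = X' ^ 2 - X * Z * X' + X ^ 2 + Z ^ 2 - 4" by (simp add: power2_eq_square algebra_simps)
    hence "(X - Z) ^ 2 = 0" using assms(1) by simp
    thus ?thesis using \<open>s = 1\<close> by simp
  next
    assume "s = -1"
    hence "X' = -2" using assms(2) 0 by (simp add: numeral_poly)
    hence "(X + Z) ^ 2 = X' ^ 2 - X * Z * X' + X ^ 2 + Z ^ 2 - 4" by (simp add: power2_eq_square algebra_simps)
    hence "(X + Z) ^ 2 = 0" using assms(1) by simp
    hence "X = - Z" by (simp add: eq_neg_iff_add_eq_0)
    thus ?thesis using \<open>s = -1\<close> by simp
  qed
  hence "X = smult s (dickson 1 \<circ>\<^sub>p Z)" by (simp add: pcompose_pCons)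
  thus ?thesis by blast
next
  case (Suc k)
  define D where "D n = dickson n \<circ>\<^sub>p Z" for n
  have rec: "D (Suc i) = Z * D i - D k"
    by (simp add: D_def Suc pcompose_diff pcompose_mult pcompose_pCons)
  have "dickson (Suc i) * dickson k = dickson i ^ 2 + [:-4, 0, 1:]"
  proof (rule poly_eq_joukowsky)
    fix w u :: complex assume w: "w * u = 1"
    define x y where "x = w ^ k" and "y = u ^ k"
    have "x * y = 1" using w by (simp add: x_def y_def flip: power_mult_distrib)
    hence "(w * (w * x) + u * (u * y)) * (x + y) = (w * x + u * y) ^ 2 + ((w + u) ^ 2 - 4)" using w by algebra
    thus "poly (dickson (Suc i) * dickson k) (w + u) = poly (dickson i ^ 2 + [:-4, 0, 1:]) (w + u)"
      using w by (simp add: poly_dickson Suc x_def y_def power2_eq_square del: dickson.simps)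
  qed
  hence prod: "D (Suc i) * D k = D i ^ 2 + Z ^ 2 - 4"
    unfolding D_def by (simp flip: pcompose_mult add: pcompose_add pcompose_power)
      (simp add: pcompose_pCons power2_eq_square numeral_poly)
  define Y where "Y = smult s X"
  have XY: "X = smult s Y" using assms(3) by (auto simp: Y_def)
  have "(D i) ^ 2 - Y * Z * D i + Y ^ 2 + Z ^ 2 - 4 = 0"
    using assms(1,3) unfolding assms(2) XY D_def by auto
  hence "(Y - D (Suc i)) * (Y - D k) = 0" using prod rec by algebra
  hence "Y = D (Suc i) \<or> Y = D k" by auto
  thus ?thesis unfolding XY D_def by blast
qed

lemma lead_coeff_square: "lead_coeff (X ^ 2) = lead_coeff X ^ 2" for X :: "complex poly"
  by (simp add: lead_coeff_power)

lemma pell_degree_pos: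
  assumes "pell h Z" "degree Z > 0" shows "degree h > 0"
proof (rule ccontr)
  assume "\<not> degree h > 0"
  then obtain c where c: "h = [:c:]" by (metis degree_eq_zeroE neq0_conv)
  obtain P where P: "Z ^ 2 - 4 = h * P ^ 2" using assms by (auto simp: pell_def)
  obtain s where s: "s ^ 2 = c" using complex_root_exists[of 2] by auto
  have eq: "(Z - smult s P) * (Z + smult s P) = 4"
    using P s c by (simp add: power2_eq_square algebra_simps)
  hence "Z - smult s P \<noteq> 0" "Z + smult s P \<noteq> 0" by auto
  hence "degree (Z - smult s P) + degree (Z + smult s P) = degree (4 :: complex poly)"
    using eq degree_mult_eq by metis
  hence "degree (Z - smult s P) = 0" "degree (Z + smult s P) = 0" by simp_all
  hence "degree ((Z - smult s P) + (Z + smult s P)) = 0" using degree_add_le[of _ 0] by (metis le_zero_eq)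
  moreover have "(Z - smult s P) + (Z + smult s P) = smult 2 Z" by (simp add: numeral_poly)
  ultimately show False using assms(2) by simp
qed

lemma pell_nonconst:
  fixes X h S :: "complex poly"
  assumes "X ^ 2 - 4 = h * S ^ 2" "degree h > 0" "degree X > 0"
  shows "S \<noteq> 0" "2 * degree X = degree h + 2 * degree S" "lead_coeff X ^ 2 = lead_coeff h * lead_coeff S ^ 2"
proof -
  have X0: "X \<noteq> 0" using assms by auto
  have d: "degree (X ^ 2 - 4) = 2 * degree X" "lead_coeff (X ^ 2 - 4) = lead_coeff X ^ 2"
  proof -
    have eq: "X ^ 2 - 4 = X ^ 2 - [:4:]" by (simp add: numeral_poly)
    show 1: "degree (X ^ 2 - 4) = 2 * degree X"
      unfolding eq degree_diff_const using X0 by (simp add: degree_power_eq)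
    have "coeff (4 :: complex poly) (2 * degree X) = 0" using assms(3) by (intro coeff_eq_0) simp
    thus "lead_coeff (X ^ 2 - 4) = lead_coeff X ^ 2" unfolding 1
      using lead_coeff_square[of X] X0 by (simp add: degree_power_eq)
  qed
  show S0: "S \<noteq> 0"
  proof
    assume "S = 0"
    hence "degree (X ^ 2 - 4) = 0" using assms(1) by simp
    thus False using d assms(3) by simp
  qed
  have h0: "h \<noteq> 0" using assms by auto
  show "2 * degree X = degree h + 2 * degree S"
    unfolding d(1)[symmetric] assms(1) using h0 S0 by (simp add: degree_mult_eq degree_power_eq)
  show "lead_coeff X ^ 2 = lead_coeff h * lead_coeff S ^ 2"
    unfolding d(2)[symmetric] assms(1) using h0 S0 by (simp add: lead_coeff_mult lead_coeff_power)
qed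

text \<open>Descent by dividing units. For the right sign of \<open>P\<close> the leading terms of
  \<open>S * Z + X * P\<close> do not cancel, while
  \<open>(S * Z - X * P) * (S * Z + X * P) = 4 * (S ^ 2 - P ^ 2)\<close> has degree at most
  \<open>2 * degree S\<close>. So the companion \<open>S'\<close> of \<open>X'\<close> is 0 or of
  smaller degree than \<open>S\<close>, and \<open>degree X' < degree X\<close>.\<close>

lemma pell_reduce:
  fixes X Z h :: "complex poly"
  assumes "pell h X" "pell h Z" "degree Z > 0" "degree Z \<le> degree X"
  shows "\<exists>X'. pell h X' \<and> degree X' < degree X \<and> X' ^ 2 - X * Z * X' + X ^ 2 + Z ^ 2 - 4 = 0"
proof -
  have dh: "degree h > 0" using pell_degree_pos assms by blast
  have dX: "degree X > 0" using assms by simp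
  obtain S where S: "X ^ 2 - 4 = h * S ^ 2" using assms by (auto simp: pell_def)
  obtain P0 where P0: "Z ^ 2 - 4 = h * P0 ^ 2" using assms by (auto simp: pell_def)
  note nS = pell_nonconst[OF S dh dX] and nP0 = pell_nonconst[OF P0 dh assms(3)]
  have hz: "lead_coeff h \<noteq> 0" using dh by auto
  have "(lead_coeff X * lead_coeff P0) ^ 2 = (lead_coeff S * lead_coeff Z) ^ 2"
    using nS(3) nP0(3) by (simp add: power_mult_distrib)
  hence "lead_coeff X * lead_coeff P0 = lead_coeff S * lead_coeff Z \<or> lead_coeff X * lead_coeff P0 = - (lead_coeff S * lead_coeff Z)"
    by (simp add: power2_eq_iff)
  then obtain P where P: "Z ^ 2 - 4 = h * P ^ 2" "lead_coeff X * lead_coeff P = lead_coeff S * lead_coeff Z"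
  proof
    assume "lead_coeff X * lead_coeff P0 = lead_coeff S * lead_coeff Z"
    thus thesis using that P0 by blast
  next
    assume "lead_coeff X * lead_coeff P0 = - (lead_coeff S * lead_coeff Z)"
    thus thesis using that[of "- P0"] P0 by simp
  qed
  note nP = pell_nonconst[OF P(1) dh assms(3)]
  obtain X' where X': "2 * X' = X * Z - h * S * P" "pell h X'"
    "X' ^ 2 - X * Z * X' + X ^ 2 + Z ^ 2 - 4 = 0" using pell_pairs_commute[OF S P(1)] by blast
  have Xnz: "X \<noteq> 0" "Z \<noteq> 0" using dX assms(3) by auto
  have dsum: "degree (S * Z) = degree S + degree Z" "degree (X * P) = degree S + degree Z"
    using nS nP Xnz by (auto simp: degree_mult_eq)
  have "coeff (S * Z + X * P) (degree S + degree Z) = lead_coeff (S * Z) + lead_coeff (X * P)"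
    using dsum by simp
  also have "\<dots> = 2 * (lead_coeff S * lead_coeff Z)" using P(2) by (simp add: lead_coeff_mult)
  finally have c: "coeff (S * Z + X * P) (degree S + degree Z) \<noteq> 0" using nS Xnz by simp
  hence plus: "degree (S * Z + X * P) \<ge> degree S + degree Z" "S * Z + X * P \<noteq> 0"
    by (rule le_degree, metis c coeff_0)
  have fact: "(S * Z - X * P) * (S * Z + X * P) = 4 * (S ^ 2 - P ^ 2)"
  proof -
    have "(S * Z - X * P) * (S * Z + X * P) = S ^ 2 * (Z ^ 2 - 4) + 4 * S ^ 2 - P ^ 2 * (X ^ 2 - 4) - 4 * P ^ 2"
      by algebra
    also have "\<dots> = 4 * (S ^ 2 - P ^ 2)" unfolding S P(1) by algebra
    finally show ?thesis .
  qed
  have "degree P \<le> degree S" using nS nP assms(4) by linarith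
  hence "degree (S ^ 2 - P ^ 2) \<le> 2 * degree S"
    using degree_power_le[of S 2] degree_power_le[of P 2] by (intro degree_diff_le) auto
  have "degree (4 * (S ^ 2 - P ^ 2)) = degree (S ^ 2 - P ^ 2)" by (simp add: numeral_poly)
  have dle: "S * Z - X * P = 0 \<or> degree (S * Z - X * P) + degree S + degree Z \<le> 2 * degree S"
  proof (cases "S * Z - X * P = 0")
    case False
    have "degree (S * Z - X * P) + degree (S * Z + X * P) = degree (S ^ 2 - P ^ 2)"
      unfolding degree_mult_eq[OF False plus(2), symmetric] fact by fact
    thus ?thesis using plus(1) \<open>degree (S ^ 2 - P ^ 2) \<le> 2 * degree S\<close> by linarith
  qed simp
  define S' where "S' = smult (1/2) (S * Z - X * P)"
  have two: "2 * S' = S * Z - X * P" by (simp add: S'_def numeral_poly)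
  have "4 * (X' ^ 2 - h * S' ^ 2) = (2 * X') ^ 2 - h * (2 * S') ^ 2" by (simp add: power_mult_distrib algebra_simps)
  also have "\<dots> = (X ^ 2 - h * S ^ 2) * (Z ^ 2 - h * P ^ 2)" unfolding X' two by algebra
  also have "\<dots> = 4 * 4" unfolding S[symmetric] P(1)[symmetric] by simp
  finally have "X' ^ 2 - h * S' ^ 2 = 4" by (metis mult_left_cancel zero_neq_numeral)
  hence XS': "X' ^ 2 - 4 = h * S' ^ 2" by (simp add: algebra_simps)
  have "degree X' < degree X"
  proof (cases "degree X' = 0")
    case False
    hence n: "S' \<noteq> 0" "2 * degree X' = degree h + 2 * degree S'" using pell_nonconst[OF XS' dh] by auto
    have "degree S' < degree S" using n(1) dle assms(3) by (auto simp: S'_def)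
    thus ?thesis using n(2) nS(2) by linarith
  qed (use dX in simp)
  thus ?thesis using X' by blast
qed

text \<open>A solution \<open>Z\<close> of least positive degree generates all others:
  \<open>pell_reduce\<close> descends to a constant solution, which is 2 or -2, and
  \<open>dickson_step\<close> climbs back.\<close>

lemma pell_generated:
  fixes h :: "complex poly"
  assumes "pell h X0" "degree X0 > 0"
  shows "\<exists>Z. pell h Z \<and> degree Z > 0 \<and> (\<forall>X. pell h X \<longrightarrow> (\<exists>i s. (s = 1 \<or> s = -1) \<and> X = smult s (dickson i \<circ>\<^sub>p Z)))"
proof -
  define Z where "Z = arg_min degree (\<lambda>Z. pell h Z \<and> degree Z > 0)"
  have Z: "pell h Z \<and> degree Z > 0" unfolding Z_def using assms by (intro arg_min_natI) auto
  have min: "degree Z \<le> degree X" if "pell h X" "degree X > 0" for X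
    unfolding Z_def using that by (intro arg_min_nat_le) auto
  have dh: "degree h > 0" using pell_degree_pos Z by blast
  have "\<exists>i s. (s = 1 \<or> s = -1) \<and> X = smult s (dickson i \<circ>\<^sub>p Z)" if "pell h X" for X
    using that
  proof (induction "degree X" arbitrary: X rule: less_induct)
    case less
    show ?case
    proof (cases "degree X = 0")
      case True
      then obtain x where x: "X = [:x:]" by (metis degree_eq_zeroE)
      obtain S where S: "X ^ 2 - 4 = h * S ^ 2" using less.prems by (auto simp: pell_def)
      have "S = 0"
      proof (rule ccontr)
        assume "S \<noteq> 0"
        hence "degree (h * S ^ 2) > 0" using dh by (subst degree_mult_eq) auto
        moreover have "X ^ 2 - 4 = [:x ^ 2 - 4:]" by (simp add: x power2_eq_square numeral_poly)
        ultimately show False using S by simp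
      qed
      hence "X ^ 2 = 4" using S by simp
      hence "[:x ^ 2:] = [:4:]" by (simp add: x power2_eq_square numeral_poly)
      hence "x ^ 2 = 2 ^ 2" by simp
      hence "x = 2 \<or> x = -2" using power2_eq_iff by blast
      thus ?thesis
      proof
        assume "x = 2"
        thus ?thesis using x by (intro exI[of _ 0] exI[of _ 1]) simp
      next
        assume "x = -2"
        thus ?thesis using x by (intro exI[of _ 0] exI[of _ "-1"]) simp
      qed
    next
      case False
      then obtain X' where X': "pell h X'" "degree X' < degree X" "X' ^ 2 - X * Z * X' + X ^ 2 + Z ^ 2 - 4 = 0"
        using pell_reduce[OF less.prems] Z min[OF less.prems] by auto
      obtain i s where si: "s = 1 \<or> s = -1" "X' = smult s (dickson i \<circ>\<^sub>p Z)" using less.hyps[OF X'(2,1)] by blast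
      show ?thesis using dickson_step[OF X'(3) si(2,1)] si(1) by blast
    qed
  qed
  thus ?thesis using Z by blast
qed

text \<open>The canonical square-free radicand: Pell equations whose radicands differ by square
  factors are compared through it.\<close>

definition odd_part :: "complex poly \<Rightarrow> complex poly" where
  "odd_part F = (\<Prod>t | poly F t = 0 \<and> odd (order t F). [:-t, 1:])"

lemma odd_part_cong_square:
  assumes "F = g * S ^ 2" "F \<noteq> 0" shows "odd_part F = odd_part g"
proof -
  have nz: "g \<noteq> 0" "S \<noteq> 0" using assms by auto
  have o: "order t F = order t g + 2 * order t S" for t
    using nz by (simp add: assms(1) order_mult order_power)
  have r: "(poly G t = 0 \<and> odd (order t G)) = odd (order t G)" if "G \<noteq> 0" for G t
    using that order_root[of G t] by (auto intro: ccontr)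
  show ?thesis unfolding odd_part_def r[OF assms(2)] r[OF nz(1)] unfolding o by simp
qed

lemma pell_odd_part:
  assumes "pell g X" "degree X > 0"
  shows "odd_part (X ^ 2 - 4) = odd_part g" "pell (odd_part g) X"
proof -
  obtain S where S: "X ^ 2 - 4 = g * S ^ 2" using assms by (auto simp: pell_def)
  have nz: "X ^ 2 - 4 \<noteq> 0"
  proof
    assume "X ^ 2 - 4 = 0"
    hence "degree (X ^ 2) = degree (4 :: complex poly)" by simp
    thus False using assms(2) by (subst (asm) degree_power_eq) auto
  qed
  show 1: "odd_part (X ^ 2 - 4) = odd_part g" using odd_part_cong_square[OF S nz] .
  obtain T where "X ^ 2 - 4 = odd_part (X ^ 2 - 4) * T ^ 2"
    using odd_part_decomposition[OF nz] by (auto simp: odd_part_def)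
  thus "pell (odd_part g) X" unfolding 1 pell_def by blast
qed

lemma dihedral_pair_imp_pell:
  assumes "dihedral_pair W1 W2"
  shows "\<exists>h X1 X2 a1 b1 a2 b2. pell h X1 \<and> pell h X2 \<and> a1 \<noteq> 0 \<and> a2 \<noteq> 0 \<and>
    W1 = smult a1 X1 + [:b1:] \<and> W2 = smult a2 X2 + [:b2:]"
proof -
  have *: "\<exists>X a b. pell h X \<and> a \<noteq> 0 \<and> W = smult a X + [:b:]"
    if "u \<noteq> v" "(W - [:u:]) * (W - [:v:]) = h * S ^ 2" for u v W h S
  proof -
    define k where "k = 4 / (u - v)"
    define X where "X = smult k W - [:k * (u + v) / 2:]"
    have "4 / D * D = 4" if "D \<noteq> 0" for D :: complex using that by simp
    from this[of "u - v"] have k: "k \<noteq> 0" "k * (u - v) = 4" using that unfolding k_def by auto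
    have four: "(k * u - k * v) * (k * u - k * v) = 16" using k(2) by (simp add: right_diff_distrib)
    have "X ^ 2 - 4 = smult (k ^ 2) ((W - [:u:]) * (W - [:v:]))"
    proof (rule poly_eq_poly_eq_iff[THEN iffD1, OF ext])
      fix z
      define w where "w = poly W z"
      have "(k * w - k * (u + v) / 2) ^ 2 - 4 = k ^ 2 * ((w - u) * (w - v)) + (k * u - k * v) * (k * u - k * v) / 4 - 4"
        by (simp add: power2_eq_square field_simps)
      also have "\<dots> = k ^ 2 * ((w - u) * (w - v))" by (simp add: four)
      finally show "poly (X ^ 2 - 4) z = poly (smult (k ^ 2) ((W - [:u:]) * (W - [:v:]))) z"
        by (simp add: X_def w_def)
    qed
    also have "\<dots> = h * (smult k S) ^ 2" unfolding that(2) by (simp add: smult_power)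
    finally have "pell h X" unfolding pell_def by blast
    moreover have "W = smult (1 / k) X + [:(u + v) / 2:]"
      using k(1) by (simp add: X_def smult_diff_right)
    ultimately show ?thesis using k(1) by (metis divide_eq_0_iff one_neq_zero)
  qed
  obtain u v x y h S1 S2 where d: "u \<noteq> v" "x \<noteq> y" "(W1 - [:u:]) * (W1 - [:v:]) = h * S1 ^ 2"
    "(W2 - [:x:]) * (W2 - [:y:]) = h * S2 ^ 2" using assms unfolding dihedral_pair_def by blast
  show ?thesis using *[OF d(1,3)] *[OF d(2,4)] by metis
qed

text \<open>Since \<open>\<xi> ^ gcd i j = 1\<close>, the Dickson polynomial of index
  \<open>gcd i j\<close> in \<open>Z\<close> takes equal values at the two points, and both
  solutions are polynomials in it because indices multiply under composition.\<close>

lemma two_pell_gcd: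
  fixes \<xi> \<alpha> \<beta> :: complex
  assumes "X = smult s (dickson i \<circ>\<^sub>p Z)" "X' = smult s' (dickson j \<circ>\<^sub>p Z)"
    and "\<xi> ^ i = 1" "\<xi> ^ j = 1"
    and \<xi>: "\<And>k. \<xi> ^ k = 1 \<Longrightarrow> poly (dickson k) (poly Z \<alpha>) = poly (dickson k) (poly Z \<beta>)"
  shows "\<exists>Y U U'. poly Y \<alpha> = poly Y \<beta> \<and> X = U \<circ>\<^sub>p Y \<and> X' = U' \<circ>\<^sub>p Y"
proof -
  define g where "g = gcd i j"
  define Y where "Y = dickson g \<circ>\<^sub>p Z"
  have "poly Y \<alpha> = poly Y \<beta>"
    using \<xi>[OF root_of_unity_gcd[OF assms(3,4)]] by (simp add: Y_def g_def poly_pcompose)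
  moreover have "smult r (dickson k \<circ>\<^sub>p Z) = smult r (dickson (k div g)) \<circ>\<^sub>p Y" if "g dvd k" for k r
    using that by (simp add: Y_def pcompose_smult pcompose_assoc dickson_pcompose)
  hence "X = smult s (dickson (i div g)) \<circ>\<^sub>p Y" "X' = smult s' (dickson (j div g)) \<circ>\<^sub>p Y"
    unfolding assms(1,2) by (auto simp: g_def)
  ultimately show ?thesis by blast
qed

definition common_closed_factor :: "complex \<Rightarrow> complex \<Rightarrow> complex poly \<Rightarrow> complex poly \<Rightarrow> bool" where
  "common_closed_factor \<alpha> \<beta> X X' \<longleftrightarrow> (\<exists>Y U U'. poly Y \<alpha> = poly Y \<beta> \<and> X = U \<circ>\<^sub>p Y \<and> X' = U' \<circ>\<^sub>p Y)"

text \<open>Writing \<open>Z \<alpha> = w + 1/w\<close> and \<open>Z \<beta> = v + 1/v\<close>, each of the three solutions makes a power of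
  \<open>w/v\<close> or of \<open>w v\<close> equal to one; two of them do so for the same number.\<close>

lemma three_pell:
  assumes "pell h X1" "pell h X2" "pell h X3" "degree X1 > 0"
    and "poly X1 \<alpha> = poly X1 \<beta>" "poly X2 \<alpha> = poly X2 \<beta>" "poly X3 \<alpha> = poly X3 \<beta>"
  shows "common_closed_factor \<alpha> \<beta> X1 X2 \<or> common_closed_factor \<alpha> \<beta> X1 X3 \<or> common_closed_factor \<alpha> \<beta> X2 X3"
proof -
  obtain Z where Z: "\<And>X. pell h X \<Longrightarrow> \<exists>i s. s \<noteq> 0 \<and> X = smult s (dickson i \<circ>\<^sub>p Z)"
    using pell_generated[OF assms(1,4)] by (metis neg_equal_0_iff_equal zero_neq_one)
  obtain i1 s1 where X1: "X1 = smult s1 (dickson i1 \<circ>\<^sub>p Z)" "s1 \<noteq> 0" using Z[OF assms(1)] by blast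
  obtain i2 s2 where X2: "X2 = smult s2 (dickson i2 \<circ>\<^sub>p Z)" "s2 \<noteq> 0" using Z[OF assms(2)] by blast
  obtain i3 s3 where X3: "X3 = smult s3 (dickson i3 \<circ>\<^sub>p Z)" "s3 \<noteq> 0" using Z[OF assms(3)] by blast
  obtain w w' where w: "w * w' = 1" "poly Z \<alpha> = w + w'" using joukowsky_surj by blast
  obtain v v' where v: "v * v' = 1" "poly Z \<beta> = v + v'" using joukowsky_surj by blast
  have iff: "poly (dickson k) (poly Z \<alpha>) = poly (dickson k) (poly Z \<beta>) \<longleftrightarrow> (w * v') ^ k = 1 \<or> (w * v) ^ k = 1" for k
    unfolding w v by (rule dickson_eq_iff[OF w(1) v(1)])
  have e: "(w * v') ^ i1 = 1 \<or> (w * v) ^ i1 = 1" "(w * v') ^ i2 = 1 \<or> (w * v) ^ i2 = 1"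
    "(w * v') ^ i3 = 1 \<or> (w * v) ^ i3 = 1"
    using assms(5-7) X1 X2 X3 by (auto simp: poly_pcompose iff)
  note c = two_pell_gcd[where \<alpha> = \<alpha> and \<beta> = \<beta>, folded common_closed_factor_def]
  show ?thesis
    using e c[OF X1(1) X2(1), of "w * v'"] c[OF X1(1) X2(1), of "w * v"]
      c[OF X1(1) X3(1), of "w * v'"] c[OF X1(1) X3(1), of "w * v"]
      c[OF X2(1) X3(1), of "w * v'"] c[OF X2(1) X3(1), of "w * v"] iff by blast
qed

section \<open>Exceptional values of Dickson polynomials and their uniqueness\<close>

lemma card_roots_pcompose_le:
  fixes G V :: "complex poly"
  assumes "G \<noteq> 0" "degree V > 0" "\<And>t. t \<in> T \<Longrightarrow> poly G (poly V t) = 0"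
  shows "card T \<le> degree G * degree V"
proof -
  have nz: "G \<circ>\<^sub>p V \<noteq> 0" using assms by (simp add: pcompose_eq_0_iff)
  have "T \<subseteq> {t. poly (G \<circ>\<^sub>p V) t = 0}" using assms(3) by (auto simp: poly_pcompose)
  hence "card T \<le> card {t. poly (G \<circ>\<^sub>p V) t = 0}" using nz poly_roots_finite by (intro card_mono)
  also have "\<dots> \<le> degree (G \<circ>\<^sub>p V)" using nz by (rule card_poly_roots_bound)
  finally show ?thesis by (simp add: degree_pcompose)
qed

lemma dickson_odd_factor:
  "dickson (2 * k + 1) - 2 = [:-2, 1:] * (dickson2 (Suc k) + dickson2 k) ^ 2"
proof -
  define G where "G = dickson2 (Suc k) + dickson2 k"
  \<comment> \<open>With \<open>w = s ^ 2\<close> and \<open>u = t ^ 2\<close>,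
    \<open>dickson (2 * k + 1) - 2\<close> becomes the square of
    \<open>s ^ (2 * k + 1) - t ^ (2 * k + 1)\<close>. The extra factor \<open>x + 2\<close>
    completes \<open>x - 2\<close> to \<open>(w - u) ^ 2\<close>, as the formula for
    \<open>dickson2\<close> needs.\<close>
  have "[:2, 1:] * (dickson (2 * k + 1) - 2) = [:2, 1:] * ([:-2, 1:] * G ^ 2)"
  proof (rule poly_eq_joukowsky)
    fix w u :: complex assume w: "w * u = 1"
    obtain s where s: "s ^ 2 = w" using complex_root_exists[of 2] by auto
    define t where "t = s * u"
    have "s * t = s ^ 2 * u" "t ^ 2 = (s ^ 2 * u) * u" by (simp_all add: t_def power2_eq_square)
    hence st: "s * t = 1" "t ^ 2 = u" by (simp_all add: s w)
    define x y where "x = s ^ (2 * k + 1)" and "y = t ^ (2 * k + 1)"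
    have "x * y = (s * t) ^ (2 * k + 1)" unfolding x_def y_def by (simp only: power_mult_distrib)
    hence xy: "x * y = 1" by (simp add: st)
    define g where "g = poly G (w + u)"
    have pow: "w ^ k * s = x" "u ^ k * t = y" by (simp_all add: x_def y_def power_add power_mult s st)
    have "(w - u) * g = (w ^ Suc k - u ^ Suc k) + (w ^ k - u ^ k)"
      using poly_dickson2[OF w, of "Suc k"] poly_dickson2[OF w, of k] by (simp add: g_def G_def distrib_left)
    also have "\<dots> = (s + t) * (x - y)"
    proof -
      have "(s ^ 2 * a - t ^ 2 * b) + (a - b) = (s + t) * (a * s - b * t)" for a b using st(1) by algebra
      thus ?thesis unfolding pow[symmetric] power_Suc s[symmetric] st(2)[symmetric] .
    qed
    finally have g: "(w - u) * g = (s + t) * (x - y)" .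
    have D: "poly (dickson (2 * k + 1)) (w + u) = x ^ 2 + y ^ 2"
    proof -
      have "(r ^ (2 * k + 1)) ^ 2 = (r ^ 2) ^ (2 * k + 1)" for r :: complex
        by (simp only: power_mult[symmetric] mult.commute)
      thus ?thesis using poly_dickson[OF w, of "2 * k + 1"] by (simp only: x_def y_def s st(2))
    qed
    have "(w + u + 2) * (x ^ 2 + y ^ 2 - 2) = (w + u + 2) * ((w + u - 2) * g ^ 2)"
    proof -
      have "(w + u + 2) * (x ^ 2 + y ^ 2 - 2) = ((s + t) * (x - y)) ^ 2"
      proof -
        have "(s + t) ^ 2 = w + u + 2" using s st by (simp add: power2_sum mult.assoc)
        moreover have "(x - y) ^ 2 = x ^ 2 + y ^ 2 - 2" using xy by (simp add: power2_diff mult.assoc)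
        ultimately show ?thesis by (simp add: power_mult_distrib)
      qed
      also have "\<dots> = ((w - u) * g) ^ 2" by (simp add: g)
      also have "\<dots> = (w + u + 2) * ((w + u - 2) * g ^ 2)" using w by algebra
      finally show ?thesis .
    qed
    thus "poly ([:2, 1:] * (dickson (2 * k + 1) - 2)) (w + u) = poly ([:2, 1:] * ([:-2, 1:] * G ^ 2)) (w + u)"
      using D by (simp add: g_def algebra_simps del: dickson.simps)
  qed
  thus ?thesis unfolding G_def by (metis mult_left_cancel pCons_eq_0_iff one_neq_zero)
qed

lemma dickson_odd_factor_exists:
  assumes "odd p" "e = 2 \<or> e = -2"
  shows "\<exists>G. G \<noteq> 0 \<and> degree G \<le> p div 2 \<and> dickson p - [:e:] = [:-e, 1:] * G ^ 2"
proof -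
  obtain k where k: "p = 2 * k + 1" using assms by (auto elim: oddE)
  define G where "G = dickson2 (Suc k) + dickson2 k"
  have "coeff (dickson2 k) k = 0 \<or> k = 0" using degree_dickson2[of k] by (auto intro: coeff_eq_0)
  hence "coeff G k = 1" using degree_dickson2_aux[of k] by (auto simp: G_def)
  hence nz: "G \<noteq> 0" by auto
  have "degree G \<le> k" unfolding G_def using degree_dickson2[of k] degree_dickson2[of "Suc k"]
    by (intro degree_add_le) auto
  have two: "[:2:] = (2 :: complex poly)" by (simp add: numeral_poly)
  have id: "dickson p - [:2:] = [:-2, 1:] * G ^ 2"
    unfolding two k G_def by (rule dickson_odd_factor)
  from assms(2) show ?thesis
  proof
    assume "e = 2"
    thus ?thesis using id nz \<open>degree G \<le> k\<close> k by (intro exI[of _ G]) auto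
  next
    assume e: "e = -2"
    define H where "H = G \<circ>\<^sub>p [:0, -1:]"
    have "H \<noteq> 0" using nz by (simp add: H_def pcompose_eq_0_iff)
    moreover have "degree H = degree G" by (simp add: H_def degree_pcompose)
    moreover have "dickson p - [:e:] = [:-e, 1:] * H ^ 2"
    proof (rule poly_eq_poly_eq_iff[THEN iffD1, OF ext])
      fix z
      have "poly (dickson p - [:2:]) (- z) = poly ([:-2, 1:] * G ^ 2) (- z)" by (simp only: id)
      hence "- poly (dickson p) z - 2 = (- z - 2) * (poly G (- z)) ^ 2"
        using assms(1) by (simp add: poly_dickson_neg left_diff_distrib)
      thus "poly (dickson p - [:e:]) z = poly ([:-e, 1:] * H ^ 2) z"
        by (simp add: e H_def poly_pcompose algebra_simps)
    qed
    ultimately show ?thesis using \<open>degree G \<le> k\<close> k by (intro exI[of _ H]) auto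
  qed
qed

lemma dickson_double: "dickson (2 * k) = dickson k ^ 2 - 2"
proof -
  have "dickson 2 = [:-2, 0, 1:]" by (simp add: numeral_2_eq_2)
  hence "dickson (2 * k) = [:-2, 0, 1:] \<circ>\<^sub>p dickson k" using dickson_pcompose[of 2 k] by (simp add: mult.commute)
  also have "\<dots> = dickson k ^ 2 + [:-2:]" by (simp add: pcompose_pCons power2_eq_square)
  also have "[:-2:] = - (2 :: complex poly)" by (simp add: numeral_poly)
  finally show ?thesis by simp
qed

text \<open>The values 2 and -2 are taken doubly except possibly at the points 2 and -2, so only
  about half of the \<open>p\<close> roots are distinct; \<open>(p + 2) div 2\<close> covers both
  parities and both signs.\<close>

lemma dickson_critical_roots:
  assumes "p > 0" "e = 2 \<or> e = -2"
  shows "\<exists>G. G \<noteq> 0 \<and> degree G \<le> (p + 2) div 2 \<and> (\<forall>z. poly (dickson p) z = e \<longrightarrow> poly G z = 0)"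
proof (cases "odd p")
  case True
  then obtain G where G: "G \<noteq> 0" "degree G \<le> p div 2" "dickson p - [:e:] = [:-e, 1:] * G ^ 2"
    using dickson_odd_factor_exists assms by blast
  have "degree ([:-e, 1:] * G) \<le> (p + 2) div 2" using G(2) degree_mult_le[of "[:-e, 1:]" G] by simp
  moreover have "poly ([:-e, 1:] * G) z = 0" if "poly (dickson p) z = e" for z
  proof -
    have "poly (dickson p - [:e:]) z = 0" using that by simp
    thus ?thesis unfolding G(3) by auto
  qed
  moreover have "[:-e, 1:] * G \<noteq> 0" using G(1) unfolding mult_eq_0_iff by simp
  ultimately show ?thesis by blast
next
  case False
  then obtain k where k: "p = 2 * k" by (auto elim: evenE)
  hence kpos: "k > 0" using assms by simp
  from assms(2) show ?thesis
  proof
    assume e: "e = 2"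
    define G where "G = [:-4, 0, 1:] * dickson2 k"
    have "G \<noteq> 0" using dickson2_nonzero[OF kpos] unfolding G_def mult_eq_0_iff by simp
    moreover have "degree G \<le> (p + 2) div 2"
      using k kpos degree_mult_le[of "[:-4, 0, 1:]" "dickson2 k"] by (simp add: G_def degree_dickson2)
    moreover have "poly G z = 0" if "poly (dickson p) z = e" for z
    proof -
      have "poly (dickson k ^ 2 - 4) z = 0" using that e by (simp add: k dickson_double)
      thus ?thesis unfolding dickson_pell by (auto simp: G_def)
    qed
    ultimately show ?thesis by blast
  next
    assume e: "e = -2"
    have "dickson k \<noteq> 0" using degree_dickson[of k] kpos by auto
    moreover have "poly (dickson k) z = 0" if "poly (dickson p) z = e" for z
      using that e by (simp add: k dickson_double)
    ultimately show ?thesis using degree_dickson[of k] k by (intro exI[of _ "dickson k"]) auto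
  qed
qed

text \<open>\<open>W\<close> is affinely equivalent to \<open>dickson p \<circ>\<^sub>p V\<close>; its two exceptional values are
  \<open>b + 2 a\<close> and \<open>b - 2 a\<close>.\<close>

definition dickson_form :: "complex poly \<Rightarrow> complex \<Rightarrow> complex \<Rightarrow> nat \<Rightarrow> complex poly \<Rightarrow> bool" where
  "dickson_form W a b p V \<longleftrightarrow> a \<noteq> 0 \<and> degree V > 0 \<and> W = smult a (dickson p \<circ>\<^sub>p V) + [:b:]"

lemma dickson_form_degree: "dickson_form W a b p V \<Longrightarrow> degree W = p * degree V"
proof -
  assume *: "dickson_form W a b p V"
  have eq: "smult a (dickson p \<circ>\<^sub>p V) + [:b:] = smult a (dickson p \<circ>\<^sub>p V) - [:-b:]" by simp
  have "degree W = degree (smult a (dickson p \<circ>\<^sub>p V) - [:-b:])"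
    using * unfolding dickson_form_def eq by metis
  also have "\<dots> = degree (smult a (dickson p \<circ>\<^sub>p V))" by (rule degree_diff_const)
  also have "\<dots> = p * degree V" using * by (simp add: dickson_form_def degree_pcompose degree_dickson)
  finally show ?thesis .
qed

lemma dickson_form_poly: "dickson_form W a b p V \<Longrightarrow> poly W t = a * poly (dickson p) (poly V t) + b"
  by (simp add: dickson_form_def poly_pcompose)

lemma dickson_form_single:
  assumes "dickson_form W a b p V" "p > 0" "c = b + 2 * a \<or> c = b - 2 * a"
  shows "card {t. poly W t = c} \<le> (p + 2) div 2 * degree V"
proof -
  have a: "a \<noteq> 0" "degree V > 0" using assms by (auto simp: dickson_form_def)
  obtain e where e: "e = 2 \<or> e = -2" "c = b + e * a" using assms(3) by force
  obtain G where G: "G \<noteq> 0" "degree G \<le> (p + 2) div 2" "\<And>z. poly (dickson p) z = e \<Longrightarrow> poly G z = 0"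
    using dickson_critical_roots[OF assms(2) e(1)] by blast
  have "card {t. poly W t = c} \<le> degree G * degree V"
  proof (rule card_roots_pcompose_le[OF G(1) a(2)])
    fix t assume "t \<in> {t. poly W t = c}"
    hence "poly (dickson p) (poly V t) = e" using dickson_form_poly[OF assms(1), of t] e(2) a(1) by simp
    thus "poly G (poly V t) = 0" by (rule G(3))
  qed
  also have "\<dots> \<le> (p + 2) div 2 * degree V" using G(2) by (rule mult_right_mono) simp
  finally show ?thesis .
qed

lemma dickson_form_total:
  assumes "dickson_form W a b p V" "p > 0"
  shows "card {t. poly W t = b + 2 * a} + card {t. poly W t = b - 2 * a} \<le> (p + 1) * degree V"
proof -
  have a: "a \<noteq> 0" "degree V > 0" using assms by (auto simp: dickson_form_def)
  have dW: "degree W > 0" using dickson_form_degree[OF assms(1)] a assms(2) by simp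
  define G where "G = [:-4, 0, 1:] * dickson2 p"
  have "G \<noteq> 0" using dickson2_nonzero[OF assms(2)] unfolding G_def by (metis mult_eq_0_iff pCons_eq_0_iff one_neq_zero)
  have "card {t. poly W t = b + 2 * a} + card {t. poly W t = b - 2 * a}
      = card ({t. poly W t = b + 2 * a} \<union> {t. poly W t = b - 2 * a})"
    using finite_fiber[OF dW] a by (intro card_Un_disjoint[symmetric]) auto
  also have "\<dots> \<le> degree G * degree V"
  proof (rule card_roots_pcompose_le[OF \<open>G \<noteq> 0\<close> a(2)])
    fix t assume "t \<in> {t. poly W t = b + 2 * a} \<union> {t. poly W t = b - 2 * a}"
    hence "a * (poly (dickson p) (poly V t) - 2) = 0 \<or> a * (poly (dickson p) (poly V t) + 2) = 0"
      using dickson_form_poly[OF assms(1), of t] by (auto simp: algebra_simps)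
    hence "poly (dickson p) (poly V t) = 2 \<or> poly (dickson p) (poly V t) = -2"
      using a(1) by (auto simp: eq_neg_iff_add_eq_0)
    hence "poly (dickson p ^ 2 - 4) (poly V t) = 0" by auto
    thus "poly G (poly V t) = 0" unfolding dickson_pell by (auto simp: G_def)
  qed
  also have "degree G = p + 1"
    using dickson2_nonzero[OF assms(2)] assms(2) unfolding G_def
    by (subst degree_mult_eq) (simp_all add: degree_dickson2)
  finally show ?thesis .
qed

text \<open>The fibres over one exceptional pair have at most \<open>m + d\<close> points together,
  and \<open>3 * d \<le> m\<close>. A second pair, disjoint or sharing one value, would leave fewer
  points over the three or four values than Riemann-Hurwitz allows. The pair determines
  \<open>b\<close>, and \<open>a\<close> up to sign.\<close>

lemma critical_pair_unique:
  assumes "dickson_form W a b p V" "dickson_form W a' b' p' V'" "p \<ge> 3" "p' \<ge> 3"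
  shows "b = b' \<and> (a' = a \<or> a' = -a)"
proof (rule ccontr)
  assume neg: "\<not> ?thesis"
  define m d d' where "m = degree W" and "d = degree V" and "d' = degree V'"
  have a: "a \<noteq> 0" "a' \<noteq> 0" "d > 0" "d' > 0" using assms by (auto simp: dickson_form_def d_def d'_def)
  have m: "m = p * d" "m = p' * d'" using dickson_form_degree[OF assms(1)] dickson_form_degree[OF assms(2)]
    unfolding m_def d_def d'_def by simp_all
  have mpos: "m > 0" using m a assms by simp
  have d3: "3 * d \<le> m" unfolding m(1) using assms(3) by simp
  have d3': "3 * d' \<le> m" unfolding m(2) using assms(4) by simp
  note d3 = d3 d3'
  define N where "N c = card {t. poly W t = c}" for c
  have tot: "N (b + 2 * a) + N (b - 2 * a) \<le> m + d" "N (b' + 2 * a') + N (b' - 2 * a') \<le> m + d'"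
    using dickson_form_total[OF assms(1)] dickson_form_total[OF assms(2)] assms(3,4)
    unfolding N_def d_def[symmetric] d'_def[symmetric] by (simp_all add: m(1), simp add: m(1)[symmetric] m(2))
  have RH: "card C * m + 1 \<le> (\<Sum>c\<in>C. N c) + m" if "finite C" for C
    using sum_card_fibers_ge[of W C] that mpos by (simp add: m_def N_def)
  have K: "4 * ((q + 2) div 2) \<le> 3 * q" if "q \<ge> 4" for q :: nat using that by linarith
  have small: "4 * ((q + 2) div 2 * e) \<le> 3 * (q * e)" if "q \<ge> 4" for q e :: nat
    using mult_le_mono1[OF K[OF that], of e] by (simp only: mult.assoc)
  \<comment> \<open>Prepared for three values: two of them have at most \<open>m + d\<close> or
    \<open>m + d'\<close> points together, the third has a fibre of roughly half size. At index 3
    that fibre is bounded by two thirds of \<open>m\<close>, made up for by the other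
    \<open>d\<close> being at most a third.\<close>
  have bound: "(p + 2) div 2 * d + d' \<le> m \<or> (p' + 2) div 2 * d' + d \<le> m"
  proof (cases "p = 3 \<or> p' = 3")
    case True
    thus ?thesis
    proof
      assume "p = 3"
      hence "(p + 2) div 2 * d = 2 * d" "m = 3 * d" using m(1) by auto
      thus ?thesis using d3 by linarith
    next
      assume "p' = 3"
      hence "(p' + 2) div 2 * d' = 2 * d'" "m = 3 * d'" using m(2) by auto
      thus ?thesis using d3 by linarith
    qed
  next
    case False
    hence "p \<ge> 4" "p' \<ge> 4" using assms by auto
    hence "4 * ((p + 2) div 2 * d) \<le> 3 * m" unfolding m(1) by (intro small)
    moreover have "4 * d' \<le> m" unfolding m(2) using \<open>p' \<ge> 4\<close> by simp
    ultimately show ?thesis by linarith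
  qed
  have three: False if x: "{x0, x1} = {b + 2 * a, b - 2 * a}" "{x0, x2} = {b' + 2 * a', b' - 2 * a'}"
    "x0 \<noteq> x1" "x0 \<noteq> x2" "x1 \<noteq> x2" for x0 x1 x2
  proof -
    have s1: "N x0 + N x1 \<le> m + d" using tot(1) x(1,3) by (auto simp: doubleton_eq_iff)
    have s2: "N x0 + N x2 \<le> m + d'" using tot(2) x(2,4) by (auto simp: doubleton_eq_iff)
    have "x1 = b + 2 * a \<or> x1 = b - 2 * a" "x2 = b' + 2 * a' \<or> x2 = b' - 2 * a'" using x by auto
    hence "N x1 \<le> (p + 2) div 2 * d" "N x2 \<le> (p' + 2) div 2 * d'"
      using dickson_form_single[OF assms(1)] dickson_form_single[OF assms(2)] assms(3,4)
      by (auto simp: N_def d_def d'_def)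
    moreover have "3 * m + 1 \<le> N x0 + N x1 + N x2 + m" using RH[of "{x0, x1, x2}"] x(3-5) by simp
    ultimately show False using s1 s2 bound by linarith
  qed
  have ne: "b + 2 * a \<noteq> b - 2 * a" "b' + 2 * a' \<noteq> b' - 2 * a'" using a by auto
  have pairs: "{b + 2 * a, b - 2 * a} \<noteq> {b' + 2 * a', b' - 2 * a'}"
  proof
    assume "{b + 2 * a, b - 2 * a} = {b' + 2 * a', b' - 2 * a'}"
    hence "(b + 2 * a = b' + 2 * a' \<and> b - 2 * a = b' - 2 * a') \<or> (b + 2 * a = b' - 2 * a' \<and> b - 2 * a = b' + 2 * a')"
      by (auto simp: doubleton_eq_iff)
    thus False
    proof
      assume h: "b + 2 * a = b' + 2 * a' \<and> b - 2 * a = b' - 2 * a'"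
      hence "2 * b = 2 * b'" by algebra
      thus False using h neg by simp
    next
      assume h: "b + 2 * a = b' - 2 * a' \<and> b - 2 * a = b' + 2 * a'"
      hence "2 * b = 2 * b'" by algebra
      hence "b = b'" by simp
      hence "b' + 2 * a = b' + 2 * (- a')" using h by simp
      hence "2 * a = 2 * (- a')" by (rule add_left_imp_eq)
      hence "a' = - a" by simp
      thus False using neg \<open>b = b'\<close> by simp
    qed
  qed
  show False
  proof (cases "{b + 2 * a, b - 2 * a} \<inter> {b' + 2 * a', b' - 2 * a'} = {}")
    case True
    hence "4 * m + 1 \<le> N (b + 2 * a) + N (b - 2 * a) + (N (b' + 2 * a') + N (b' - 2 * a')) + m"
      using RH[of "{b + 2 * a, b - 2 * a, b' + 2 * a', b' - 2 * a'}"] ne by auto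
    thus False using tot d3 by linarith
  next
    case False
    then obtain x0 where x0: "x0 \<in> {b + 2 * a, b - 2 * a}" "x0 \<in> {b' + 2 * a', b' - 2 * a'}" by blast
    have pick: "\<exists>x1. {x0, x1} = {y, z} \<and> x0 \<noteq> x1" if "x0 \<in> {y, z}" "y \<noteq> z" for y z
      using that by (auto simp: insert_commute)
    obtain x1 x2 where x: "{x0, x1} = {b + 2 * a, b - 2 * a}" "{x0, x2} = {b' + 2 * a', b' - 2 * a'}"
      "x0 \<noteq> x1" "x0 \<noteq> x2" using pick[OF x0(1) ne(1)] pick[OF x0(2) ne(2)] by blast
    thus False using three[OF x] pairs by auto
  qed
qed

section \<open>Pairs of minimal closed factors\<close>

definition affine_equiv :: "complex poly \<Rightarrow> complex poly \<Rightarrow> bool" where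
  "affine_equiv W W' \<longleftrightarrow> (\<exists>U. degree U = 1 \<and> W' = U \<circ>\<^sub>p W)"

lemma degree_1_poly: "degree (U :: complex poly) = 1 \<Longrightarrow> \<exists>u0 u1. u1 \<noteq> 0 \<and> U = [:u0, u1:]"
proof -
  assume d: "degree U = 1"
  have "U = [:coeff U 0, coeff U 1:]"
    by (rule poly_eqI) (use d in \<open>auto simp: coeff_pCons coeff_eq_0 split: nat.splits\<close>)
  moreover have "coeff U 1 \<noteq> 0" using d leading_coeff_0_iff[of U] by auto
  ultimately show ?thesis by blast
qed

lemma degree_1_inverse:
  assumes "degree (U :: complex poly) = 1" shows "\<exists>U'. degree U' = 1 \<and> U' \<circ>\<^sub>p U = [:0, 1:]"
proof -
  obtain u0 u1 where U: "u1 \<noteq> 0" "U = [:u0, u1:]" using degree_1_poly[OF assms] by blast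
  show ?thesis by (intro exI[of _ "[:-u0 / u1, 1 / u1:]"]) (use U in \<open>simp add: pcompose_pCons\<close>)
qed

lemma pcompose_X: "[:0, 1:] \<circ>\<^sub>p W = W" for W :: "complex poly"
  by (simp add: pcompose_pCons)

lemma affine_equiv_sym: assumes "affine_equiv W W'" shows "affine_equiv W' W"
proof -
  obtain U where U: "degree U = 1" "W' = U \<circ>\<^sub>p W" using assms by (auto simp: affine_equiv_def)
  obtain U' where U': "degree U' = 1" "U' \<circ>\<^sub>p U = [:0, 1:]" using degree_1_inverse[OF U(1)] by blast
  have "U' \<circ>\<^sub>p W' = W" using U(2) U'(2) by (simp add: pcompose_assoc pcompose_X)
  thus ?thesis using U'(1) unfolding affine_equiv_def by metis
qed

lemma pcompose_cancel_right:
  fixes P P' V :: "complex poly"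
  assumes "P \<circ>\<^sub>p V = P' \<circ>\<^sub>p V" "degree V > 0" shows "P = P'"
proof -
  have "(P - P') \<circ>\<^sub>p V = 0" using assms(1) by (simp add: pcompose_diff)
  hence "P - P' = 0" using pcompose_eq_0[OF _ assms(2)] by blast
  thus ?thesis by simp
qed

definition minimal_closed :: "complex \<Rightarrow> complex \<Rightarrow> complex poly \<Rightarrow> bool" where
  "minimal_closed \<alpha> \<beta> W \<longleftrightarrow> degree W > 0 \<and> poly W \<alpha> = poly W \<beta> \<and>
     (\<forall>U V. W = U \<circ>\<^sub>p V \<and> poly V \<alpha> = poly V \<beta> \<longrightarrow> degree U = 1)"

lemma common_closed_factor_imp_affine_equiv:
  assumes "minimal_closed \<alpha> \<beta> W" "minimal_closed \<alpha> \<beta> W'" "common_closed_factor \<alpha> \<beta> W W'"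
  shows "affine_equiv W W'"
proof -
  obtain Y U U' where Y: "poly Y \<alpha> = poly Y \<beta>" "W = U \<circ>\<^sub>p Y" "W' = U' \<circ>\<^sub>p Y"
    using assms(3) by (auto simp: common_closed_factor_def)
  have d: "degree U = 1" "degree U' = 1" using assms(1,2) Y unfolding minimal_closed_def by blast+
  obtain I where I: "degree I = 1" "I \<circ>\<^sub>p U = [:0, 1:]" using degree_1_inverse[OF d(1)] by blast
  have "I \<circ>\<^sub>p W = Y" using Y(2) I(2) by (simp add: pcompose_assoc pcompose_X)
  hence "W' = (U' \<circ>\<^sub>p I) \<circ>\<^sub>p W" using Y(3) by (simp add: pcompose_assoc[symmetric])
  moreover have "degree (U' \<circ>\<^sub>p I) = 1" using d I by (simp add: degree_pcompose)
  ultimately show ?thesis unfolding affine_equiv_def by blast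
qed

text \<open>A cyclic pair composed with the common right factor and recentred, so that the left
  factors are essentially \<open>z ^ n\<close> and \<open>U = z ^ s * R (z ^ n)\<close>. The two
  points are recorded as distinct zeros of \<open>U\<close> in one rotation orbit. The relation is
  directed from the power to the symmetric polynomial.\<close>

definition cyclic_type :: "complex \<Rightarrow> complex \<Rightarrow> complex poly \<Rightarrow> complex poly \<Rightarrow> bool" where
  "cyclic_type \<alpha> \<beta> W W' \<longleftrightarrow> (\<exists>Y n U c e f. c \<noteq> 0 \<and> n \<ge> 2 \<and> W = smult c (Y ^ n) + [:e:] \<and> W' = U \<circ>\<^sub>p Y + [:f:] \<and>
     coprime n (degree U) \<and> (\<forall>\<epsilon> z. \<epsilon> ^ n = 1 \<longrightarrow> poly U (\<epsilon> * z) = \<epsilon> ^ degree U * poly U z) \<and>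
     poly U (poly Y \<alpha>) = 0 \<and> poly U (poly Y \<beta>) = 0 \<and> poly Y \<alpha> \<noteq> poly Y \<beta> \<and> poly Y \<alpha> ^ n = poly Y \<beta> ^ n)"

text \<open>Index 2 is left out because \<open>dickson 2\<close> is a square up to a constant, which
  makes such pairs cyclic.\<close>

definition dickson_type :: "complex poly \<Rightarrow> complex poly \<Rightarrow> bool" where
  "dickson_type W W' \<longleftrightarrow> (\<exists>Z p q a b a' b'. p \<ge> 3 \<and> q \<ge> 3 \<and> coprime p q \<and>
     dickson_form W a b p Z \<and> dickson_form W' a' b' q Z)"

lemma dickson_type_sym: "dickson_type W W' \<Longrightarrow> dickson_type W' W"
  unfolding dickson_type_def by (metis coprime_commute)

text \<open>The quotient \<open>\<zeta>\<close> of the two values of \<open>Y\<close> is a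
  nontrivial \<open>n\<close>-th root of unity. As \<open>degree U\<close> is prime to
  \<open>n\<close>, multiplication by \<open>\<zeta> ^ degree U\<close> fixes only 0, so equal
  values of \<open>U\<close> at the two points must vanish.\<close>

lemma cyclic_typeI:
  assumes "c \<noteq> 0" "n \<ge> 2" "W = smult c (Y ^ n) + [:e:]" "W' = U \<circ>\<^sub>p Y + [:f:]" "coprime n (degree U)"
    and rot: "\<And>\<epsilon> z. \<epsilon> ^ n = 1 \<Longrightarrow> poly U (\<epsilon> * z) = \<epsilon> ^ degree U * poly U z"
    and "poly Y \<alpha> \<noteq> poly Y \<beta>" "poly W \<alpha> = poly W \<beta>" "poly W' \<alpha> = poly W' \<beta>"
  shows "cyclic_type \<alpha> \<beta> W W'"
proof -
  define y z where "y = poly Y \<alpha>" and "z = poly Y \<beta>"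
  have yz: "y \<noteq> z" "y ^ n = z ^ n" using assms by (auto simp: y_def z_def)
  have z0: "z \<noteq> 0"
  proof
    assume "z = 0"
    hence "y ^ n = 0" using yz(2) assms(2) by simp
    thus False using yz(1) \<open>z = 0\<close> by simp
  qed
  define \<zeta> where "\<zeta> = y / z"
  have zeta: "\<zeta> ^ n = 1" "y = \<zeta> * z" "\<zeta> \<noteq> 1" using yz z0 by (auto simp: \<zeta>_def power_divide)
  have eq: "poly U y = poly U z" using assms(4,9) by (simp add: poly_pcompose y_def z_def)
  have "poly U y = \<zeta> ^ degree U * poly U z" using rot[OF zeta(1), of z] zeta(2) by simp
  moreover have "\<zeta> ^ degree U \<noteq> 1"
  proof
    assume "\<zeta> ^ degree U = 1"
    hence "\<zeta> ^ gcd n (degree U) = 1" using zeta(1) root_of_unity_gcd by blast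
    thus False using assms(5) zeta(3) by simp
  qed
  ultimately have "poly U z = 0" using eq by (metis mult_cancel_right1)
  thus ?thesis unfolding cyclic_type_def
    using assms(1-5) rot yz eq unfolding y_def z_def by metis
qed

text \<open>By symmetry \<open>U\<close> vanishes at 0 and at all \<open>n\<close> numbers with the
  same \<open>n\<close>-th power as \<open>poly Y \<alpha>\<close>; these \<open>n + 1\<close> roots
  give \<open>degree U > n\<close>, so degrees increase along the relation.\<close>

lemma cyclic_typeE:
  assumes "cyclic_type \<alpha> \<beta> W W'" "degree W > 0"
  obtains c n Y e U f where "c \<noteq> 0" "n \<ge> 2" "W = smult c (Y ^ n) + [:e:]" "W' = U \<circ>\<^sub>p Y + [:f:]"
    "coprime n (degree U)" "\<forall>\<epsilon> z. \<epsilon> ^ n = 1 \<longrightarrow> poly U (\<epsilon> * z) = \<epsilon> ^ degree U * poly U z"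
    "poly U (poly Y \<alpha>) = 0" "poly U (poly Y \<beta>) = 0" "poly Y \<alpha> \<noteq> 0" "poly Y \<alpha> \<noteq> poly Y \<beta>" "poly U 0 = 0"
    "degree Y > 0" "degree W = n * degree Y" "degree W' = degree U * degree Y" "degree U > n"
proof -
  obtain Y n U c e f where *: "c \<noteq> 0" "n \<ge> 2" "W = smult c (Y ^ n) + [:e:]" "W' = U \<circ>\<^sub>p Y + [:f:]"
    "coprime n (degree U)" "\<And>\<epsilon> z. \<epsilon> ^ n = 1 \<Longrightarrow> poly U (\<epsilon> * z) = \<epsilon> ^ degree U * poly U z"
    "poly U (poly Y \<alpha>) = 0" "poly U (poly Y \<beta>) = 0" "poly Y \<alpha> \<noteq> poly Y \<beta>" "poly Y \<alpha> ^ n = poly Y \<beta> ^ n"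
    using assms(1) unfolding cyclic_type_def by metis
  define y z where "y = poly Y \<alpha>" and "z = poly Y \<beta>"
  have yz: "y \<noteq> z" "y ^ n = z ^ n" using * by (auto simp: y_def z_def)
  have z0: "z \<noteq> 0"
  proof
    assume "z = 0"
    hence "y ^ n = 0" using yz(2) *(2) by simp
    thus False using yz(1) \<open>z = 0\<close> by simp
  qed
  have y0: "y \<noteq> 0"
  proof
    assume "y = 0"
    hence "z ^ n = 0" using yz(2) *(2) by (simp add: zero_power)
    thus False using z0 by simp
  qed
  define \<zeta> where "\<zeta> = y / z"
  have zeta: "\<zeta> ^ n = 1" "\<zeta> \<noteq> 1" using yz z0 by (auto simp: \<zeta>_def power_divide)
  have zk: "\<zeta> ^ degree U \<noteq> 1"
  proof
    assume "\<zeta> ^ degree U = 1"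
    hence "\<zeta> ^ gcd n (degree U) = 1" using zeta(1) root_of_unity_gcd by blast
    thus False using *(5) zeta(2) by simp
  qed
  have U0: "poly U 0 = 0" using *(6)[OF zeta(1), of 0] zk by simp
  have dU: "degree U > 0" using *(2,5) by (auto intro!: gr0I)
  have Ynz: "Y \<noteq> 0" using y0 by (auto simp: y_def)
  have dW: "degree W = n * degree Y" unfolding *(3) degree_add_const using *(1) Ynz by (simp add: degree_power_eq)
  have dW': "degree W' = degree U * degree Y" unfolding *(4) degree_add_const by (simp add: degree_pcompose)
  have Y0: "degree Y > 0" using dW assms(2) by (auto intro!: gr0I)
  have roots: "insert 0 {x. x ^ n = y ^ n} \<subseteq> {x. poly U x = 0}"
  proof
    fix x assume "x \<in> insert 0 {x. x ^ n = y ^ n}"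
    thus "x \<in> {x. poly U x = 0}"
    proof
      assume "x = 0" thus ?thesis using U0 by simp
    next
      assume "x \<in> {x. x ^ n = y ^ n}"
      hence "(x / y) ^ n = 1" using y0 by (simp add: power_divide)
      hence "poly U (x / y * y) = (x / y) ^ degree U * poly U y" by (rule *(6))
      thus ?thesis using *(7) y0 by (simp add: y_def)
    qed
  qed
  have "U \<noteq> 0" using dU by auto
  have fin: "finite {x. x ^ n = y ^ n}" using *(2) y0 by (intro finite_nth_roots) auto
  have "n + 1 = card (insert 0 {x. x ^ n = y ^ n})"
    using fin card_nth_roots[of "y ^ n" n] y0 *(2) by (simp add: zero_power)
  also have "\<dots> \<le> card {x. poly U x = 0}" using roots poly_roots_finite[OF \<open>U \<noteq> 0\<close>] by (intro card_mono)
  also have "\<dots> \<le> degree U" by (rule card_poly_roots_bound[OF \<open>U \<noteq> 0\<close>])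
  finally have "degree U > n" by simp
  thus thesis using that[of c n Y e U f] * U0 Y0 dW dW' y0 by (simp add: y_def)
qed

lemma cyclic_type_degree_less:
  assumes "cyclic_type \<alpha> \<beta> W W'" "degree W > 0" shows "degree W < degree W'"
  using assms by (rule cyclic_typeE) simp

locale closed_factors =
  fixes \<alpha> \<beta> :: complex and Q :: "complex poly"
  assumes Qpos: "degree Q > 0"
begin

definition M where "M = {W. minimal_closed \<alpha> \<beta> W \<and> (\<exists>A. Q = A \<circ>\<^sub>p W)}"

definition indep where "indep W W' \<longleftrightarrow> W \<in> M \<and> W' \<in> M \<and> \<not> affine_equiv W W'"

lemma indep_sym: "indep W W' \<Longrightarrow> indep W' W"
  using affine_equiv_sym unfolding indep_def by blast

lemma MD: "W \<in> M \<Longrightarrow> degree W > 0" "W \<in> M \<Longrightarrow> poly W \<alpha> = poly W \<beta>"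
  by (auto simp: M_def minimal_closed_def)

lemma indepD: "indep W W' \<Longrightarrow> \<not> common_closed_factor \<alpha> \<beta> W W'"
  unfolding indep_def M_def using common_closed_factor_imp_affine_equiv by blast

text \<open>\<open>V\<close> separates the two points, since otherwise it would be a common closed
  factor and make \<open>W\<close> and \<open>W'\<close> affinely equivalent. For the same reason
  neither left factor is linear.\<close>

lemma pair_structure:
  assumes "indep W W'"
  obtains U U' V where "W = U \<circ>\<^sub>p V" "W' = U' \<circ>\<^sub>p V" "degree V > 0" "poly V \<alpha> \<noteq> poly V \<beta>"
    "coprime (degree U) (degree U')" "degree U \<ge> 2" "degree U' \<ge> 2" "\<exists>A A'. A \<circ>\<^sub>p U = A' \<circ>\<^sub>p U' \<and> degree (A \<circ>\<^sub>p U) > 0"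
proof -
  have M: "W \<in> M" "W' \<in> M" using assms by (auto simp: indep_def)
  obtain A where "Q = A \<circ>\<^sub>p W" using M(1) unfolding M_def by blast
  moreover obtain A' where "Q = A' \<circ>\<^sub>p W'" using M(2) unfolding M_def by blast
  ultimately have A: "Q = A \<circ>\<^sub>p W" "Q = A' \<circ>\<^sub>p W'" .
  obtain V U U' where V: "degree V = gcd (degree W) (degree W')" "W = U \<circ>\<^sub>p V" "W' = U' \<circ>\<^sub>p V"
    using gcd_right_factor[OF A Qpos] by blast
  have dV: "degree V > 0" using V(1) MD(1)[OF M(1)] by simp
  have ne: "poly V \<alpha> \<noteq> poly V \<beta>"
    using indepD[OF assms] V(2,3) unfolding common_closed_factor_def by blast
  have d: "degree W = degree U * degree V" "degree W' = degree U' * degree V"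
    using V by (auto simp: degree_pcompose)
  have "gcd (degree U) (degree U') * degree V = degree V"
    using V(1) unfolding d by (metis gcd_mult_distrib_nat mult.commute)
  hence cop: "coprime (degree U) (degree U')" using dV by (simp add: coprime_iff_gcd_eq_1)
  have ge2: "degree P \<ge> 2" if P: "X = P \<circ>\<^sub>p V" "X \<in> M" for P X
  proof -
    have "degree P \<noteq> 0" using MD(1)[OF P(2)] P(1) by (auto simp: degree_pcompose)
    moreover have "degree P \<noteq> 1"
    proof
      assume "degree P = 1"
      then obtain u0 u1 where "u1 \<noteq> 0" "P = [:u0, u1:]" using degree_1_poly by blast
      thus False using MD(2)[OF P(2)] P(1) ne by (simp add: poly_pcompose)
    qed
    ultimately show ?thesis by simp
  qed
  have "A \<circ>\<^sub>p U \<circ>\<^sub>p V = A' \<circ>\<^sub>p U' \<circ>\<^sub>p V" using A V by (simp add: pcompose_assoc)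
  hence eq: "A \<circ>\<^sub>p U = A' \<circ>\<^sub>p U'" using dV by (rule pcompose_cancel_right)
  have "degree (A \<circ>\<^sub>p U) > 0" using Qpos A(1) V(2) by (auto simp: degree_pcompose)
  thus thesis using that[OF V(2,3) dV ne cop ge2[OF V(2) M(1)] ge2[OF V(3) M(2)]] eq by blast
qed

lemma cyclic_pair_imp_cyclic_type:
  assumes "cyclic_pair U U'" "W = U \<circ>\<^sub>p V" "W' = U' \<circ>\<^sub>p V" "poly V \<alpha> \<noteq> poly V \<beta>"
    and "coprime (degree U) (degree U')" "degree U \<ge> 2"
    and "poly W \<alpha> = poly W \<beta>" "poly W' \<alpha> = poly W' \<beta>"
  shows "cyclic_type \<alpha> \<beta> W W'"
proof -
  obtain c u e f where *: "c \<noteq> 0" "U = smult c ([:-u, 1:] ^ degree U) + [:e:]" "rotation_symmetric (degree U) u f U'"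
    using assms(1) unfolding cyclic_pair_def by blast
  define Y where "Y = V - [:u:]"
  define U2 where "U2 = U' \<circ>\<^sub>p [:u, 1:] - [:f:]"
  have dU2: "degree U2 = degree U'" by (simp add: U2_def degree_diff_const degree_pcompose)
  show ?thesis
  proof (rule cyclic_typeI[OF *(1) assms(6), of W Y e W' U2 f])
    have "[:-u, 1:] \<circ>\<^sub>p V = Y"
      by (simp add: Y_def pcompose_pCons diff_conv_add_uminus add.commute del: add_uminus_conv_diff)
    thus "W = smult c (Y ^ degree U) + [:e:]" unfolding assms(2)
      by (subst *(2)) (simp add: pcompose_add pcompose_smult pcompose_power)
    have "[:u, 1:] \<circ>\<^sub>p Y = V" by (simp add: Y_def pcompose_pCons)
    hence "U' \<circ>\<^sub>p [:u, 1:] \<circ>\<^sub>p Y = U' \<circ>\<^sub>p V" by (metis pcompose_assoc)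
    thus "W' = U2 \<circ>\<^sub>p Y + [:f:]" unfolding assms(3) by (simp add: U2_def pcompose_diff)
    show "coprime (degree U) (degree U2)" using assms(5) dU2 by simp
    show "poly U2 (\<epsilon> * z) = \<epsilon> ^ degree U2 * poly U2 z" if "\<epsilon> ^ degree U = 1" for \<epsilon> z
      using *(3) that unfolding rotation_symmetric_def dU2 by (simp add: U2_def poly_pcompose mult.commute)
    show "poly Y \<alpha> \<noteq> poly Y \<beta>" using assms(4) by (simp add: Y_def)
  qed (use assms in auto)
qed

lemma dickson_form_2_imp_cyclic_type:
  assumes "dickson_form W a b 2 Z" "dickson_form W' a' b' q Z" "odd q" "poly Z \<alpha> \<noteq> poly Z \<beta>"
    and "poly W \<alpha> = poly W \<beta>" "poly W' \<alpha> = poly W' \<beta>"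
  shows "cyclic_type \<alpha> \<beta> W W'"
proof (rule cyclic_typeI[of a 2 W Z "b - 2 * a" W' "smult a' (dickson q)" b'])
  have "dickson 2 = [:-2, 0, 1:]" by (simp add: numeral_2_eq_2)
  hence "dickson 2 \<circ>\<^sub>p Z = Z ^ 2 - [:2:]" by (simp add: pcompose_pCons power2_eq_square)
  thus "W = smult a (Z ^ 2) + [:b - 2 * a:]"
    using assms(1) by (simp add: dickson_form_def smult_diff_right mult.commute)
  show "W' = smult a' (dickson q) \<circ>\<^sub>p Z + [:b':]" using assms(2) by (simp add: dickson_form_def pcompose_smult)
  have d: "degree (smult a' (dickson q)) = q" using assms(2) by (simp add: dickson_form_def degree_dickson)
  show "coprime 2 (degree (smult a' (dickson q)))" unfolding d using assms(3) by simp
  show "poly (smult a' (dickson q)) (\<epsilon> * z) = \<epsilon> ^ degree (smult a' (dickson q)) * poly (smult a' (dickson q)) z"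
    if "\<epsilon>\<^sup>2 = 1" for \<epsilon> z
  proof -
    have "\<epsilon> = 1 \<or> \<epsilon> = -1" using that by (simp add: power2_eq_1_iff)
    thus ?thesis unfolding d using assms(3) by (auto simp: poly_dickson_neg)
  qed
qed (use assms in \<open>auto simp: dickson_form_def\<close>)

lemma dickson_pair_cases:
  assumes "indep W W'" and W: "dickson_form W a b p Z" "dickson_form W' a' b' q Z" and "coprime p q" "p \<ge> 2" "q \<ge> 2"
  shows "cyclic_type \<alpha> \<beta> W W' \<or> cyclic_type \<alpha> \<beta> W' W \<or> dickson_type W W'"
proof -
  have M: "W \<in> M" "W' \<in> M" using assms by (auto simp: indep_def)
  have "W = (smult a (dickson p) + [:b:]) \<circ>\<^sub>p Z" "W' = (smult a' (dickson q) + [:b':]) \<circ>\<^sub>p Z"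
    using W by (auto simp: dickson_form_def pcompose_add pcompose_smult)
  hence ne: "poly Z \<alpha> \<noteq> poly Z \<beta>"
    using indepD[OF assms(1)] unfolding common_closed_factor_def by blast
  consider "p = 2" | "q = 2" | "p \<ge> 3" "q \<ge> 3" using assms(5,6) by linarith
  thus ?thesis
  proof cases
    case 1
    thus ?thesis using dickson_form_2_imp_cyclic_type[of W a b Z W' a' b' q] W ne MD(2) M assms(4) by simp
  next
    case 2
    thus ?thesis using dickson_form_2_imp_cyclic_type[of W' a' b' Z W a b p] W ne MD(2) M assms(4) by simp
  next
    case 3
    thus ?thesis using W assms(4) unfolding dickson_type_def by blast
  qed
qed

theorem pair_classification:
  assumes "indep W W'"
  shows "cyclic_type \<alpha> \<beta> W W' \<or> cyclic_type \<alpha> \<beta> W' W \<or> dickson_type W W'"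
proof -
  have M: "W \<in> M" "W' \<in> M" using assms by (auto simp: indep_def)
  obtain U U' V where V: "W = U \<circ>\<^sub>p V" "W' = U' \<circ>\<^sub>p V" "degree V > 0" "poly V \<alpha> \<noteq> poly V \<beta>"
    and cop: "coprime (degree U) (degree U')" and ge2: "degree U \<ge> 2" "degree U' \<ge> 2"
    and A: "\<exists>A A'. A \<circ>\<^sub>p U = A' \<circ>\<^sub>p U' \<and> degree (A \<circ>\<^sub>p U) > 0"
    by (rule pair_structure[OF assms])
  have "cyclic_pair U U' \<or> cyclic_pair U' U \<or> dihedral_pair U U'"
    using A ritt_second cop ge2 by blast
  moreover have "cyclic_type \<alpha> \<beta> W W'" if "cyclic_pair U U'"
    using cyclic_pair_imp_cyclic_type[OF that V(1,2,4) cop ge2(1)] MD(2) M by blast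
  moreover have "cyclic_type \<alpha> \<beta> W' W" if "cyclic_pair U' U"
    using cyclic_pair_imp_cyclic_type[OF that V(2,1,4) _ ge2(2)] cop MD(2) M by (simp add: coprime_commute)
  moreover have ?thesis if dih: "dihedral_pair U U'"
  proof -
    obtain h X1 X2 a1 b1 a2 b2 where X: "pell h X1" "pell h X2" "a1 \<noteq> 0" "a2 \<noteq> 0"
      "U = smult a1 X1 + [:b1:]" "U' = smult a2 X2 + [:b2:]" using dihedral_pair_imp_pell[OF dih] by blast
    have "degree X1 > 0"
    proof (rule ccontr)
      assume "\<not> degree X1 > 0"
      then obtain x where "X1 = [:x:]" by (metis degree_eq_zeroE neq0_conv)
      thus False using X(5) ge2(1) by simp
    qed
    then obtain Z where Z: "degree Z > 0" "\<And>X. pell h X \<Longrightarrow> \<exists>i s. (s = 1 \<or> s = -1) \<and> X = smult s (dickson i \<circ>\<^sub>p Z)"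
      using pell_generated[OF X(1)] by blast
    obtain i s where s: "s = 1 \<or> s = -1" "X1 = smult s (dickson i \<circ>\<^sub>p Z)" using Z(2)[OF X(1)] by blast
    obtain j s' where s': "s' = 1 \<or> s' = -1" "X2 = smult s' (dickson j \<circ>\<^sub>p Z)" using Z(2)[OF X(2)] by blast
    have nz: "a1 * s \<noteq> 0" "a2 * s' \<noteq> 0" using X s s' by auto
    have fU: "dickson_form U (a1 * s) b1 i Z" "dickson_form U' (a2 * s') b2 j Z"
      using X s s' Z(1) nz by (auto simp: dickson_form_def)
    \<comment> \<open>Both left factors are polynomials in
      \<open>dickson g \<circ>\<^sub>p Z\<close>, whose degree \<open>g * degree Z\<close> divides
      two coprime numbers; so it is affine and can be absorbed into the right factor.\<close>
    define g where "g = gcd i j"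
    have dU: "degree U = i * degree Z" "degree U' = j * degree Z" using fU dickson_form_degree by blast+
    have ij: "i > 0" "j > 0" using dU ge2 by (auto intro!: gr0I)
    hence "g > 0" by (simp add: g_def)
    have "g dvd i" "g dvd j" by (auto simp: g_def)
    then obtain p q where pq: "i = g * p" "j = g * q" by blast
    have "g * degree Z dvd gcd (degree U) (degree U')" unfolding dU pq by (simp add: mult_ac)
    hence gZ: "g * degree Z = 1" using cop by simp
    define Z' where "Z' = dickson g \<circ>\<^sub>p Z \<circ>\<^sub>p V"
    have "dickson p \<circ>\<^sub>p dickson g = dickson i" "dickson q \<circ>\<^sub>p dickson g = dickson j"
      by (simp_all add: dickson_pcompose pq)
    hence comp: "dickson p \<circ>\<^sub>p Z' = dickson i \<circ>\<^sub>p Z \<circ>\<^sub>p V" "dickson q \<circ>\<^sub>p Z' = dickson j \<circ>\<^sub>p Z \<circ>\<^sub>p V"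
      unfolding Z'_def by (metis pcompose_assoc)+
    have "degree Z' = degree V" using gZ by (simp add: Z'_def degree_pcompose degree_dickson)
    hence f: "dickson_form W (a1 * s) b1 p Z'" "dickson_form W' (a2 * s') b2 q Z'"
      using fU V(1-3) unfolding dickson_form_def comp by (simp_all add: pcompose_add pcompose_smult)
    have "p = degree U" "q = degree U'" using dU pq gZ by auto
    thus ?thesis using dickson_pair_cases[OF assms f] cop ge2 by simp
  qed
  ultimately show ?thesis by blast
qed

text \<open>By uniqueness of the exceptional values the two Pell equations coincide up to squares.\<close>

lemma common_dickson:
  assumes f: "dickson_form W1 a b p V" "dickson_form W1 a' b' p' V'" "p \<ge> 3" "p' \<ge> 3"
    and g: "dickson_form W2 a2 b2 q V" "dickson_form W3 a3 b3 q' V'"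
    and ind: "indep W1 W2" "indep W1 W3" "indep W2 W3"
  shows False
proof -
  have M: "W1 \<in> M" "W2 \<in> M" "W3 \<in> M" using ind by (auto simp: indep_def)
  have u: "b' = b" "a' = a \<or> a' = -a" using critical_pair_unique[OF f] by auto
  define X1 X1' where "X1 = dickson p \<circ>\<^sub>p V" and "X1' = dickson p' \<circ>\<^sub>p V'"
  define X2 X3 where "X2 = dickson q \<circ>\<^sub>p V" and "X3 = dickson q' \<circ>\<^sub>p V'"
  have W: "W1 = smult a X1 + [:b:]" "W1 = smult a' X1' + [:b':]" "W2 = smult a2 X2 + [:b2:]" "W3 = smult a3 X3 + [:b3:]"
    and nz: "a \<noteq> 0" "a' \<noteq> 0" "a2 \<noteq> 0" "a3 \<noteq> 0"
    using f g by (simp_all add: dickson_form_def X1_def X1'_def X2_def X3_def)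
  have "smult a X1 = smult a' X1'" using W(1,2) u(1) by (metis add_right_cancel)
  hence "smult (1 / a) (smult a X1) = smult (1 / a) (smult a' X1')" by simp
  hence "X1 = X1' \<or> X1 = - X1'" using u(2) nz by auto
  hence sq: "X1' ^ 2 = X1 ^ 2" by auto
  have dX: "degree X1 > 0" "degree X1' > 0" using f
    by (auto simp: X1_def X1'_def dickson_form_def degree_pcompose degree_dickson)
  define h h' where "h = V ^ 2 - 4" and "h' = V' ^ 2 - 4"
  have "pell h V" "pell h' V'" unfolding pell_def h_def h'_def by (metis mult.right_neutral power_one)+
  hence p: "pell h X1" "pell h X2" "pell h' X1'" "pell h' X3"
    unfolding X1_def X2_def X1'_def X3_def by (simp_all add: pell_dickson)
  have "odd_part h = odd_part h'"
    using pell_odd_part(1)[OF p(1) dX(1)] pell_odd_part(1)[OF p(3) dX(2)] sq by simp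
  moreover have dX23: "degree X2 > 0" "degree X3 > 0"
  proof -
    have "degree X > 0" if "W = smult c X + [:d:]" "W \<in> M" for W X c d
    proof (rule ccontr)
      assume "\<not> degree X > 0"
      then obtain x where "X = [:x:]" by (metis degree_eq_zeroE neq0_conv)
      thus False using that(1) MD(1)[OF that(2)] by simp
    qed
    thus "degree X2 > 0" "degree X3 > 0" using W M by blast+
  qed
  ultimately have P: "pell (odd_part h) X1" "pell (odd_part h) X2" "pell (odd_part h) X3"
    using pell_odd_part(2) p dX by metis+
  have eq: "poly X \<alpha> = poly X \<beta>" if "W = smult c X + [:d:]" "W \<in> M" "c \<noteq> 0" for W X c d
    using MD(2)[OF that(2)] that(1,3) by simp
  have "common_closed_factor \<alpha> \<beta> X1 X2 \<or> common_closed_factor \<alpha> \<beta> X1 X3 \<or> common_closed_factor \<alpha> \<beta> X2 X3"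
    by (rule three_pell[OF P dX(1) eq[OF W(1) M(1) nz(1)] eq[OF W(3) M(2) nz(3)] eq[OF W(4) M(3) nz(4)]])
  moreover have "common_closed_factor \<alpha> \<beta> (smult c X + [:d:]) (smult c' X' + [:d':])"
    if ccf: "common_closed_factor \<alpha> \<beta> X X'" for X X' c d c' d'
  proof -
    obtain Y U U' where Y: "poly Y \<alpha> = poly Y \<beta>" "X = U \<circ>\<^sub>p Y" "X' = U' \<circ>\<^sub>p Y"
      using ccf by (auto simp: common_closed_factor_def)
    have "smult c X + [:d:] = (smult c U + [:d:]) \<circ>\<^sub>p Y" "smult c' X' + [:d':] = (smult c' U' + [:d':]) \<circ>\<^sub>p Y"
      using Y by (simp_all add: pcompose_add pcompose_smult)
    thus ?thesis using Y(1) unfolding common_closed_factor_def by blast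
  qed
  ultimately show False using indepD ind W(1,3,4) by metis
qed

lemma no_two_dickson:
  assumes "dickson_type W1 W2" "dickson_type W1 W3" "indep W1 W2" "indep W1 W3" "indep W2 W3"
  shows False
proof -
  obtain Z p q a b a' b' where 1: "p \<ge> 3" "dickson_form W1 a b p Z" "dickson_form W2 a' b' q Z"
    using assms(1) unfolding dickson_type_def by blast
  obtain Z' p' q' c d c' d' where 2: "p' \<ge> 3" "dickson_form W1 c d p' Z'" "dickson_form W3 c' d' q' Z'"
    using assms(2) unfolding dickson_type_def by blast
  show False by (rule common_dickson[OF 1(2) 2(2) 1(1) 2(1) 1(3) 2(3) assms(3-5)])
qed

end

section \<open>Triples of minimal closed factors\<close>

lemma two_ramified_fibers:
  fixes Y :: "complex poly"
  assumes "degree Y > 0" "x \<noteq> x'" "\<And>t. poly Y t = x \<or> poly Y t = x' \<Longrightarrow> ramif Y t \<ge> 2"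
  shows False
proof -
  have half: "2 * card {t. poly Y t = z} \<le> degree Y" if "z = x \<or> z = x'" for z
  proof -
    have "(\<Sum>t | poly Y t = z. 2) \<le> (\<Sum>t | poly Y t = z. ramif Y t)" using that assms(3) by (intro sum_mono) auto
    thus ?thesis using sum_ramif_fiber[OF assms(1), of z] by simp
  qed
  \<comment> \<open>A fibre without simple points has at most half as many points as the degree; two
    of them would miss more than Riemann-Hurwitz allows.\<close>
  have "2 * degree Y + 1 \<le> card {t. poly Y t = x} + card {t. poly Y t = x'} + degree Y"
    using sum_card_fibers_ge[OF assms(1), of "{x, x'}"] assms(2) by simp
  thus False using half[of x] half[of x'] by simp
qed

lemma order_smult_power:
  fixes Y :: "complex poly"
  assumes "c \<noteq> 0" "Y \<noteq> 0" shows "order t (smult c (Y ^ n)) = n * order t Y"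
  using assms by (simp add: order_smult order_power)

lemma power_form_ramif:
  fixes U Y Z :: "complex poly"
  assumes "U \<circ>\<^sub>p Y - [:g:] = smult c (Z ^ n)" "c \<noteq> 0" "degree U > 0" "degree Y > 0" "poly U (poly Y t) = g"
  shows "n dvd ramif U (poly Y t) * ramif Y t"
proof -
  have d: "degree (U \<circ>\<^sub>p Y) > 0" using assms by (simp add: degree_pcompose)
  have "smult c (Z ^ n) \<noteq> 0" using diff_const_nonzero[OF d, of g] assms(1) by simp
  hence ord: "order t (smult c (Z ^ n)) = n * order t Z"
    by (cases "Z = 0") (auto simp: order_smult_power assms(2) power_0_left order_0I split: if_splits)
  have "ramif (U \<circ>\<^sub>p Y) t = order t (U \<circ>\<^sub>p Y - [:g:])" using assms(5) by (simp add: ramif_def poly_pcompose)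
  hence "ramif U (poly Y t) * ramif Y t = n * order t Z"
    unfolding assms(1) ord using ramif_pcompose[OF assms(3,4), of t] by simp
  thus ?thesis by simp
qed

text \<open>Point counts over \<open>e\<close> and the exceptional values: an \<open>n\<close>-th
  power has at most \<open>m / n\<close> points over \<open>e\<close>, and the exceptional fibres
  are small as well. Another value \<open>e\<close>, or an exponent above 2, would exceed the total
  ramification.\<close>

lemma power_dickson_form:
  assumes f: "dickson_form W a b p V" "p \<ge> 3" and W: "W = smult c (Y ^ n) + [:e:]" "c \<noteq> 0" "n \<ge> 2"
  shows "n = 2 \<and> (e = b + 2 * a \<or> e = b - 2 * a)"
proof -
  define m d where "m = degree W" and "d = degree V"
  have a: "a \<noteq> 0" "d > 0" using f by (auto simp: dickson_form_def d_def)
  have m: "m = p * d" using dickson_form_degree[OF f(1)] by (simp add: m_def d_def)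
  have mpos: "m > 0" using m a f(2) by simp
  have d3: "3 * d \<le> m" unfolding m using f(2) by simp
  have Ynz: "Y \<noteq> 0" using mpos W by (auto simp: m_def power_0_left)
  have "W = smult c (Y ^ n) - [:-e:]" using W(1) by simp
  hence "m = degree (smult c (Y ^ n))" unfolding m_def by (simp only: degree_diff_const)
  hence mY: "m = n * degree Y" using W(2) Ynz by (simp add: degree_power_eq)
  define N where "N z = card {t. poly W t = z}" for z
  have RH: "card C * m + 1 \<le> (\<Sum>z\<in>C. N z) + m" if "finite C" for C
    using sum_card_fibers_ge[of W C] that mpos by (simp add: m_def N_def)
  have "{t. poly W t = e} = {t. poly Y t = 0}" using W by auto
  hence Ne: "N e \<le> degree Y" unfolding N_def using card_poly_roots_bound[OF Ynz] by simp
  have tot: "N (b + 2 * a) + N (b - 2 * a) \<le> m + d"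
    using dickson_form_total[OF f(1)] f(2) unfolding N_def m d_def by simp
  have ne: "b + 2 * a \<noteq> b - 2 * a" using a by auto
  have "2 * degree Y \<le> n * degree Y" using W(3) by (rule mult_le_mono1)
  hence Ne2: "2 * N e \<le> m" using Ne mY by linarith
  have e: "e = b + 2 * a \<or> e = b - 2 * a"
  proof (rule ccontr)
    assume "\<not> ?thesis"
    hence "3 * m + 1 \<le> N e + (N (b + 2 * a) + N (b - 2 * a)) + m"
      using RH[of "{e, b + 2 * a, b - 2 * a}"] ne by auto
    thus False using tot Ne2 d3 by linarith
  qed
  define e' where "e' = 2 * b - e"
  have e': "e' = b + 2 * a \<or> e' = b - 2 * a" "e \<noteq> e'" using e a by (auto simp: e'_def)
  have "n = 2"
  proof (rule ccontr)
    assume "n \<noteq> 2"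
    hence n3: "n \<ge> 3" using W(3) by simp
    hence "3 * degree Y \<le> m" unfolding mY by (rule mult_le_mono1)
    hence Ne3: "3 * N e \<le> m" using Ne by linarith
    have two: "m + 1 \<le> N e + N e'" using RH[of "{e, e'}"] e'(2) by simp
    have Ne': "N e' \<le> (p + 2) div 2 * d" using dickson_form_single[OF f(1) _ e'(1)] f(2) by (simp add: N_def d_def)
    show False
    \<comment> \<open>For \<open>p \<ge> 3\<close> the estimate
      \<open>3 * ((p + 2) div 2) \<le> 2 * p\<close> fails only at 4, an index handled through
      \<open>dickson 4 = dickson 2 ^ 2 - 2\<close>.\<close>
    proof (cases "p = 4")
      case False
      have "3 * ((p + 2) div 2) \<le> 2 * p" using False f(2) by presburger
      hence "3 * ((p + 2) div 2) * d \<le> 2 * p * d" by (rule mult_le_mono1)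
      moreover have "3 * N e' \<le> 3 * ((p + 2) div 2) * d" using mult_le_mono2[OF Ne', of 3] by (simp only: mult.assoc)
      ultimately have "3 * N e' \<le> 2 * m" unfolding m by (simp only: mult.assoc)
      thus False using two Ne3 by linarith
    next
      case p4: True
      obtain r where r: "r ^ 2 = (2 :: complex)" using complex_root_exists[of 2] by auto
      have r0: "r \<noteq> 0" using r by auto
      have D4: "dickson 4 = dickson 2 ^ 2 - 2" using dickson_double[of 2] by simp
      have "dickson 2 = [:-2, 0, 1:]" by (simp add: numeral_2_eq_2)
      also have "\<dots> = [:-r, 1:] * [:r, 1:]" using r by (simp add: power2_eq_square)
      finally have D2: "dickson 2 = [:-r, 1:] * [:r, 1:]" .
      have val: "poly W t = a * ((poly (dickson 2) (poly V t)) ^ 2 - 2) + b" for t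
        using dickson_form_poly[OF f(1), of t] by (simp add: p4 D4)
      show False
      proof (cases "e' = b - 2 * a")
        case True
        have "poly (dickson 2) (poly V t) = 0" if "poly W t = e'" for t
        proof -
          have "a * (poly (dickson 2) (poly V t)) ^ 2 = 0" using val[of t] that True by (simp add: algebra_simps)
          thus ?thesis using a by simp
        qed
        hence "N e' \<le> degree (dickson 2) * degree V" unfolding N_def
          using a(2) D2 by (intro card_roots_pcompose_le) (auto simp: d_def)
        hence "N e' \<le> 2 * d" by (simp add: degree_dickson d_def)
        thus False using two Ne3 d3 m p4 a(2) by linarith
      next
        case False
        hence eq: "e = b - 2 * a" using e e' by auto
        have "n = 3"
        proof (rule ccontr)
          assume "n \<noteq> 3"
          hence "4 * degree Y \<le> n * degree Y" using n3 by (intro mult_le_mono1) simp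
          moreover have "m = 4 * d" using m p4 by simp
        ultimately have "4 * N e \<le> 4 * d" using Ne mY by linarith
          thus False using two Ne' m p4 by simp
        qed
        \<comment> \<open>\<open>G\<close> at \<open>V\<close> is a cube up to a constant, but
          \<open>G\<close> has double zeros at \<open>r\<close> and \<open>-r\<close>; so
          \<open>V\<close> would be ramified at all points of both fibres.\<close>
        define G where "G = smult a (dickson 2 ^ 2)"
        have G: "G \<circ>\<^sub>p V - [:0:] = smult c (Y ^ 3)"
        proof -
          have "W = smult a (dickson 2 ^ 2 - 2) \<circ>\<^sub>p V + [:b:]"
            using f(1) by (simp add: dickson_form_def p4 D4 pcompose_smult)
          also have "smult a (dickson 2 ^ 2 - 2) = G - [:2 * a:]"
            by (simp add: G_def smult_diff_right numeral_poly mult.commute)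
          finally have "W = G \<circ>\<^sub>p V + [:e:]" by (simp add: pcompose_diff eq)
          thus ?thesis using W(1) \<open>n = 3\<close> by simp
        qed
        have "dickson 2 \<noteq> 0" using degree_dickson[of 2] by auto
        hence dG: "degree G > 0" using a(1) degree_dickson[of 2] by (simp add: G_def degree_power_eq) 
        have ordG: "ramif G x = 2" if "x = r \<or> x = -r" for x
        proof -
          have "poly G x = 0" using that by (auto simp: G_def D2)
          hence "ramif G x = order x G" by (simp add: ramif_def)
          also have "\<dots> = 2 * order x (dickson 2)" unfolding G_def using a(1) D2 by (intro order_smult_power) auto
          also have "order x (dickson 2) = order x [:-r, 1:] + order x [:r, 1:]"
            unfolding D2 by (rule order_mult) simp
          also have "\<dots> = 1"
          proof -
            have "order x [:-x, 1:] = 1" using order_power_n_n[of x 1] by simp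
            moreover have "order x [:x, 1:] = 0" using that r0 by (intro order_0I) auto
            ultimately show ?thesis using that by auto
          qed
          finally show ?thesis by simp
        qed
        show False
        proof (rule two_ramified_fibers[of V r "-r"])
          show "degree V > 0" using a(2) by (simp add: d_def)
          show "r \<noteq> -r" using r0 by auto
          fix t assume t: "poly V t = r \<or> poly V t = -r"
          have "3 dvd ramif G (poly V t) * ramif V t"
            using power_form_ramif[OF G W(2) dG _, of t] t a(2) by (auto simp: d_def G_def D2)
          hence "3 dvd 2 * ramif V t" using ordG[of "poly V t"] t by simp
          moreover have "ramif V t \<ge> 1" using ramif_pos a(2) by (simp add: d_def)
          ultimately show "ramif V t \<ge> 2" by presburger
        qed
      qed
    qed
  qed
  thus ?thesis using e by blast
qed

text \<open>The generating solution must produce the solution \<open>[:0, 1:]\<close>, so it has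
  degree 1 and equals it up to sign; the sign passes through \<open>dickson\<close> by
  parity.\<close>

lemma dickson_of_pell:
  assumes "pell [:-4, 0, 1:] X"
  shows "\<exists>s. (s = 1 \<or> s = -1) \<and> X = smult s (dickson (degree X))"
proof -
  have "pell [:-4, 0, 1:] [:0, 1:]"
    unfolding pell_def by (intro exI[of _ 1]) (simp add: power2_eq_square numeral_poly)
  then obtain Z where Z: "pell [:-4, 0, 1:] Z" "degree Z > 0"
    "\<And>X. pell [:-4, 0, 1:] X \<Longrightarrow> \<exists>i s. (s = 1 \<or> s = -1) \<and> X = smult s (dickson i \<circ>\<^sub>p Z)"
    using pell_generated[of "[:-4, 0, 1:]" "[:0, 1:]"] by auto
  obtain j s where j: "s = 1 \<or> s = -1" "[:0, 1:] = smult s (dickson j \<circ>\<^sub>p Z)"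
    using Z(3)[OF \<open>pell [:-4, 0, 1:] [:0, 1:]\<close>] by blast
  have "degree [:0, 1 :: complex:] = j * degree Z"
    by (subst j(2)) (use j(1) in \<open>auto simp: degree_pcompose degree_dickson\<close>)
  hence "j = 1" "degree Z = 1" by simp_all
  hence "[:0, 1:] = smult s Z" using j(2) by (simp add: pcompose_X)
  hence "smult s [:0, 1:] = smult s (smult s Z)" by simp
  hence ZX: "Z = [:0, s:]" using j(1) by auto
  obtain i s' where i: "s' = 1 \<or> s' = -1" "X = smult s' (dickson i \<circ>\<^sub>p Z)" using Z(3)[OF assms] by blast
  have "dickson i \<circ>\<^sub>p Z = smult (s ^ i) (dickson i)"
  proof (rule poly_eq_poly_eq_iff[THEN iffD1, OF ext])
    show "poly (dickson i \<circ>\<^sub>p Z) z = poly (smult (s ^ i) (dickson i)) z" for z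
      using j(1) poly_dickson_neg[of i z] by (auto simp: poly_pcompose ZX)
  qed
  hence X: "X = smult (s' * s ^ i) (dickson i)" using i(2) by simp
  have s: "s' * s ^ i = 1 \<or> s' * s ^ i = -1" using i(1) j(1) by (cases "even i") auto
  hence "s' * s ^ i \<noteq> 0" by (metis neg_equal_0_iff_equal zero_neq_one)
  hence "degree X = i" unfolding X degree_smult_eq by (simp only: if_False degree_dickson)
  thus ?thesis using X s by blast
qed

lemma even_fiber_square:
  fixes Y :: "complex poly"
  assumes "degree Y > 0" "\<And>t. poly Y t = x \<Longrightarrow> even (ramif Y t)"
  shows "\<exists>S. Y - [:x:] = S ^ 2"
proof -
  have empty: "{t. poly (Y - [:x:]) t = 0 \<and> odd (order t (Y - [:x:]))} = {}"
    using assms(2) by (auto simp: ramif_def)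
  show ?thesis using odd_part_decomposition[OF diff_const_nonzero[OF assms(1), of x]] unfolding empty by simp
qed

lemma odd_fiber_square:
  fixes U :: "complex poly"
  assumes "degree U > 0" "{x. poly U x = g \<and> odd (ramif U x)} = {x0}"
  shows "\<exists>S. U - [:g:] = [:-x0, 1:] * S ^ 2"
proof -
  have single: "{t. poly (U - [:g:]) t = 0 \<and> odd (order t (U - [:g:]))} = {x0}"
    unfolding assms(2)[symmetric] by (auto simp: ramif_def)
  show ?thesis using odd_part_decomposition[OF diff_const_nonzero[OF assms(1), of g]] unfolding single by simp
qed

text \<open>Oddness turns \<open>U - g = (y - x0) * S(y) ^ 2\<close> into
  \<open>U + g = (y + x0) * S(-y) ^ 2\<close>. The product of both, rescaled so that
  \<open>x0\<close> becomes 2, is the Pell equation with radicand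
  \<open>[:-4, 0, 1:]\<close>.\<close>

lemma odd_square_factor_imp_dickson:
  fixes U :: "complex poly"
  assumes "U - [:g:] = [:-x0, 1:] * S ^ 2" "\<And>z. poly U (- z) = - poly U z" "g \<noteq> 0" "x0 \<noteq> 0"
  shows "\<exists>s. s \<noteq> 0 \<and> U \<circ>\<^sub>p [:0, x0 / 2:] = smult s (dickson (degree U))"
proof -
  define X1 where "X1 = smult (2 / g) (U \<circ>\<^sub>p [:0, x0 / 2:])"
  define T where "T = smult (x0 / g) ((S \<circ>\<^sub>p [:0, x0 / 2:]) * (S \<circ>\<^sub>p [:0, - x0 / 2:]))"
  have U: "poly U y - g = (y - x0) * (poly S y) ^ 2" for y
  proof -
    have "poly (U - [:g:]) y = poly ([:-x0, 1:] * S ^ 2) y" by (simp only: assms(1))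
    thus ?thesis by (simp add: left_diff_distrib)
  qed
  have "X1 ^ 2 - 4 = [:-4, 0, 1:] * T ^ 2"
  proof (rule poly_eq_poly_eq_iff[THEN iffD1, OF ext])
    fix z
    define y where "y = x0 / 2 * z"
    define p q where "p = poly S y" and "q = poly S (- y)"
    have 1: "poly U y - g = (y - x0) * p ^ 2" using U by (simp add: p_def)
    have "- poly U y - g = (- y - x0) * q ^ 2" using U[of "- y"] assms(2) by (simp add: q_def)
    hence 2: "poly U y + g = (y + x0) * q ^ 2" by (simp add: algebra_simps)
    have "poly (X1 ^ 2 - 4) z = (2 / g) ^ 2 * ((poly U y - g) * (poly U y + g))"
    proof -
      define \<kappa> u where "\<kappa> = 2 / g" and "u = poly U y"
      have "\<kappa> * g = 2" using assms(3) by (simp add: \<kappa>_def)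
      hence "(\<kappa> * g) * (\<kappa> * g) = 4" by simp
      hence "(\<kappa> * u) ^ 2 - 4 = \<kappa> ^ 2 * ((u - g) * (u + g))" by (simp add: power2_eq_square algebra_simps)
      moreover have "poly X1 z = \<kappa> * u" by (simp add: X1_def poly_pcompose y_def \<kappa>_def u_def mult.commute)
      ultimately show ?thesis by (simp add: \<kappa>_def u_def)
    qed
    also have "\<dots> = (2 / g) ^ 2 * ((y - x0) * (y + x0)) * (p * q) ^ 2" unfolding 1 2 by (simp add: power2_eq_square)
    also have "(y - x0) * (y + x0) = (x0 / 2) ^ 2 * (z ^ 2 - 4)"
    proof -
      have "(h * z - 2 * h) * (h * z + 2 * h) = h ^ 2 * (z ^ 2 - 4)" for h by (simp add: power2_eq_square algebra_simps)
      from this[of "x0 / 2"] show ?thesis by (simp add: y_def)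
    qed
    also have "(2 / g) ^ 2 * ((x0 / 2) ^ 2 * (z ^ 2 - 4)) * (p * q) ^ 2 = (z ^ 2 - 4) * (x0 / g * (p * q)) ^ 2"
    proof -
      have "(k * h * r) ^ 2 = k ^ 2 * h ^ 2 * r ^ 2" for k h r :: complex by (simp add: power_mult_distrib)
      from this[of "2 / g" "x0 / 2" "p * q"] show ?thesis by (simp add: mult.assoc)
    qed
    also have "\<dots> = poly ([:-4, 0, 1:] * T ^ 2) z"
    proof -
      have "poly T z = x0 / g * (p * q)" by (simp add: T_def poly_pcompose p_def q_def y_def mult.commute)
      moreover have "poly ([:-4, 0, 1:] * T ^ 2) z = (z ^ 2 - 4) * (poly T z) ^ 2"
        by (simp add: power2_eq_square algebra_simps)
      ultimately show ?thesis by simp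
    qed
    finally show "poly (X1 ^ 2 - 4) z = poly ([:-4, 0, 1:] * T ^ 2) z" .
  qed
  hence "pell [:-4, 0, 1:] X1" unfolding pell_def by blast
  moreover have "degree X1 = degree U" using assms(3,4) by (simp add: X1_def degree_pcompose)
  ultimately obtain s where s: "s = 1 \<or> s = -1" "X1 = smult s (dickson (degree U))" using dickson_of_pell by metis
  have "U \<circ>\<^sub>p [:0, x0 / 2:] = smult (g / 2) X1" using assms(3) by (simp add: X1_def)
  also have "\<dots> = smult (g / 2 * s) (dickson (degree U))" by (simp add: s(2))
  finally show ?thesis using s(1) assms(3) by (intro exI[of _ "g / 2 * s"]) auto
qed

text \<open>With \<open>R = r - 1\<close> and \<open>K = k - 1\<close> the inequalities read
  \<open>n' * R \<le> K\<close> and \<open>(n - 1) * K \<le> n * R\<close>, so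
  \<open>(n - 1) * n' \<le> n\<close>.\<close>

lemma path_arith:
  fixes n n' k r :: nat
  assumes "n \<ge> 2" "n' \<ge> 2" "k > 1" "n' * r + 1 \<le> k + n'" "n * k + 1 \<le> n * r + k"
  shows "n = 2 \<and> n' = 2"
proof -
  define R K where "R = int r - 1" and "K = int k - 1"
  have K: "K \<ge> 1" using assms(3) by (simp add: K_def)
  have "int n' * int r + 1 \<le> int k + int n'" using assms(4) by (simp flip: of_nat_mult of_nat_add add: of_nat_le_iff[where ?'a=int, symmetric])
  hence 1: "int n' * R \<le> K" by (simp add: R_def K_def algebra_simps)
  have "int n * int k + 1 \<le> int n * int r + int k" using assms(5) by (simp flip: of_nat_mult of_nat_add add: of_nat_le_iff[where ?'a=int, symmetric])
  hence 2: "(int n - 1) * K \<le> int n * R" by (simp add: R_def K_def algebra_simps)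
  have "(int n - 1) * K > 0" using K assms(1) by simp
  hence "int n * R > 0" using 2 by linarith
  hence R: "R \<ge> 1" using assms(1) by (simp add: zero_less_mult_iff)
  have "2 * R \<le> int n' * R" using R assms(2) by (intro mult_right_mono) auto
  hence 3: "2 * R \<le> K" using 1 by linarith
  have "(int n - 1) * (2 * R) \<le> (int n - 1) * K" using 3 assms(1) by (intro mult_left_mono) auto
  hence "(2 * (int n - 1)) * R \<le> int n * R" using 2 by (simp add: mult_ac)
  hence "2 * (int n - 1) \<le> int n" using R by simp
  hence n: "n = 2" using assms(1) by simp
  hence "K \<le> 2 * R" using 2 by simp
  hence "int n' * R \<le> 2 * R" using 1 by linarith
  hence "int n' \<le> 2" using R by simp
  thus ?thesis using n assms(2) by simp
qed

text \<open>The middle polynomial is both \<open>U\<close> of \<open>Y\<close> and a power of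
  \<open>Z\<close> up to constants, so \<open>U \<circ>\<^sub>p Y - [:g:]\<close> is an
  \<open>n'\<close>-th power up to a factor. Over a point of the fibre \<open>R\<close> whose index
  is not divisible by \<open>n'\<close>, \<open>Y\<close> is ramified everywhere; so there is at
  most one such point and \<open>R\<close> is small. Rotating \<open>R\<close> forces
  \<open>n = n' = 2\<close>, and the resulting squares turn \<open>U\<close> and \<open>Y\<close>
  into Dickson polynomials.\<close>

lemma path_structure:
  assumes c13: "cyclic_type \<alpha> \<beta> W1 W3" and c32: "cyclic_type \<alpha> \<beta> W3 W2" and d: "degree W1 > 0"
  shows "\<exists>K k a1 b1 a3 b3. odd k \<and> k \<ge> 3 \<and> dickson_form W1 a1 b1 4 K \<and> dickson_form W3 a3 b3 (2 * k) K \<and>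
    (\<exists>E k'. odd k' \<and> degree W3 = 2 * E \<and> degree W2 = k' * E)"
proof -
  have d3: "degree W3 > 0" using cyclic_type_degree_less[OF c13 d] by simp
  from c13 d obtain c n Y e U f where 1: "c \<noteq> 0" "n \<ge> 2" "W1 = smult c (Y ^ n) + [:e:]" "W3 = U \<circ>\<^sub>p Y + [:f:]"
    "coprime n (degree U)" "\<forall>\<epsilon> z. \<epsilon> ^ n = 1 \<longrightarrow> poly U (\<epsilon> * z) = \<epsilon> ^ degree U * poly U z"
    "poly U (poly Y \<alpha>) = 0" "poly U (poly Y \<beta>) = 0" "poly Y \<alpha> \<noteq> 0" "poly Y \<alpha> \<noteq> poly Y \<beta>" "poly U 0 = 0"
    "degree Y > 0" "degree W1 = n * degree Y" "degree W3 = degree U * degree Y" "degree U > n"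
    by (rule cyclic_typeE)
  from c32 d3 obtain c' n' Z e' U' f' where 2: "c' \<noteq> 0" "n' \<ge> 2" "W3 = smult c' (Z ^ n') + [:e':]"
    "W2 = U' \<circ>\<^sub>p Z + [:f':]"
    "coprime n' (degree U')" "\<forall>\<epsilon> z. \<epsilon> ^ n' = 1 \<longrightarrow> poly U' (\<epsilon> * z) = \<epsilon> ^ degree U' * poly U' z"
    "poly U' (poly Z \<alpha>) = 0" "poly U' (poly Z \<beta>) = 0" "poly Z \<alpha> \<noteq> 0" "poly Z \<alpha> \<noteq> poly Z \<beta>" "poly U' 0 = 0"
    "degree Z > 0" "degree W3 = n' * degree Z" "degree W2 = degree U' * degree Z" "degree U' > n'"
    by (rule cyclic_typeE)
  define k where "k = degree U"
  have k: "k > 1" "degree U > 0" "k \<ge> 3" using 1 by (auto simp: k_def)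
  define g where "g = e' - f"
  have eq: "U \<circ>\<^sub>p Y - [:g:] = smult c' (Z ^ n')"
  proof -
    have "U \<circ>\<^sub>p Y = smult c' (Z ^ n') + [:e':] - [:f:]" using 1(4) 2(3) by (metis add_diff_cancel_right')
    thus ?thesis by (simp add: g_def)
  qed
  have g0: "g \<noteq> 0"
  proof
    assume "g = 0"
    have "poly (U \<circ>\<^sub>p Y - [:g:]) \<alpha> = poly (smult c' (Z ^ n')) \<alpha>" by (simp only: eq)
    thus False using \<open>g = 0\<close> 1(7) 2(1,2,9) by (simp add: poly_pcompose)
  qed
  define R where "R = {x. poly U x = g}"
  have fR: "finite R" using finite_fiber k by (simp add: R_def)
  have ram: "n' dvd ramif U x * ramif Y t" if "poly Y t = x" "x \<in> R" for x t
    using power_form_ramif[OF eq 2(1) k(2) 1(12), of t] that by (simp add: R_def)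
  have sumR: "(\<Sum>x\<in>R. ramif U x) = k" using sum_ramif_fiber[OF k(2)] by (simp add: R_def k_def)
  have uniq: "x = x'" if "x \<in> R" "x' \<in> R" "\<not> n' dvd ramif U x" "\<not> n' dvd ramif U x'" for x x'
  proof (rule ccontr)
    assume "x \<noteq> x'"
    show False
    proof (rule two_ramified_fibers[OF 1(12) \<open>x \<noteq> x'\<close>])
      fix t assume t: "poly Y t = x \<or> poly Y t = x'"
      hence "n' dvd ramif U (poly Y t) * ramif Y t" "\<not> n' dvd ramif U (poly Y t)" using ram that by auto
      hence "ramif Y t \<noteq> 1" by auto
      thus "ramif Y t \<ge> 2" using ramif_pos[OF 1(12), of t] by simp
    qed
  qed
  have count: "n' * card R + 1 \<le> k + n'"
  proof (cases "\<exists>x\<in>R. \<not> n' dvd ramif U x")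
    case True
    then obtain x where x: "x \<in> R" "\<not> n' dvd ramif U x" by blast
    have "(\<Sum>y\<in>R - {x}. n') \<le> (\<Sum>y\<in>R - {x}. ramif U y)"
    proof (rule sum_mono)
      fix y assume "y \<in> R - {x}"
      hence "n' dvd ramif U y" using uniq[OF x(1) _ x(2)] by blast
      thus "n' \<le> ramif U y" using ramif_pos[OF k(2), of y] by (intro dvd_imp_le) auto
    qed
    moreover have "k = ramif U x + (\<Sum>y\<in>R - {x}. ramif U y)" using sum.remove[OF fR x(1)] sumR by metis
    moreover have "card R = Suc (card (R - {x}))" using card.remove[OF fR x(1)] .
    ultimately show ?thesis using ramif_pos[OF k(2), of x] by (simp add: mult.commute)
  next
    case False
    have "(\<Sum>y\<in>R. n') \<le> (\<Sum>y\<in>R. ramif U y)"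
      using False ramif_pos[OF k(2)] by (intro sum_mono dvd_imp_le) (auto simp: Suc_le_eq)
    thus ?thesis using sumR 2(2) by (simp add: mult.commute)
  qed
  \<comment> \<open>Rotation carries the fibre of \<open>U\<close> over \<open>g\<close> to those
    over \<open>\<epsilon> ^ k * g\<close>; as \<open>n\<close> and \<open>k\<close> are coprime,
    these are \<open>n\<close> different fibres of the same size.\<close>
  define C where "C = (\<lambda>\<epsilon>. \<epsilon> ^ k * g) ` {\<epsilon>. \<epsilon> ^ n = 1}"
  have inj: "inj_on (\<lambda>\<epsilon>. \<epsilon> ^ k * g) {\<epsilon>. \<epsilon> ^ n = 1}"
  proof
    fix x y :: complex assume xy: "x \<in> {\<epsilon>. \<epsilon> ^ n = 1}" "y \<in> {\<epsilon>. \<epsilon> ^ n = 1}" "x ^ k * g = y ^ k * g"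
    have y0: "y \<noteq> 0" using xy(2) 1(2) by (auto simp: power_0_left)
    have "(x / y) ^ n = 1" "(x / y) ^ k = 1" using xy y0 g0 by (auto simp: power_divide)
    hence "(x / y) ^ gcd n k = 1" by (rule root_of_unity_gcd)
    thus "x = y" using 1(5) y0 by (simp add: k_def)
  qed
  have fC: "finite C" unfolding C_def using 1(2) by (intro finite_imageI finite_nth_roots) auto
  have cC: "card C = n" unfolding C_def using inj 1(2) by (simp add: card_image card_roots_unity_eq)
  have NC: "card {x. poly U x = z} = card R" if zC: "z \<in> C" for z
  proof -
    obtain \<epsilon> where eps: "\<epsilon> ^ n = 1" "z = \<epsilon> ^ k * g" using zC by (auto simp: C_def)
    have e0: "\<epsilon> \<noteq> 0" using eps 1(2) by (auto simp: power_0_left)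
    have "{x. poly U x = z} = (\<lambda>x. \<epsilon> * x) ` R"
    proof (intro equalityI subsetI)
      fix x assume "x \<in> {x. poly U x = z}"
      hence "\<epsilon> ^ k * poly U (x / \<epsilon>) = \<epsilon> ^ k * g" using 1(6)[rule_format, OF eps(1), of "x / \<epsilon>"] e0 eps(2) by (simp add: k_def)
      hence "x / \<epsilon> \<in> R" using e0 by (simp add: R_def)
      thus "x \<in> (\<lambda>x. \<epsilon> * x) ` R" using e0 by (intro image_eqI[of _ _ "x / \<epsilon>"]) auto
    next
      fix x assume "x \<in> (\<lambda>x. \<epsilon> * x) ` R"
      thus "x \<in> {x. poly U x = z}" using 1(6)[rule_format, OF eps(1)] eps(2) by (auto simp: R_def k_def)
    qed
    thus ?thesis using e0 by (simp add: card_image inj_on_def)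
  qed
  have "n * k + 1 \<le> n * card R + k"
    using sum_card_fibers_ge[OF k(2) fC] NC cC by (simp add: k_def)
  hence n2: "n = 2" "n' = 2" using path_arith[OF 1(2) 2(2) k(1) count] by auto
  have kodd: "odd k" using 1(5) n2 by (simp add: k_def)
  have "\<exists>x\<in>R. odd (ramif U x)"
  proof (rule ccontr)
    assume "\<not> ?thesis"
    hence "even (\<Sum>x\<in>R. ramif U x)" by (intro dvd_sum) auto
    thus False using sumR kodd by simp
  qed
  then obtain x0 where x0: "x0 \<in> R" "odd (ramif U x0)" by blast
  have "{x. poly U x = g \<and> odd (ramif U x)} = {x0}" using uniq x0 n2 by (auto simp: R_def)
  then obtain S where S: "U - [:g:] = [:-x0, 1:] * S ^ 2" using odd_fiber_square[OF k(2)] by blast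
  have Uneg: "poly U (- z) = - poly U z" for z
    using 1(6)[rule_format, of "-1" z] n2 kodd by (simp add: k_def)
  have x00: "x0 \<noteq> 0" using x0(1) 1(11) g0 by (auto simp: R_def)
  obtain s where s: "s \<noteq> 0" "U \<circ>\<^sub>p [:0, x0 / 2:] = smult s (dickson k)"
    using odd_square_factor_imp_dickson[OF S Uneg g0 x00] by (auto simp: k_def)
  have "even (ramif Y t)" if "poly Y t = x0" for t
    using ram[OF that x0(1)] x0(2) n2 by simp
  then obtain T where T: "Y - [:x0:] = T ^ 2" using even_fiber_square[OF 1(12)] by blast
  \<comment> \<open>The scale is chosen so that \<open>dickson 2\<close> of \<open>K\<close> is a
    constant multiple of \<open>Y\<close>.\<close>
  obtain \<kappa> where \<kappa>: "\<kappa> ^ 2 = - 2 / x0" using complex_root_exists[of 2] by auto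
  define K where "K = smult \<kappa> T"
  have D2: "dickson 2 = [:-2, 0, 1:]" by (simp add: numeral_2_eq_2)
  have KY: "dickson 2 \<circ>\<^sub>p K = smult (- 2 / x0) Y"
  proof -
    have "dickson 2 \<circ>\<^sub>p K = smult (\<kappa> ^ 2) (T ^ 2) + [:-2:]"
      by (simp add: D2 pcompose_pCons K_def power2_eq_square)
    also have "\<dots> = smult (- 2 / x0) (Y - [:x0:]) + [:-2:]" by (simp add: \<kappa> T)
    also have "\<dots> = smult (- 2 / x0) Y" using x00 by (simp add: smult_diff_right)
    finally show ?thesis .
  qed
  have "degree (dickson 2 \<circ>\<^sub>p K) = degree Y" unfolding KY using x00 by simp
  hence dK: "degree K > 0" using 1(12) by (simp add: degree_pcompose degree_dickson)
  have val: "poly Y t = - (x0 / 2) * poly (dickson 2) (poly K t)" for t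
  proof -
    have "poly (dickson 2 \<circ>\<^sub>p K) t = poly (smult (- 2 / x0) Y) t" by (simp only: KY)
    thus ?thesis using x00 by (simp add: poly_pcompose)
  qed
  have f1: "dickson_form W1 (c * (x0 / 2) ^ 2) (c * (x0 / 2) ^ 2 * 2 + e) 4 K"
    unfolding dickson_form_def
  proof (intro conjI)
    show "c * (x0 / 2) ^ 2 \<noteq> 0" using 1(1) x00 by simp
    show "W1 = smult (c * (x0 / 2) ^ 2) (dickson 4 \<circ>\<^sub>p K) + [:c * (x0 / 2) ^ 2 * 2 + e:]"
    proof (rule poly_eq_poly_eq_iff[THEN iffD1, OF ext])
      fix t
      have "poly W1 t = c * (poly Y t) ^ 2 + e" by (simp add: 1(3) n2)
      also have "\<dots> = c * (x0 / 2) ^ 2 * (poly (dickson 2) (poly K t)) ^ 2 + e"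
        unfolding val by (simp add: power2_eq_square)
      also have "(poly (dickson 2) (poly K t)) ^ 2 = poly (dickson 4) (poly K t) + 2"
        using dickson_double[of 2] by simp
      finally show "poly W1 t = poly (smult (c * (x0 / 2) ^ 2) (dickson 4 \<circ>\<^sub>p K) + [:c * (x0 / 2) ^ 2 * 2 + e:]) t"
        by (simp add: poly_pcompose distrib_left)
    qed
  qed (rule dK)
  have Uval: "poly U y = s * poly (dickson k) (2 / x0 * y)" for y
  proof -
    have "poly (U \<circ>\<^sub>p [:0, x0 / 2:]) (2 / x0 * y) = poly (smult s (dickson k)) (2 / x0 * y)" by (simp only: s(2))
    thus ?thesis using x00 by (simp add: poly_pcompose)
  qed
  have f3: "dickson_form W3 (- s) f (2 * k) K"
    unfolding dickson_form_def
  proof (intro conjI)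
    show "- s \<noteq> 0" using s by simp
    show "W3 = smult (- s) (dickson (2 * k) \<circ>\<^sub>p K) + [:f:]"
    proof (rule poly_eq_poly_eq_iff[THEN iffD1, OF ext])
      fix t
      have "poly W3 t = s * poly (dickson k) (2 / x0 * poly Y t) + f" by (simp add: 1(4) poly_pcompose Uval)
      also have "2 / x0 * poly Y t = - poly (dickson 2) (poly K t)" using x00 by (simp add: val)
      also have "poly (dickson k) (- poly (dickson 2) (poly K t)) = - poly (dickson k \<circ>\<^sub>p dickson 2) (poly K t)"
        using kodd by (simp add: poly_dickson_neg poly_pcompose)
      finally show "poly W3 t = poly (smult (- s) (dickson (2 * k) \<circ>\<^sub>p K) + [:f:]) t"
        by (simp add: dickson_pcompose poly_pcompose)
    qed
  qed (rule dK)
  have "odd (degree U')" using 2(5) n2 by simp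
  thus ?thesis using kodd k(3) f1 f3 2(13,14) n2 by blast
qed

text \<open>The path gives \<open>W1\<close> and \<open>W3\<close> the even Dickson indices 4 and
  \<open>2 * k\<close> over one \<open>K\<close>. A Dickson pair \<open>W1\<close>,
  \<open>W2\<close> then falls to \<open>common_dickson\<close>; \<open>W2\<close> before
  \<open>W1\<close> contradicts the degrees; \<open>W1\<close> before \<open>W2\<close> yields
  \<open>degree U * 2 = k' * k\<close> with an odd right-hand side.\<close>

lemma (in closed_factors) no_path:
  assumes "cyclic_type \<alpha> \<beta> W1 W3" "cyclic_type \<alpha> \<beta> W3 W2" "indep W1 W2" "indep W1 W3" "indep W2 W3"
  shows False
proof -
  have M: "W1 \<in> M" "W2 \<in> M" "W3 \<in> M" using assms by (auto simp: indep_def)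
  have d: "degree W1 > 0" "degree W2 > 0" "degree W3 > 0" using MD(1) M by blast+
  obtain K k a1 b1 a3 b3 E k' where p: "odd k" "k \<ge> 3" "dickson_form W1 a1 b1 4 K" "dickson_form W3 a3 b3 (2 * k) K"
    "odd k'" "degree W3 = 2 * E" "degree W2 = k' * E"
    using path_structure[OF assms(1,2) d(1)] by blast
  show False using pair_classification[OF assms(3)]
  proof (elim disjE)
    assume "dickson_type W1 W2"
    then obtain Z p q a b a' b' where 1: "p \<ge> 3" "dickson_form W1 a b p Z" "dickson_form W2 a' b' q Z"
      unfolding dickson_type_def by blast
    show False by (rule common_dickson[OF 1(2) p(3) 1(1) _ 1(3) p(4) assms(3-5)]) simp
  next
    assume "cyclic_type \<alpha> \<beta> W2 W1"
    thus False using cyclic_type_degree_less assms(1,2) d by (meson less_asym less_trans)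
  next
    assume "cyclic_type \<alpha> \<beta> W1 W2"
    from this d(1) obtain c n Y e U f where 1: "c \<noteq> 0" "n \<ge> 2" "W1 = smult c (Y ^ n) + [:e:]" "W2 = U \<circ>\<^sub>p Y + [:f:]"
    "coprime n (degree U)" "\<forall>\<epsilon> z. \<epsilon> ^ n = 1 \<longrightarrow> poly U (\<epsilon> * z) = \<epsilon> ^ degree U * poly U z"
    "poly U (poly Y \<alpha>) = 0" "poly U (poly Y \<beta>) = 0" "poly Y \<alpha> \<noteq> 0" "poly Y \<alpha> \<noteq> poly Y \<beta>" "poly U 0 = 0"
    "degree Y > 0" "degree W1 = n * degree Y" "degree W2 = degree U * degree Y" "degree U > n"
      by (rule cyclic_typeE)
    have n2: "n = 2" using power_dickson_form[OF p(3) _ 1(3,1,2)] by simp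
    have dW: "degree W1 = 4 * degree K" "degree W3 = 2 * k * degree K" using dickson_form_degree p(3,4) by blast+
    have Y: "degree Y = 2 * degree K" and E: "E = k * degree K" using dW 1(13) n2 p(6) by auto
    have "degree U * degree Y = k' * E" using 1(14) p(7) by (rule trans[OF sym])
    hence "(degree U * 2) * degree K = (k' * k) * degree K" unfolding Y E mult.assoc .
    moreover have "degree K > 0" using p(3) by (simp add: dickson_form_def)
    ultimately have "degree U * 2 = k' * k" by (metis mult_cancel2 less_irrefl)
    thus False using p(1,5) by (metis dvd_triv_right even_mult_iff)
  qed
qed

section \<open>Excluding two power positions with the same source\<close>

lemma right_factor_of_dvd:
  fixes Q :: "complex poly"
  assumes "Q = A \<circ>\<^sub>p X" "Q = B \<circ>\<^sub>p V" "degree Q > 0" "degree X dvd degree V"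
  shows "\<exists>v. V = v \<circ>\<^sub>p X"
proof -
  obtain G P P' where G: "degree G = gcd (degree X) (degree V)" "X = P \<circ>\<^sub>p G" "V = P' \<circ>\<^sub>p G"
    using gcd_right_factor[OF assms(1-3)] by blast
  have dX: "degree X > 0" using assms(1,3) by (auto simp: degree_pcompose)
  have "degree G = degree X" using G(1) assms(4) by (simp add: gcd_nat.absorb1)
  hence "degree P = 1" using G(2) dX degree_pcompose[of P G] by simp
  then obtain I where I: "I \<circ>\<^sub>p P = [:0, 1:]" using degree_1_inverse by blast
  have "I \<circ>\<^sub>p X = G" using G(2) I by (simp add: pcompose_assoc pcompose_X)
  hence "V = (P' \<circ>\<^sub>p I) \<circ>\<^sub>p X" using G(3) by (simp add: pcompose_assoc[symmetric])
  thus ?thesis by blast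
qed

lemma power_center_unique:
  fixes Y Y' :: "complex poly"
  assumes "W = smult c (Y ^ n) + [:e:]" "W = smult c' (Y' ^ n') + [:e':]"
    and "c \<noteq> 0" "c' \<noteq> 0" "n \<ge> 2" "n' \<ge> 2" "degree W > 0"
  shows "e = e'"
proof (rule ccontr)
  assume "e \<noteq> e'"
  have half: "2 * card {t. poly W t = e} \<le> degree W"
    if W: "W = smult c (Y ^ n) + [:e:]" "c \<noteq> 0" "n \<ge> 2" for c Y n e
  proof -
    have Y: "Y \<noteq> 0" using W assms(7) by (auto simp: power_0_left)
    have "{t. poly W t = e} = {t. poly Y t = 0}" using W by auto
    hence "card {t. poly W t = e} \<le> degree Y" using card_poly_roots_bound[OF Y] by simp
    moreover have "degree W = n * degree Y" unfolding W(1) degree_add_const using W(2) Y by (simp add: degree_power_eq)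
    moreover have "2 * degree Y \<le> n * degree Y" using W(3) by (rule mult_le_mono1)
    ultimately show ?thesis by linarith
  qed
  have "2 * degree W + 1 \<le> card {t. poly W t = e} + card {t. poly W t = e'} + degree W"
    using sum_card_fibers_ge[OF assms(7), of "{e, e'}"] \<open>e \<noteq> e'\<close> by simp
  thus False using half[OF assms(1,3,5)] half[OF assms(2,4,6)] by linarith
qed

text \<open>The orders satisfy \<open>\<nu> * order t Y = \<nu>' * order t Y'\<close>; by
  coprimality they are multiples of \<open>\<nu>'\<close> and \<open>\<nu>\<close> with one common
  quotient, the order of \<open>X\<close>.\<close>

lemma common_power_root:
  fixes Y Y' :: "complex poly"
  assumes "smult c (Y ^ (g * \<nu>)) = smult c' (Y' ^ (g * \<nu>'))" "c \<noteq> 0" "c' \<noteq> 0" "Y \<noteq> 0" "Y' \<noteq> 0"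
    and "coprime \<nu> \<nu>'" "g > 0" "\<nu> > 0" "\<nu>' > 0"
  shows "\<exists>X \<kappa> \<kappa>'. \<kappa> \<noteq> 0 \<and> \<kappa>' \<noteq> 0 \<and> Y = smult \<kappa> (X ^ \<nu>') \<and> Y' = smult \<kappa>' (X ^ \<nu>)"
proof -
  have o: "\<nu> * order t Y = \<nu>' * order t Y'" for t
  proof -
    have "order t (smult c (Y ^ (g * \<nu>))) = order t (smult c' (Y' ^ (g * \<nu>')))" by (simp only: assms(1))
    hence "(g * \<nu>) * order t Y = (g * \<nu>') * order t Y'"
      unfolding order_smult_power[OF assms(2,4)] order_smult_power[OF assms(3,5)] .
    hence "g * (\<nu> * order t Y) = g * (\<nu>' * order t Y')" by (simp only: mult.assoc)
    thus ?thesis using assms(7) by simp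
  qed
  define k where "k t = order t Y div \<nu>'" for t
  have k1: "order t Y = k t * \<nu>'" for t
  proof -
    have "\<nu>' dvd \<nu> * order t Y" unfolding o by simp
    hence "\<nu>' dvd order t Y" using assms(6) by (simp add: coprime_dvd_mult_right_iff coprime_commute)
    thus ?thesis by (simp add: k_def)
  qed
  have k2: "order t Y' = k t * \<nu>" for t
  proof -
    have "\<nu>' * order t Y' = \<nu>' * (k t * \<nu>)" using o[of t] unfolding k1[of t] by (simp only: mult_ac)
    thus ?thesis using assms(9) by (metis mult_left_cancel less_irrefl)
  qed
  have rt: "poly F t = 0 \<longleftrightarrow> order t F \<noteq> 0" if "F \<noteq> 0" for F :: "complex poly" and t
    using that order_root[of F t] by auto
  have T: "{t. poly Y t = 0} = {t. k t \<noteq> 0}" "{t. poly Y' t = 0} = {t. k t \<noteq> 0}"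
    using rt[OF assms(4)] rt[OF assms(5)] k1 k2 assms(8,9) by auto
  define X where "X = (\<Prod>t | k t \<noteq> 0. [:-t, 1:] ^ k t)"
  have "Y = smult (lead_coeff Y) (X ^ \<nu>')"
    using complex_poly_decompose[of Y] unfolding T k1 power_mult X_def prod_power_distrib by simp
  moreover have "Y' = smult (lead_coeff Y') (X ^ \<nu>)"
    using complex_poly_decompose[of Y'] unfolding T k2 power_mult X_def prod_power_distrib by simp
  moreover have "lead_coeff Y \<noteq> 0" "lead_coeff Y' \<noteq> 0" using assms(4,5) by simp_all
  ultimately show ?thesis by blast
qed

lemma odd_part_pell_base: "odd_part [:-4, 0, 1:] = [:-4, 0, 1:]"
proof -
  have eq: "[:-4, 0, 1:] = ([:0, 1:] - [:2:]) * ([:0, 1:] - [:-2 :: complex:])" by simp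
  have pz: "poly [:-4, 0, 1 :: complex:] t = 0 \<longleftrightarrow> t = 2 \<or> t = -2" for t
  proof -
    have "poly [:-4, 0, 1 :: complex:] t = (t - 2) * (t + 2)" by (simp add: algebra_simps)
    thus ?thesis by (simp only: mult_eq_0_iff eq_neg_iff_add_eq_0 right_minus_eq)
  qed
  have r: "ramif [:0, 1:] t = 1" for t
    using order_power_n_n[of t 1] by (simp add: ramif_def)
  have o: "order t [:-4, 0, 1:] = (if t \<in> {2, -2} then 1 else 0)" for t :: complex
    unfolding eq by (subst order_fiber_product) (auto simp: r)
  have "{t. poly [:-4, 0, 1:] t = 0 \<and> odd (order t [:-4, 0, 1 :: complex:])} = {2, -2}"
    unfolding o using pz by (auto split: if_splits)
  thus ?thesis unfolding odd_part_def by simp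
qed

text \<open>The rotated \<open>v\<close> is a right factor of the same degree of the same
  polynomial, hence an affine function \<open>\<mu>\<close> of \<open>v\<close>, and
  \<open>P \<circ>\<^sub>p \<mu> = smult \<omega> P\<close>. Uniqueness of the exceptional values
  fixes \<open>b - f\<close> and makes \<open>\<omega>\<close> a sign; comparing odd parts then
  makes \<open>\<mu>\<close> the identity up to sign.\<close>

lemma rotated_dickson:
  fixes v U :: "complex poly"
  assumes eq: "smult a (dickson p) \<circ>\<^sub>p v + [:b:] = U + [:f:]" and rot: "\<And>z. poly U (\<eta> * z) = \<omega> * poly U z"
    and nz: "a \<noteq> 0" "\<eta> \<noteq> 0" "\<omega> \<noteq> 0" and p: "p \<ge> 3" and dv: "degree v > 0"
  shows "\<exists>s. (s = 1 \<or> s = -1) \<and> v \<circ>\<^sub>p [:0, \<eta>:] = smult s v \<and> \<omega> * (b - f) = b - f"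
proof -
  define P where "P = smult a (dickson p) + [:b - f:]"
  define v' where "v' = v \<circ>\<^sub>p [:0, \<eta>:]"
  have "U = smult a (dickson p) \<circ>\<^sub>p v + [:b:] - [:f:]" using eq by simp
  hence U: "U = P \<circ>\<^sub>p v" by (simp add: P_def pcompose_add)
  have comp: "P \<circ>\<^sub>p v' = smult \<omega> P \<circ>\<^sub>p v"
  proof (rule poly_eq_poly_eq_iff[THEN iffD1, OF ext])
    fix z show "poly (P \<circ>\<^sub>p v') z = poly (smult \<omega> P \<circ>\<^sub>p v) z"
      using rot[of z] by (simp add: U v'_def poly_pcompose mult.commute)
  qed
  have dP: "degree P = p" unfolding P_def degree_add_const using nz by (simp add: degree_dickson)
  have dv': "degree v' = degree v" using nz by (simp add: v'_def degree_pcompose)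
  have "degree (P \<circ>\<^sub>p v') > 0" using dP dv' dv p by (simp add: degree_pcompose)
  then obtain \<mu> where mu: "v' = \<mu> \<circ>\<^sub>p v" using right_factor_of_dvd[OF comp refl] dv' by auto
  have dmu: "degree \<mu> = 1" using mu dv dv' by (simp add: degree_pcompose)
  have "P \<circ>\<^sub>p \<mu> \<circ>\<^sub>p v = smult \<omega> P \<circ>\<^sub>p v" using comp by (simp add: mu pcompose_assoc)
  hence Pmu: "P \<circ>\<^sub>p \<mu> = smult \<omega> P" using dv by (rule pcompose_cancel_right)
  have "dickson_form (P \<circ>\<^sub>p \<mu>) a (b - f) p \<mu>"
    using nz dmu by (simp add: dickson_form_def P_def pcompose_add pcompose_smult)
  moreover have "dickson_form (P \<circ>\<^sub>p \<mu>) (\<omega> * a) (\<omega> * (b - f)) p [:0, 1:]"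
    using nz unfolding Pmu by (simp add: dickson_form_def P_def smult_add_right)
  ultimately have crit: "b - f = \<omega> * (b - f)" "\<omega> * a = a \<or> \<omega> * a = - a"
    using critical_pair_unique p by blast+
  have "smult a (dickson p \<circ>\<^sub>p \<mu>) + [:b - f:] = smult (\<omega> * a) (dickson p) + [:\<omega> * (b - f):]"
    using Pmu by (simp add: P_def pcompose_add pcompose_smult smult_add_right)
  hence "smult a (dickson p \<circ>\<^sub>p \<mu>) = smult (\<omega> * a) (dickson p)"
    unfolding crit(1)[symmetric] by simp
  hence "smult (1 / a) (smult a (dickson p \<circ>\<^sub>p \<mu>)) = smult (1 / a) (smult (\<omega> * a) (dickson p))" by simp
  moreover have "\<omega> = 1 \<or> \<omega> = -1" using crit(2) nz(1) by (metis minus_mult_left mult_cancel_right mult_1)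
  ultimately have "dickson p \<circ>\<^sub>p \<mu> = dickson p \<or> dickson p \<circ>\<^sub>p \<mu> = - dickson p" using nz(1) by auto
  hence sq: "(dickson p \<circ>\<^sub>p \<mu>) ^ 2 = dickson p ^ 2" by auto
  have "pell (\<mu> ^ 2 - 4) \<mu>" unfolding pell_def by (intro exI[of _ 1]) simp
  have "pell [:-4, 0, 1:] (dickson p)" unfolding pell_def using dickson_pell by blast
  hence "odd_part (dickson p ^ 2 - 4) = [:-4, 0, 1:]"
    using pell_odd_part(1) p odd_part_pell_base by (metis degree_dickson less_le_trans zero_less_numeral)
  moreover have "odd_part ((dickson p \<circ>\<^sub>p \<mu>) ^ 2 - 4) = odd_part (\<mu> ^ 2 - 4)"
    using dmu p by (intro pell_odd_part(1) pell_dickson \<open>pell (\<mu> ^ 2 - 4) \<mu>\<close>) (simp add: degree_pcompose degree_dickson)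
  ultimately have "odd_part (\<mu> ^ 2 - 4) = [:-4, 0, 1:]" using sq by simp
  hence "pell [:-4, 0, 1:] \<mu>" using pell_odd_part(2)[OF \<open>pell (\<mu> ^ 2 - 4) \<mu>\<close>] dmu by simp
  then obtain s where s: "s = 1 \<or> s = -1" "\<mu> = smult s (dickson 1)" using dickson_of_pell dmu by metis
  have "v' = smult s v" unfolding mu s(2) by (simp add: pcompose_pCons)
  thus ?thesis using s(1) crit(1) by (auto simp: v'_def)
qed

text \<open>With \<open>z = w + 1/w\<close>, a zero of an odd \<open>dickson k\<close> satisfies
  \<open>(- (w ^ 2)) ^ k = 1\<close>; two coprime indices leave \<open>w ^ 2 = -1\<close>.\<close>

lemma odd_dickson_common_root:
  assumes "odd p" "odd q" "coprime p q" "poly (dickson p) z = 0" "poly (dickson q) z = 0"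
  shows "z = 0"
proof -
  obtain w u where w: "w * u = 1" "z = w + u" using joukowsky_surj by blast
  have *: "(- (w ^ 2)) ^ k = 1" if "odd k" "poly (dickson k) z = 0" for k
  proof -
    have "w ^ k * (w ^ k + u ^ k) = 0" using that poly_dickson[OF w(1), of k] w(2) by simp
    moreover have "w ^ k * u ^ k = 1" using w(1) by (simp flip: power_mult_distrib)
    ultimately have "w ^ k * w ^ k = -1" by (simp add: distrib_left eq_neg_iff_add_eq_0)
    moreover have "(- (w ^ 2)) ^ k = - (w ^ k * w ^ k)"
      using that(1) by (simp add: power2_eq_square power_mult_distrib)
    ultimately show ?thesis by simp
  qed
  have "(- (w ^ 2)) ^ gcd p q = 1" using root_of_unity_gcd *[OF assms(1,4)] *[OF assms(2,5)] by blast
  hence "- (w ^ 2) = 1" using assms(3) by simp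
  hence "w ^ 2 = -1" by (metis minus_minus)
  hence "w * z = 0" using w by (simp add: power2_eq_square distrib_left)
  moreover have "w \<noteq> 0" using w(1) by auto
  ultimately show ?thesis by simp
qed

lemma rotation_arith:
  fixes p q D k k' G \<nu> \<nu>' :: nat
  assumes "p * D = k * \<nu>'" "q * D = k' * \<nu>" "coprime (G * \<nu>) k" "coprime (G * \<nu>') k'" "coprime \<nu> \<nu>'"
  shows "coprime D (G * \<nu> * \<nu>')"
proof -
  have G: "coprime G k" "coprime \<nu> k" "coprime G k'" "coprime \<nu>' k'" using assms(3,4) by simp_all
  have dv: "c dvd k * \<nu>'" "c dvd k' * \<nu>" if "c dvd D" for c
    using that assms(1,2) by (metis dvd_mult)+
  have cd: "coprime c y" if "c dvd x" "coprime x y" for c x y :: nat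
    using that coprime_divisors dvd_refl by blast
  have 1: "coprime D \<nu>"
  proof (rule coprimeI)
    fix c assume c: "c dvd D" "c dvd \<nu>"
    have "coprime c (k * \<nu>')" using cd[OF c(2) G(2)] cd[OF c(2) assms(5)] by simp
    thus "is_unit c" using dv(1)[OF c(1)] coprime_absorb_left by blast
  qed
  have 2: "coprime D \<nu>'"
  proof (rule coprimeI)
    fix c assume c: "c dvd D" "c dvd \<nu>'"
    have "coprime c (k' * \<nu>)" using cd[OF c(2) G(4)] cd[OF c(2), of \<nu>] assms(5) by (simp add: coprime_commute)
    thus "is_unit c" using dv(2)[OF c(1)] coprime_absorb_left by blast
  qed
  have 3: "coprime D G"
  proof (rule coprimeI)
    fix c assume c: "c dvd D" "c dvd G"
    have "c dvd \<nu>'" using dv(1)[OF c(1)] cd[OF c(2) G(1)] by (simp add: coprime_dvd_mult_right_iff)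
    thus "is_unit c" using 2 c(1) coprime_common_divisor by blast
  qed
  show ?thesis using 1 2 3 by simp
qed

context closed_factors
begin

text \<open>By \<open>no_path\<close>, \<open>W2\<close> and \<open>W3\<close> form a Dickson pair
  over some \<open>V\<close>. Being a power in two ways, \<open>W1\<close> yields a common root
  \<open>X\<close> of \<open>Y\<close> and \<open>Y'\<close>, and
  \<open>V = v \<circ>\<^sub>p X\<close>. The rotation symmetries of both targets pass to
  \<open>v\<close> up to sign, which leaves only rotations of order at most 2; then \<open>V\<close>
  vanishes at both points.\<close>

lemma no_out:
  assumes "cyclic_type \<alpha> \<beta> W1 W2" "cyclic_type \<alpha> \<beta> W1 W3" "indep W1 W2" "indep W1 W3" "indep W2 W3"
  shows False
proof -
  have M: "W1 \<in> M" "W2 \<in> M" "W3 \<in> M" using assms by (auto simp: indep_def)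
  have d: "degree W1 > 0" "degree W2 > 0" "degree W3 > 0" using MD(1) M by blast+
  have "\<not> cyclic_type \<alpha> \<beta> W2 W3" using no_path[OF assms(1) _ assms(4,3) indep_sym[OF assms(5)]] by blast
  moreover have "\<not> cyclic_type \<alpha> \<beta> W3 W2" using no_path[OF assms(2) _ assms(3,4,5)] by blast
  ultimately have "dickson_type W2 W3" using pair_classification[OF assms(5)] by blast
  then obtain V p q a2 b2 a3 b3 where V: "p \<ge> 3" "q \<ge> 3" "coprime p q"
    "dickson_form W2 a2 b2 p V" "dickson_form W3 a3 b3 q V" unfolding dickson_type_def by blast
  from assms(1) d(1) obtain c n Y e U f where 1: "c \<noteq> 0" "n \<ge> 2" "W1 = smult c (Y ^ n) + [:e:]" "W2 = U \<circ>\<^sub>p Y + [:f:]"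
    "coprime n (degree U)" "\<forall>\<epsilon> z. \<epsilon> ^ n = 1 \<longrightarrow> poly U (\<epsilon> * z) = \<epsilon> ^ degree U * poly U z"
    "poly U (poly Y \<alpha>) = 0" "poly U (poly Y \<beta>) = 0" "poly Y \<alpha> \<noteq> 0" "poly Y \<alpha> \<noteq> poly Y \<beta>" "poly U 0 = 0"
    "degree Y > 0" "degree W1 = n * degree Y" "degree W2 = degree U * degree Y" "degree U > n"
    by (rule cyclic_typeE)
  from assms(2) d(1) obtain c' n' Y' e' U' f' where 2: "c' \<noteq> 0" "n' \<ge> 2" "W1 = smult c' (Y' ^ n') + [:e':]" "W3 = U' \<circ>\<^sub>p Y' + [:f':]"
    "coprime n' (degree U')" "\<forall>\<epsilon> z. \<epsilon> ^ n' = 1 \<longrightarrow> poly U' (\<epsilon> * z) = \<epsilon> ^ degree U' * poly U' z"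
    "poly U' (poly Y' \<alpha>) = 0" "poly U' (poly Y' \<beta>) = 0" "poly Y' \<alpha> \<noteq> 0" "poly Y' \<alpha> \<noteq> poly Y' \<beta>" "poly U' 0 = 0"
    "degree Y' > 0" "degree W1 = n' * degree Y'" "degree W3 = degree U' * degree Y'" "degree U' > n'"
    by (rule cyclic_typeE)
  define k k' where "k = degree U" and "k' = degree U'"
  have "e = e'" using power_center_unique[OF 1(3) 2(3) 1(1) 2(1) 1(2) 2(2) d(1)] .
  hence pw: "smult c (Y ^ n) = smult c' (Y' ^ n')" using 1(3) 2(3) by (metis add_right_cancel)
  define G where "G = gcd n n'"
  have "G \<noteq> 0" using 1(2) by (simp add: G_def)
  then obtain \<nu> \<nu>' where "n = \<nu> * G" "n' = \<nu>' * G" "coprime \<nu> \<nu>'"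
    using gcd_coprime_exists[of n n'] unfolding G_def by blast
  hence n: "n = G * \<nu>" "n' = G * \<nu>'" "coprime \<nu> \<nu>'" by simp_all
  have pos: "G > 0" "\<nu> > 0" "\<nu>' > 0" using n 1(2) 2(2) by (auto intro!: gr0I)
  have "Y \<noteq> 0" "Y' \<noteq> 0" using 1(12) 2(12) by auto
  then obtain X \<kappa> \<kappa>' where X: "\<kappa> \<noteq> 0" "\<kappa>' \<noteq> 0" "Y = smult \<kappa> (X ^ \<nu>')" "Y' = smult \<kappa>' (X ^ \<nu>)"
    using common_power_root[OF pw[unfolded n(1,2)] 1(1) 2(1) _ _ n(3) pos] by blast
  have dX: "degree X > 0" using 1(12) X(1,3) degree_power_le[of X \<nu>'] by (intro gr0I) simp
  hence "X \<noteq> 0" by auto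
  hence dY: "degree Y = \<nu>' * degree X" "degree Y' = \<nu> * degree X" using X by (simp_all add: degree_power_eq)
  define u u' where "u = U \<circ>\<^sub>p monom \<kappa> \<nu>'" and "u' = U' \<circ>\<^sub>p monom \<kappa>' \<nu>"
  have uX: "u \<circ>\<^sub>p X = U \<circ>\<^sub>p Y" "u' \<circ>\<^sub>p X = U' \<circ>\<^sub>p Y'"
    by (simp_all add: u_def u'_def X(3,4) pcompose_monom flip: pcompose_assoc)
  have Wd: "p * degree V = (k * \<nu>') * degree X" "q * degree V = (k' * \<nu>) * degree X"
    using dickson_form_degree[OF V(4)] dickson_form_degree[OF V(5)] 1(14) 2(14) dY by (simp_all add: k_def k'_def mult_ac)
  have "degree X dvd gcd (p * degree V) (q * degree V)" unfolding Wd by simp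
  also have "gcd (p * degree V) (q * degree V) = degree V"
    using V(3) by (metis coprime_iff_gcd_eq_1 gcd_mult_distrib_nat mult.commute mult_1)
  finally have dvd: "degree X dvd degree V" .
  have W2V: "W2 = (smult a2 (dickson p) + [:b2:]) \<circ>\<^sub>p V" "W3 = (smult a3 (dickson q) + [:b3:]) \<circ>\<^sub>p V"
    using V(4,5) by (auto simp: dickson_form_def pcompose_add pcompose_smult)
  have W2X: "W2 = (u + [:f:]) \<circ>\<^sub>p X" "W3 = (u' + [:f':]) \<circ>\<^sub>p X" using 1(4) 2(4) uX by (simp_all add: pcompose_add)
  obtain v where v: "V = v \<circ>\<^sub>p X" using right_factor_of_dvd[OF W2X(1) W2V(1) d(2) dvd] by blast
  define D where "D = degree v"
  have dV: "degree V = D * degree X" by (simp add: v D_def degree_pcompose)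
  have "degree V > 0" using V(4) by (simp add: dickson_form_def)
  hence dv: "degree v > 0" using dV by (auto simp: D_def intro!: gr0I)
  have "(p * D) * degree X = (k * \<nu>') * degree X" "(q * D) * degree X = (k' * \<nu>) * degree X"
    using Wd dV by (simp_all add: mult.assoc)
  hence pD: "p * D = k * \<nu>'" "q * D = k' * \<nu>" using dX by (metis mult_cancel2 less_irrefl)+
  have id: "smult a2 (dickson p) \<circ>\<^sub>p v + [:b2:] = u + [:f:]" "smult a3 (dickson q) \<circ>\<^sub>p v + [:b3:] = u' + [:f':]"
  proof -
    have "((smult a2 (dickson p) + [:b2:]) \<circ>\<^sub>p v) \<circ>\<^sub>p X = (u + [:f:]) \<circ>\<^sub>p X"
      using W2V(1) W2X(1) by (simp add: v pcompose_assoc)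
    from pcompose_cancel_right[OF this dX] show "smult a2 (dickson p) \<circ>\<^sub>p v + [:b2:] = u + [:f:]"
      by (simp add: pcompose_add)
    have "((smult a3 (dickson q) + [:b3:]) \<circ>\<^sub>p v) \<circ>\<^sub>p X = (u' + [:f':]) \<circ>\<^sub>p X"
      using W2V(2) W2X(2) by (simp add: v pcompose_assoc)
    from pcompose_cancel_right[OF this dX] show "smult a3 (dickson q) \<circ>\<^sub>p v + [:b3:] = u' + [:f':]"
      by (simp add: pcompose_add)
  qed
  \<comment> \<open>This is \<open>lcm n n'\<close>: raising an \<open>N\<close>-th root of unity to
    the power \<open>\<nu>'\<close> or \<open>\<nu>\<close> gives an \<open>n\<close>-th or
    \<open>n'\<close>-th root of unity.\<close>
  define N where "N = G * \<nu> * \<nu>'"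
  have rot: "poly u (\<eta> * z) = (\<eta> ^ \<nu>') ^ k * poly u z" "poly u' (\<eta> * z) = (\<eta> ^ \<nu>) ^ k' * poly u' z"
    if "\<eta> ^ N = 1" for \<eta> z
  proof -
    have "(\<eta> ^ \<nu>') ^ n = 1" "(\<eta> ^ \<nu>) ^ n' = 1"
      using that by (simp_all add: N_def n flip: power_mult) (simp_all add: mult_ac)
    thus "poly u (\<eta> * z) = (\<eta> ^ \<nu>') ^ k * poly u z" "poly u' (\<eta> * z) = (\<eta> ^ \<nu>) ^ k' * poly u' z"
      using 1(6)[rule_format, of "\<eta> ^ \<nu>'" "\<kappa> * z ^ \<nu>'"] 2(6)[rule_format, of "\<eta> ^ \<nu>" "\<kappa>' * z ^ \<nu>"]
      by (simp_all add: u_def u'_def k_def k'_def poly_pcompose poly_monom power_mult_distrib mult.left_commute)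
  qed
  have Npos: "N > 0" using pos by (simp add: N_def)
  have nz: "a2 \<noteq> 0" "a3 \<noteq> 0" using V by (auto simp: dickson_form_def)
  have R: "\<exists>s. (s = 1 \<or> s = -1) \<and> v \<circ>\<^sub>p [:0, \<eta>:] = smult s v \<and> (\<eta> ^ \<nu>') ^ k * (b2 - f) = b2 - f"
    "\<exists>s. (s = 1 \<or> s = -1) \<and> v \<circ>\<^sub>p [:0, \<eta>:] = smult s v \<and> (\<eta> ^ \<nu>) ^ k' * (b3 - f') = b3 - f'"
    if "\<eta> ^ N = 1" for \<eta>
  proof -
    have e0: "\<eta> \<noteq> 0" using that Npos by (auto simp: power_0_left)
    show "\<exists>s. (s = 1 \<or> s = -1) \<and> v \<circ>\<^sub>p [:0, \<eta>:] = smult s v \<and> (\<eta> ^ \<nu>') ^ k * (b2 - f) = b2 - f"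
      using rotated_dickson[OF id(1) rot(1)[OF that] nz(1) e0 _ V(1) dv] e0 by simp
    show "\<exists>s. (s = 1 \<or> s = -1) \<and> v \<circ>\<^sub>p [:0, \<eta>:] = smult s v \<and> (\<eta> ^ \<nu>) ^ k' * (b3 - f') = b3 - f'"
      using rotated_dickson[OF id(2) rot(2)[OF that] nz(2) e0 _ V(2) dv] e0 by simp
  qed
  have lead: "\<eta> ^ D = s" if "v \<circ>\<^sub>p [:0, \<eta>:] = smult s v" for \<eta> s
  proof -
    have "coeff (v \<circ>\<^sub>p [:0, \<eta>:]) D = coeff (smult s v) D" by (simp only: that)
    thus ?thesis using dv by (simp add: coeff_pcompose_linear D_def) (metis degree_0 leading_coeff_0_iff less_irrefl)
  qed
  \<comment> \<open>Rotation multiplies the leading coefficient of \<open>v\<close> by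
    \<open>\<eta> ^ D\<close>, which is a sign. With \<open>D\<close> prime to \<open>N\<close> this
    forces \<open>\<eta> ^ 2 = 1\<close>, hence \<open>N \<le> 2\<close>.\<close>
  have cop: "coprime D N" unfolding N_def
    by (rule rotation_arith[OF pD _ _ n(3)]) (use 1(5) 2(5) n in \<open>simp_all add: k_def k'_def\<close>)
  have "{\<eta> :: complex. \<eta> ^ N = 1} \<subseteq> {\<eta>. \<eta> ^ 2 = 1}"
  proof
    fix \<eta> :: complex assume "\<eta> \<in> {\<eta>. \<eta> ^ N = 1}"
    hence e: "\<eta> ^ N = 1" by simp
    then obtain s where "s = 1 \<or> s = -1" "\<eta> ^ D = s" using R(1) lead by blast
    hence "(\<eta> ^ D) ^ 2 = 1" by auto
    hence "\<eta> ^ (2 * D) = 1" by (simp add: mult.commute flip: power_mult)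
    hence "\<eta> ^ gcd N (2 * D) = 1" using e root_of_unity_gcd by blast
    moreover have "gcd N (2 * D) dvd 2"
      using cop by (metis coprime_commute coprime_divisors coprime_dvd_mult_left_iff dvd_refl gcd_dvd1 gcd_dvd2)
    ultimately have "\<eta> ^ 2 = 1" by (metis dvdE power_mult power_one)
    thus "\<eta> \<in> {\<eta>. \<eta> ^ 2 = 1}" by simp
  qed
  hence "card {\<eta> :: complex. \<eta> ^ N = 1} \<le> card {\<eta> :: complex. \<eta> ^ 2 = 1}"
    by (intro card_mono finite_nth_roots) auto
  hence N2: "N \<le> 2" using card_roots_unity_eq[of N] card_roots_unity_eq[of 2] Npos by simp
  have "n * \<nu>' \<le> 2" "n' * \<nu> \<le> 2" using N2 n by (simp_all add: N_def mult_ac)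
  moreover have "2 * \<nu>' \<le> n * \<nu>'" "2 * \<nu> \<le> n' * \<nu>" using 1(2) 2(2) by (simp_all add: mult_le_mono1)
  ultimately have nu: "\<nu> = 1" "\<nu>' = 1" using pos by linarith+
  hence n2: "n = 2" "n' = 2" using \<open>n * \<nu>' \<le> 2\<close> \<open>n' * \<nu> \<le> 2\<close> 1(2) 2(2) by simp_all
  have odd: "odd k" "odd k'" using 1(5) 2(5) n2 by (simp_all add: k_def k'_def)
  have pq: "odd p" "odd q" using pD odd nu by (metis even_mult_iff mult.right_neutral)+
  have N1: "(-1 :: complex) ^ N = 1" using n nu n2 by (simp add: N_def)
  \<comment> \<open>For \<open>\<eta> = -1\<close> the odd exponents \<open>k\<close> and
    \<open>k'\<close> turn the fixed-point equations into \<open>b2 - f = - (b2 - f)\<close> and its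
    analogue, so both Dickson polynomials vanish at the two points.\<close>
  have bf: "b2 = f" "b3 = f'"
    using R(1)[OF N1] R(2)[OF N1] odd nu by auto
  have W2v: "poly W2 \<alpha> = f" "poly W2 \<beta> = f" "poly W3 \<alpha> = f'" "poly W3 \<beta> = f'"
    using 1(4,7,8) 2(4,7,8) by (simp_all add: poly_pcompose)
  have "poly (dickson p) (poly V t) = 0" if "t = \<alpha> \<or> t = \<beta>" for t
    using dickson_form_poly[OF V(4), of t] W2v that bf nz by auto
  moreover have "poly (dickson q) (poly V t) = 0" if "t = \<alpha> \<or> t = \<beta>" for t
    using dickson_form_poly[OF V(5), of t] W2v that bf nz by auto
  ultimately have "poly V \<alpha> = 0" "poly V \<beta> = 0" using odd_dickson_common_root[OF pq V(3)] by blast+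
  hence "common_closed_factor \<alpha> \<beta> W2 W3" unfolding common_closed_factor_def using W2V by metis
  thus False using indepD assms(5) by blast
qed

end

section \<open>Triples of independent factors and the constant 90\<close>

lemma square_cofactor_square:
  fixes F H Y :: "complex poly"
  assumes "F * H ^ 2 = smult c (Y ^ 2)" "c \<noteq> 0" "F \<noteq> 0" "H \<noteq> 0"
  shows "\<exists>S. F = S ^ 2"
proof -
  have "F * H ^ 2 \<noteq> 0" using assms(3,4) by simp
  hence "Y \<noteq> 0" unfolding assms(1) by auto
  have "even (order t F)" for t
  proof -
    have "order t (F * H ^ 2) = order t (smult c (Y ^ 2))" by (simp only: assms(1))
    hence "order t F + 2 * order t H = 2 * order t Y"
      using assms(3,4) \<open>Y \<noteq> 0\<close> by (simp add: order_mult order_power order_smult_power[OF assms(2)])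
    thus ?thesis by presburger
  qed
  hence empty: "{t. poly F t = 0 \<and> odd (order t F)} = {}" by blast
  show ?thesis using odd_part_decomposition[OF assms(3)] unfolding empty by simp
qed

lemma smult_square_eq_smult_square:
  fixes X Y :: "complex poly"
  assumes "smult c (Y ^ 2) = smult a (X ^ 2)" "c \<noteq> 0" "a \<noteq> 0"
  shows "\<exists>r. r \<noteq> 0 \<and> Y = smult r X"
proof -
  obtain \<rho> where rho: "\<rho> ^ 2 = a / c" using complex_root_exists[of 2] by auto
  have "smult (1 / c) (smult c (Y ^ 2)) = smult (1 / c) (smult a (X ^ 2))" by (simp only: assms(1))
  hence "Y ^ 2 = smult (\<rho> ^ 2) (X ^ 2)" using assms(2) by (simp add: rho)
  hence "Y ^ 2 = (smult \<rho> X) ^ 2" by (simp add: smult_power)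
  hence "Y = smult \<rho> X \<or> Y = smult (- \<rho>) X" by (simp add: power2_eq_iff)
  moreover have "\<rho> \<noteq> 0" using rho assms(2,3) by auto
  ultimately show ?thesis by (metis neg_equal_0_iff_equal)
qed

text \<open>The degree equations give \<open>k1 = q * \<kappa>\<close> and
  \<open>k2 = p * \<kappa>\<close> with odd \<open>\<kappa>\<close>. If
  \<open>\<kappa> \<ge> 3\<close>, then \<open>2 * l = p * q * d * \<kappa> * j\<close> with
  \<open>p * q \<ge> 15\<close> and even \<open>d\<close> and \<open>j\<close>, so
  \<open>2 * l \<ge> 15 * 2 * 3 * 2 = 180\<close>.\<close>

lemma triple_arith:
  fixes p q d D1 D2 k1 k2 :: nat
  assumes "p \<ge> 3" "q \<ge> 3" "coprime p q" "odd k1" "odd k2" "d > 0"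
    and "p * d = 2 * D1" "q * d = 2 * D2" "k1 * D1 = k2 * D2"
  shows "odd p \<and> odd q \<and> (k1 = q \<and> k2 = p \<or> (\<forall>l>0. p * d dvd l \<and> k1 * D1 dvd l \<longrightarrow> 90 \<le> l))"
proof -
  have "k1 * (p * d) = k2 * (q * d)" using assms(7-9) by simp
  hence k: "k1 * p = k2 * q" using assms(6) by (simp add: mult.assoc[symmetric])
  have op: "odd p"
  proof
    assume "even p"
    moreover have "even q" using k assms(5) \<open>even p\<close> by (metis even_mult_iff)
    ultimately show False using assms(3) coprime_common_divisor[of p q 2] by simp
  qed
  have oq: "odd q" using k assms(3-5) op by (metis even_mult_iff)
  have "q dvd k1 * p" unfolding k by simp
  hence "q dvd k1" using assms(3) by (simp add: coprime_dvd_mult_left_iff coprime_commute)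
  then obtain \<kappa> where k1: "k1 = q * \<kappa>" by blast
  have k2: "k2 = p * \<kappa>"
  proof -
    have "q * k2 = q * (p * \<kappa>)" using k unfolding k1 by (simp only: mult_ac)
    thus ?thesis using assms(2) by (metis mult_left_cancel not_numeral_le_zero)
  qed
  have ok: "odd \<kappa>" using assms(4) k1 by simp
  have "90 \<le> l" if l: "\<kappa> \<noteq> 1" "l > 0" "p * d dvd l" "k1 * D1 dvd l" for l
  proof -
    have k3: "\<kappa> \<ge> 3" using ok l(1) by presburger
    obtain j where j: "l = k1 * D1 * j" using l(4) by blast
    obtain t where t: "l = p * d * t" using l(3) by blast
    have l2: "2 * l = p * d * (q * \<kappa> * j)" using j k1 assms(7) by (metis mult.assoc mult.commute)
    have "(p * d) * (2 * t) = (p * d) * (q * \<kappa> * j)" using l2 unfolding t by (simp only: mult_ac)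
    moreover have "p * d \<noteq> 0" using assms(1,6) by simp
    ultimately have "2 * t = q * \<kappa> * j" using mult_left_cancel by blast
    hence "even j" using oq ok by (metis dvd_triv_left even_mult_iff)
    moreover have "j > 0" using j l(2) by (auto intro!: gr0I)
    ultimately have j2: "j \<ge> 2" by presburger
    have "even d" using assms(7) op by (metis dvd_triv_left even_mult_iff)
    hence d2: "d \<ge> 2" using assms(6) by presburger
    have "p \<noteq> q" using assms(1,3) by auto
    hence "p \<ge> 5 \<or> q \<ge> 5" using assms(1,2) op oq by presburger
    hence "p * q \<ge> 15" using assms(1,2) mult_le_mono[of 5 p 3 q] mult_le_mono[of 3 p 5 q] by auto
    hence "15 * 2 * 3 * 2 \<le> (p * q) * d * \<kappa> * j" using d2 k3 j2 by (intro mult_le_mono)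
    thus ?thesis using l2 by (simp add: mult_ac)
  qed
  thus ?thesis using op oq k1 k2 by auto
qed

lemma dickson_odd_smult_sign:
  assumes "\<tau> = 1 \<or> \<tau> = -1" "odd p"
  shows "dickson p \<circ>\<^sub>p smult \<tau> V = smult \<tau> (dickson p \<circ>\<^sub>p V)"
proof (rule poly_eq_poly_eq_iff[THEN iffD1, OF ext])
  show "poly (dickson p \<circ>\<^sub>p smult \<tau> V) z = poly (smult \<tau> (dickson p \<circ>\<^sub>p V)) z" for z
    using assms by (auto simp: poly_pcompose poly_dickson_neg)
qed

text \<open>In \<open>dickson p - [:e:] = [:-e, 1:] * G ^ 2\<close> only the linear factor is not a
  square, so composing with \<open>V\<close> to get a square makes \<open>V - [:e:]\<close>
  one.\<close>

lemma square_dickson_form: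
  assumes f: "dickson_form W a b p V" "odd p" and W: "W = smult c (Y ^ 2) + [:b + e * a:]" "c \<noteq> 0" "e = 2 \<or> e = -2"
  shows "\<exists>S. V - [:e:] = S ^ 2"
proof -
  have a: "a \<noteq> 0" "degree V > 0" using f(1) by (auto simp: dickson_form_def)
  obtain G where G: "G \<noteq> 0" "dickson p - [:e:] = [:-e, 1:] * G ^ 2"
    using dickson_odd_factor_exists[OF f(2) W(3)] by blast
  have "smult a (dickson p \<circ>\<^sub>p V) = smult c (Y ^ 2) + [:e * a:]"
  proof -
    have "smult a (dickson p \<circ>\<^sub>p V) = W - [:b:]" using f(1) by (simp add: dickson_form_def)
    also have "\<dots> = smult c (Y ^ 2) + ([:b + e * a:] - [:b:])" unfolding W(1) by (simp only: add_diff_eq)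
    finally show ?thesis by simp
  qed
  hence "smult (1 / a) (smult a (dickson p \<circ>\<^sub>p V)) = smult (1 / a) (smult c (Y ^ 2) + [:e * a:])" by simp
  hence "dickson p \<circ>\<^sub>p V = smult (c / a) (Y ^ 2) + [:e:]" using a by (simp add: smult_add_right)
  hence "(dickson p - [:e:]) \<circ>\<^sub>p V = smult (c / a) (Y ^ 2)" by (simp add: pcompose_diff)
  moreover have "[:-e, 1:] \<circ>\<^sub>p V = V - [:e:]" by (simp add: pcompose_pCons)
  ultimately have "(V - [:e:]) * (G \<circ>\<^sub>p V) ^ 2 = smult (c / a) (Y ^ 2)"
    unfolding G(2) by (simp only: pcompose_mult pcompose_power)
  moreover have "G \<circ>\<^sub>p V \<noteq> 0" using G(1) a(2) pcompose_eq_0 by blast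
  moreover have "V - [:e:] \<noteq> 0" using diff_const_nonzero a(2) by blast
  ultimately show ?thesis using square_cofactor_square a W(2) by (metis divide_eq_0_iff)
qed

lemma square_fibers_unique:
  fixes V :: "complex poly"
  assumes "degree V > 0" "V - [:e:] = S ^ 2" "V - [:e':] = S' ^ 2"
  shows "e = e'"
proof (rule ccontr)
  assume "e \<noteq> e'"
  have "ramif V t \<ge> 2" if "V - [:x:] = T ^ 2" "poly V t = x" for x T t
  proof -
    have nz: "V - [:x:] \<noteq> 0" using diff_const_nonzero assms(1) by blast
    hence "T \<noteq> 0" unfolding that(1) by auto
    hence "even (ramif V t)" unfolding ramif_def that(2) that(1) by (simp add: order_power)
    moreover have "ramif V t \<ge> 1" using ramif_pos assms(1) by blast
    ultimately show ?thesis by presburger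
  qed
  thus False using two_ramified_fibers[OF assms(1) \<open>e \<noteq> e'\<close>] assms(2,3) by blast
qed

text \<open>Subtracting \<open>\<theta>\<close> times the commutation of \<open>dickson p\<close>
  and \<open>dickson q\<close> leaves a left factor \<open>R\<close> of degree below
  \<open>q\<close>; coprimality makes that degree divisible by \<open>q\<close>, hence 0.\<close>

lemma dickson_common_composite:
  assumes eq: "P \<circ>\<^sub>p dickson p = P' \<circ>\<^sub>p dickson q" and cop: "coprime p q" "p > 0" "q > 0" and d: "degree P = q"
  shows "\<exists>\<theta> b. \<theta> \<noteq> 0 \<and> P = smult \<theta> (dickson q) + [:b:]"
proof -
  define \<theta> where "\<theta> = lead_coeff P / lead_coeff (dickson q)"
  define R where "R = P - smult \<theta> (dickson q)"
  have lc: "lead_coeff (dickson q) \<noteq> 0" "lead_coeff P \<noteq> 0" using degree_dickson[of q] d cop(3)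
    unfolding leading_coeff_0_iff by (metis degree_0 less_irrefl)+
  have dR: "degree R < q"
  proof (rule degree_lessI)
    show "R \<noteq> 0 \<or> 0 < q" using cop(3) by simp
    show "\<forall>k\<ge>q. coeff R k = 0"
    proof (intro allI impI)
      fix k assume "k \<ge> q"
      show "coeff R k = 0"
      proof (cases "k = q")
        case True
        thus ?thesis using lc d by (simp add: R_def \<theta>_def degree_dickson)
      next
        case False
        thus ?thesis using \<open>k \<ge> q\<close> d by (simp add: R_def coeff_eq_0 degree_dickson)
      qed
    qed
  qed
  have "R \<circ>\<^sub>p dickson p = (P' - smult \<theta> (dickson p)) \<circ>\<^sub>p dickson q"
    by (simp add: R_def pcompose_diff pcompose_smult dickson_pcompose eq mult.commute)
  hence "degree (R \<circ>\<^sub>p dickson p) = degree ((P' - smult \<theta> (dickson p)) \<circ>\<^sub>p dickson q)" by simp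
  hence "degree R * p = degree (P' - smult \<theta> (dickson p)) * q" by (simp add: degree_pcompose degree_dickson)
  hence "q dvd degree R * p" by simp
  hence "q dvd degree R" using cop(1) by (simp add: coprime_dvd_mult_left_iff coprime_commute)
  hence "degree R = 0" using dR by (auto dest: dvd_imp_le)
  then obtain b where "R = [:b:]" by (metis degree_eq_zeroE)
  hence "P = smult \<theta> (dickson q) + [:b:]" by (simp add: R_def algebra_simps)
  moreover have "\<theta> \<noteq> 0" using lc by (simp add: \<theta>_def)
  ultimately show ?thesis by blast
qed

context closed_factors
begin

text \<open>\<open>triple_arith\<close> gives the bound unless the left factors of \<open>W3\<close>
  have degrees exactly \<open>q\<close> and \<open>p\<close>. In that case \<open>V\<close> is
  \<open>dickson 2\<close> of some \<open>K\<close> up to sign, and \<open>W1\<close>,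
  \<open>W2\<close>, \<open>W3\<close> have Dickson indices \<open>2 * p\<close>,
  \<open>2 * q\<close>, \<open>p * q\<close> over this \<open>K\<close>, which
  \<open>common_dickson\<close> excludes.\<close>

theorem triple_degree_bound:
  assumes "dickson_type W1 W2" "cyclic_type \<alpha> \<beta> W1 W3" "cyclic_type \<alpha> \<beta> W2 W3"
    and ind: "indep W1 W2" "indep W1 W3" "indep W2 W3"
    and l: "l > 0" "degree W1 dvd l" "degree W3 dvd l"
  shows "90 \<le> l"
proof (rule ccontr)
  assume "\<not> 90 \<le> l"
  have M: "W1 \<in> M" "W2 \<in> M" "W3 \<in> M" using ind by (auto simp: indep_def)
  have d: "degree W1 > 0" "degree W2 > 0" using MD(1) M by blast+
  obtain V p q a1 b1 a2 b2 where V: "p \<ge> 3" "q \<ge> 3" "coprime p q"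
    "dickson_form W1 a1 b1 p V" "dickson_form W2 a2 b2 q V" using assms(1) unfolding dickson_type_def by blast
  from assms(2) d(1) obtain c1 n1 Y1 e1 U1 f1 where 1: "c1 \<noteq> 0" "n1 \<ge> 2" "W1 = smult c1 (Y1 ^ n1) + [:e1:]" "W3 = U1 \<circ>\<^sub>p Y1 + [:f1:]"
    "coprime n1 (degree U1)" "\<forall>\<epsilon> z. \<epsilon> ^ n1 = 1 \<longrightarrow> poly U1 (\<epsilon> * z) = \<epsilon> ^ degree U1 * poly U1 z"
    "poly U1 (poly Y1 \<alpha>) = 0" "poly U1 (poly Y1 \<beta>) = 0" "poly Y1 \<alpha> \<noteq> 0" "poly Y1 \<alpha> \<noteq> poly Y1 \<beta>" "poly U1 0 = 0"
    "degree Y1 > 0" "degree W1 = n1 * degree Y1" "degree W3 = degree U1 * degree Y1" "degree U1 > n1"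
    by (rule cyclic_typeE)
  from assms(3) d(2) obtain c2 n2 Y2 e2 U2 f2 where 2: "c2 \<noteq> 0" "n2 \<ge> 2" "W2 = smult c2 (Y2 ^ n2) + [:e2:]" "W3 = U2 \<circ>\<^sub>p Y2 + [:f2:]"
    "coprime n2 (degree U2)" "\<forall>\<epsilon> z. \<epsilon> ^ n2 = 1 \<longrightarrow> poly U2 (\<epsilon> * z) = \<epsilon> ^ degree U2 * poly U2 z"
    "poly U2 (poly Y2 \<alpha>) = 0" "poly U2 (poly Y2 \<beta>) = 0" "poly Y2 \<alpha> \<noteq> 0" "poly Y2 \<alpha> \<noteq> poly Y2 \<beta>" "poly U2 0 = 0"
    "degree Y2 > 0" "degree W2 = n2 * degree Y2" "degree W3 = degree U2 * degree Y2" "degree U2 > n2"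
    by (rule cyclic_typeE)
  have n: "n1 = 2" "n2 = 2" and e: "e1 = b1 + 2 * a1 \<or> e1 = b1 - 2 * a1" "e2 = b2 + 2 * a2 \<or> e2 = b2 - 2 * a2"
    using power_dickson_form[OF V(4,1) 1(3,1,2)] power_dickson_form[OF V(5,2) 2(3,1,2)] by auto
  obtain E1 where E1: "E1 = 2 \<or> E1 = -2" "e1 = b1 + E1 * a1" using e(1) by force
  obtain E2 where E2: "E2 = 2 \<or> E2 = -2" "e2 = b2 + E2 * a2" using e(2) by force
  have dV: "degree V > 0" using V(4) by (simp add: dickson_form_def)
  have deg: "p * degree V = 2 * degree Y1" "q * degree V = 2 * degree Y2" "degree U1 * degree Y1 = degree U2 * degree Y2"
    using dickson_form_degree[OF V(4)] dickson_form_degree[OF V(5)] 1(13,14) 2(13,14) n by simp_all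
  have "odd (degree U1)" "odd (degree U2)" using 1(5) 2(5) n by simp_all
  note arith = triple_arith[OF V(1-3) this dV deg]
  have "degree W1 = p * degree V" using dickson_form_degree[OF V(4)] .
  hence "\<not> (\<forall>l>0. p * degree V dvd l \<and> degree U1 * degree Y1 dvd l \<longrightarrow> 90 \<le> l)"
    using l \<open>\<not> 90 \<le> l\<close> unfolding 1(14) by auto
  hence pq: "odd p" "odd q" and k: "degree U1 = q" "degree U2 = p" using arith by blast+
  obtain S where S: "V - [:E1:] = S ^ 2"
    using square_dickson_form[OF V(4) pq(1) 1(3)[unfolded n E1(2)] 1(1) E1(1)] by blast
  moreover obtain S' where "V - [:E2:] = S' ^ 2"
    using square_dickson_form[OF V(5) pq(2) 2(3)[unfolded n E2(2)] 2(1) E2(1)] by blast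
  ultimately have EE: "E2 = E1" using square_fibers_unique[OF dV] by blast
  \<comment> \<open>This sign makes
    \<open>dickson 2 \<circ>\<^sub>p K = smult \<tau> V\<close>.\<close>
  define \<tau> where "\<tau> = - E1 / 2"
  have tau: "\<tau> = 1 \<or> \<tau> = -1" "E1 = - 2 * \<tau>" "\<tau> * \<tau> = 1" using E1(1) by (auto simp: \<tau>_def)
  obtain \<rho> where rho: "\<rho> ^ 2 = \<tau>" using complex_root_exists[of 2] by auto
  define K where "K = smult \<rho> S"
  have K2: "K ^ 2 = smult \<tau> V + [:2:]"
  proof -
    have "K ^ 2 = smult \<tau> (V - [:E1:])" by (simp add: K_def smult_power rho S)
    also have "\<dots> = smult \<tau> V + [:2:]" using tau(3) by (simp add: smult_diff_right tau(2) mult.left_commute)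
    finally show ?thesis .
  qed
  have dK: "degree K > 0"
  proof (rule gr0I)
    assume "degree K = 0"
    hence "degree (K ^ 2) = 0" using degree_power_le[of K 2] by simp
    thus False unfolding K2 degree_add_const using tau dV by auto
  qed
  have D: "dickson r \<circ>\<^sub>p V = smult \<tau> ((dickson r \<circ>\<^sub>p K) ^ 2 - [:2:])" "dickson r \<circ>\<^sub>p V = smult \<tau> (dickson (2 * r) \<circ>\<^sub>p K)"
    if "odd r" for r
  proof -
    have "dickson 2 = [:-2, 0, 1:]" by (simp add: numeral_2_eq_2)
    hence "dickson 2 \<circ>\<^sub>p K = K ^ 2 - [:2:]" by (simp add: pcompose_pCons power2_eq_square)
    hence "dickson 2 \<circ>\<^sub>p K = smult \<tau> V" by (simp add: K2)
    hence "dickson (2 * r) \<circ>\<^sub>p K = smult \<tau> (dickson r \<circ>\<^sub>p V)"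
      using dickson_odd_smult_sign[OF tau(1) that] by (metis dickson_pcompose pcompose_assoc)
    thus *: "dickson r \<circ>\<^sub>p V = smult \<tau> (dickson (2 * r) \<circ>\<^sub>p K)" by (simp add: tau(3))
    have "dickson (2 * r) = dickson r ^ 2 - [:2:]" by (simp add: dickson_double numeral_poly)
    thus "dickson r \<circ>\<^sub>p V = smult \<tau> ((dickson r \<circ>\<^sub>p K) ^ 2 - [:2:])"
      unfolding * by (simp add: pcompose_diff pcompose_power)
  qed
  have form: "dickson_form W (a * \<tau>) b (2 * r) K" if "dickson_form W a b r V" "odd r" for W a b r
    using that(1) dK tau(1) by (auto simp: dickson_form_def D(2)[OF that(2)])
  have root: "\<exists>\<rho>. \<rho> \<noteq> 0 \<and> Y = smult \<rho> (dickson r \<circ>\<^sub>p K)"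
    if f: "dickson_form W a b r V" "odd r" "W = smult c (Y ^ 2) + [:b + E1 * a:]" "c \<noteq> 0" for W a b r c Y
  proof (rule smult_square_eq_smult_square)
    have "smult c (Y ^ 2) + [:b + E1 * a:] = smult (a * \<tau>) ((dickson r \<circ>\<^sub>p K) ^ 2) + [:b + E1 * a:]"
      unfolding f(3)[symmetric] using f(1) by (simp add: dickson_form_def D(1)[OF f(2)] smult_diff_right tau(2) mult_ac)
    thus "smult c (Y ^ 2) = smult (a * \<tau>) ((dickson r \<circ>\<^sub>p K) ^ 2)" by (metis add_right_cancel)
    show "c \<noteq> 0" "a * \<tau> \<noteq> 0" using f(1,4) tau(1) by (auto simp: dickson_form_def)
  qed
  obtain r1 where r1: "r1 \<noteq> 0" "Y1 = smult r1 (dickson p \<circ>\<^sub>p K)"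
    using root[OF V(4) pq(1) 1(3)[unfolded n E1(2)] 1(1)] by blast
  obtain r2 where r2: "r2 \<noteq> 0" "Y2 = smult r2 (dickson q \<circ>\<^sub>p K)"
    using root[OF V(5) pq(2) 2(3)[unfolded n E2(2) EE] 2(1)] by blast
  define P1 P2 where "P1 = U1 \<circ>\<^sub>p [:0, r1:]" and "P2 = U2 \<circ>\<^sub>p [:0, r2:]"
  have P: "P1 \<circ>\<^sub>p (dickson p \<circ>\<^sub>p K) = U1 \<circ>\<^sub>p Y1" "P2 \<circ>\<^sub>p (dickson q \<circ>\<^sub>p K) = U2 \<circ>\<^sub>p Y2"
    by (simp_all add: P1_def P2_def r1(2) r2(2) pcompose_pCons flip: pcompose_assoc)
  have "poly W3 \<alpha> = f1" using 1(4,7) by (simp add: poly_pcompose)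
  moreover have "poly W3 \<alpha> = f2" using 2(4,7) by (simp add: poly_pcompose)
  ultimately have "U1 \<circ>\<^sub>p Y1 = U2 \<circ>\<^sub>p Y2" using 1(4) 2(4) by (metis add_right_cancel)
  hence "P1 \<circ>\<^sub>p dickson p \<circ>\<^sub>p K = P2 \<circ>\<^sub>p dickson q \<circ>\<^sub>p K" using P by (metis pcompose_assoc)
  hence comp: "P1 \<circ>\<^sub>p dickson p = P2 \<circ>\<^sub>p dickson q" using dK by (rule pcompose_cancel_right)
  have "degree P1 = q" using k(1) r1(1) by (simp add: P1_def degree_pcompose)
  then obtain \<theta> b where \<theta>: "\<theta> \<noteq> 0" "P1 = smult \<theta> (dickson q) + [:b:]"
    using dickson_common_composite[OF comp V(3)] V(1,2) by auto
  have "W3 = P1 \<circ>\<^sub>p dickson p \<circ>\<^sub>p K + [:f1:]" using 1(4) P(1) by (metis pcompose_assoc)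
  hence "W3 = smult \<theta> (dickson (p * q) \<circ>\<^sub>p K) + [:b + f1:]"
    unfolding \<theta>(2) by (simp add: pcompose_add pcompose_smult dickson_pcompose)
  hence W3: "dickson_form W3 \<theta> (b + f1) (p * q) K" using \<theta>(1) dK by (simp add: dickson_form_def)
  show False
    by (rule common_dickson[OF form[OF V(4) pq(1)] form[OF V(4) pq(1)] _ _ form[OF V(5) pq(2)] W3 ind]) (use V(1) in auto)
qed

text \<open>At most one side of the triangle is of Dickson type. Two directed sides meet in a
  vertex, where neither a common source nor a path is possible, so both end there; three directed
  sides cannot all do so pairwise.\<close>

lemma independent_triple_shape:
  assumes "indep W1 W2" "indep W1 W3" "indep W2 W3"
  shows "(dickson_type W1 W2 \<and> cyclic_type \<alpha> \<beta> W1 W3 \<and> cyclic_type \<alpha> \<beta> W2 W3) \<or>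
    (dickson_type W1 W3 \<and> cyclic_type \<alpha> \<beta> W1 W2 \<and> cyclic_type \<alpha> \<beta> W3 W2) \<or>
    (dickson_type W2 W3 \<and> cyclic_type \<alpha> \<beta> W2 W1 \<and> cyclic_type \<alpha> \<beta> W3 W1)"
proof -
  let ?c = "cyclic_type \<alpha> \<beta>"
  note i = assms assms[THEN indep_sym]
  have out: "\<not> (?c W1 W2 \<and> ?c W1 W3)" "\<not> (?c W2 W1 \<and> ?c W2 W3)" "\<not> (?c W3 W1 \<and> ?c W3 W2)"
    using no_out i by blast+
  have path: "\<not> (?c W1 W2 \<and> ?c W2 W3)" "\<not> (?c W1 W3 \<and> ?c W3 W2)" "\<not> (?c W2 W1 \<and> ?c W1 W3)"
    "\<not> (?c W2 W3 \<and> ?c W3 W1)" "\<not> (?c W3 W1 \<and> ?c W1 W2)" "\<not> (?c W3 W2 \<and> ?c W2 W1)"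
    using no_path i by blast+
  have dick: "\<not> (dickson_type W1 W2 \<and> dickson_type W1 W3)" "\<not> (dickson_type W1 W2 \<and> dickson_type W2 W3)"
    "\<not> (dickson_type W1 W3 \<and> dickson_type W2 W3)"
    using no_two_dickson i dickson_type_sym by blast+
  show ?thesis
    using pair_classification[OF i(1)] pair_classification[OF i(2)] pair_classification[OF i(3)] out path dick by blast
qed

lemma independent_triple_lcm:
  assumes "indep W1 W2" "indep W1 W3" "indep W2 W3"
    and "l > 0" "degree W1 dvd l" "degree W2 dvd l" "degree W3 dvd l"
  shows "90 \<le> l"
  using independent_triple_shape[OF assms(1-3)] triple_degree_bound assms indep_sym by meson

text \<open>Each of the four triangles contains a Dickson side, and no two such sides meet; so there
  are two opposite ones. In one triangle an element is the target of the others, in the next one it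
  is a source, against the growth of degrees.\<close>

lemma no_four_independent:
  assumes "indep W1 W2" "indep W1 W3" "indep W1 W4" "indep W2 W3" "indep W2 W4" "indep W3 W4"
  shows False
proof -
  have less: "degree W < degree W'" if "cyclic_type \<alpha> \<beta> W W'" "indep W W''" for W W' W''
    using cyclic_type_degree_less[OF that(1)] MD(1) that(2) by (simp add: indep_def)
  note i = assms assms[THEN indep_sym]
  note t = independent_triple_shape[OF i(1,2,4)] independent_triple_shape[OF i(1,3,5)]
    independent_triple_shape[OF i(2,3,6)] independent_triple_shape[OF i(4,5,6)]
  have dick: "\<not> (dickson_type W W' \<and> dickson_type W W'')" if "indep W W'" "indep W W''" "indep W' W''" for W W' W''
    using no_two_dickson that by blast
  note ls = less[OF _ i(1)] less[OF _ i(7)] less[OF _ i(6)] less[OF _ i(12)]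
  show False using t ls dick[OF i(1,2,4)] dick[OF i(1,3,5)] dick[OF i(2,3,6)] dick[OF i(7,4,2)] dick[OF i(7,5,3)] dick[OF i(4,5,6)]
    dick[OF i(8,10,1)] dickson_type_sym
    by (smt (verit) less_asym)
qed

end

section \<open>Dimensions of composition sets\<close>

lemma finite_card_leI:
  assumes "\<And>T. T \<subseteq> F \<Longrightarrow> finite T \<Longrightarrow> card T = Suc n \<Longrightarrow> False"
  shows "finite F \<and> card F \<le> n"
proof (cases "finite F")
  case True
  have "card F \<le> n"
  proof (rule ccontr)
    assume "\<not> card F \<le> n"
    then obtain T where "T \<subseteq> F" "card T = Suc n" "finite T"
      using obtain_subset_with_card_n[of "Suc n" F] by auto
    thus False using assms by blast
  qed
  thus ?thesis using True by blast
next
  case False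
  thus ?thesis using infinite_arbitrarily_large[OF False, of "Suc n"] assms by blast
qed

text \<open>Choose one element for each degree that occurs; cancelling leading terms shows that they
  span \<open>V\<close>.\<close>

lemma dim_le_card_degrees:
  assumes V: "cpoly.subspace V" and D: "finite D" "\<And>P. P \<in> V \<Longrightarrow> P \<noteq> 0 \<Longrightarrow> degree P \<in> D"
  shows "cpoly.dim V \<le> card D"
proof -
  define b where "b e = (SOME P. P \<in> V \<and> P \<noteq> 0 \<and> degree P = e)" for e
  have b: "b (degree P) \<in> V \<and> b (degree P) \<noteq> 0 \<and> degree (b (degree P)) = degree P" if "P \<in> V" "P \<noteq> 0" for P
    unfolding b_def by (rule someI_ex) (use that in blast)
  have "P \<in> cpoly.span (b ` D)" if "P \<in> V" for P
    using that
  proof (induction "degree P" arbitrary: P rule: less_induct)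
    case less
    show ?case
    proof (cases "P = 0")
      case True
      thus ?thesis by (simp add: cpoly.span_zero)
    next
      case False
      define B c where "B = b (degree P)" and "c = lead_coeff P / lead_coeff B"
      have B: "B \<in> V" "B \<noteq> 0" "degree B = degree P" using b[OF less.prems False] by (auto simp: B_def)
      have "B \<in> b ` D" using D(2)[OF less.prems False] by (auto simp: B_def)
      hence cB: "smult c B \<in> cpoly.span (b ` D)" by (intro cpoly.span_scale cpoly.span_base)
      have R: "P - smult c B \<in> V" using less.prems B(1) V by (intro cpoly.subspace_diff cpoly.subspace_scale)
      have "P - smult c B \<in> cpoly.span (b ` D)"
      proof (cases "P - smult c B = 0")
        case True
        thus ?thesis by (simp only: cpoly.span_zero)
      next
        case nz: False
        have "coeff (P - smult c B) (degree P) = 0" using B leading_coeff_0_iff[of B] by (simp add: c_def)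
        moreover have "degree (P - smult c B) \<le> degree P" using B by (simp add: degree_diff_le)
        ultimately have "degree (P - smult c B) < degree P"
          using nz by (metis le_neq_implies_less leading_coeff_0_iff)
        thus ?thesis using R less.hyps by blast
      qed
      hence "(P - smult c B) + smult c B \<in> cpoly.span (b ` D)" using cB by (rule cpoly.span_add)
      thus ?thesis by simp
    qed
  qed
  hence "cpoly.dim V \<le> card (b ` D)" using D(1) by (intro cpoly.dim_le_card) auto
  also have "\<dots> \<le> card D" by (rule card_image_le[OF D(1)])
  finally show ?thesis .
qed

text \<open>Only the \<open>d div l\<close> positive multiples of \<open>l\<close> up to
  \<open>d\<close> occur as degrees; degree 0 is excluded by assumption, so no extra 1
  appears.\<close>

lemma dim_le_div:
  assumes "cpoly.subspace V" "0 < k" "k \<le> l"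
    and "\<And>P. P \<in> V \<Longrightarrow> P \<noteq> 0 \<Longrightarrow> 0 < degree P \<and> degree P \<le> d \<and> l dvd degree P"
  shows "cpoly.dim V \<le> d div k"
proof -
  have "degree P \<in> (\<lambda>i. l * i) ` {1..d div l}" if P: "P \<in> V" "P \<noteq> 0" for P
  proof -
    obtain i where i: "degree P = l * i" using assms(4)[OF P] by (auto elim: dvdE)
    have "0 < i" "l * i \<le> d" using assms(4)[OF P] i by (auto intro: gr0I)
    hence "i \<in> {1..d div l}" using assms(2,3) by (simp add: less_eq_div_iff_mult_less_eq mult.commute)
    thus ?thesis using i by blast
  qed
  hence "cpoly.dim V \<le> card ((\<lambda>i. l * i) ` {1..d div l})"
    by (intro dim_le_card_degrees[OF assms(1)]) auto
  also have "\<dots> \<le> d div l" using card_image_le[of "{1..d div l}" "\<lambda>i. l * i"] by simp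
  also have "\<dots> \<le> d div k" using assms(2,3) by (rule div_le_mono2[OF _ _])
  finally show ?thesis .
qed

context closed_factors
begin

lemma minimal_factor_exists:
  assumes "Q = A \<circ>\<^sub>p W" "poly W \<alpha> = poly W \<beta>"
  shows "\<exists>V\<in>M. \<exists>U. W = U \<circ>\<^sub>p V"
proof -
  define C where "C V \<longleftrightarrow> poly V \<alpha> = poly V \<beta> \<and> (\<exists>U. W = U \<circ>\<^sub>p V)" for V
  have "C W" using assms(2) pcompose_X[of W] unfolding C_def by metis
  then obtain V where V: "C V" "\<And>V'. C V' \<Longrightarrow> degree V \<le> degree V'"
    using ex_has_least_nat[of C W degree] by blast
  obtain U where U: "W = U \<circ>\<^sub>p V" "poly V \<alpha> = poly V \<beta>" using V(1) by (auto simp: C_def)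
  have Q: "Q = (A \<circ>\<^sub>p U) \<circ>\<^sub>p V" using assms(1) U(1) by (simp add: pcompose_assoc)
  hence dV: "degree V > 0" using Qpos by (auto simp: degree_pcompose intro!: gr0I)
  have "degree X = 1" if X: "V = X \<circ>\<^sub>p Y" "poly Y \<alpha> = poly Y \<beta>" for X Y
  proof -
    have "C Y" unfolding C_def using X U(1) by (metis pcompose_assoc)
    hence "degree X * degree Y \<le> degree Y" using V(2) X(1) by (metis degree_pcompose)
    moreover have "degree X > 0" "degree Y > 0" using dV X(1) by (auto simp: degree_pcompose)
    ultimately show ?thesis by simp
  qed
  hence "minimal_closed \<alpha> \<beta> V" unfolding minimal_closed_def using dV U(2) by blast
  hence "V \<in> M" using Q unfolding M_def by blast
  thus ?thesis using U(1) by blast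
qed

lemma M_degree_ge_2:
  assumes "W \<in> M" "\<alpha> \<noteq> \<beta>" shows "2 \<le> degree W"
proof -
  have "degree W \<noteq> 1"
  proof
    assume "degree W = 1"
    then obtain u v where "v \<noteq> 0" "W = [:u, v:]" using degree_1_poly by blast
    thus False using MD(2)[OF assms(1)] assms(2) by simp
  qed
  thus ?thesis using MD(1)[OF assms(1)] by linarith
qed

lemma M_degree_dvd: "W \<in> M \<Longrightarrow> degree W dvd degree Q"
  by (auto simp: M_def degree_pcompose)

lemma indep_not_dvd:
  assumes "indep W1 W2" shows "\<not> degree W1 dvd degree W2"
proof
  assume dvd: "degree W1 dvd degree W2"
  have M: "W1 \<in> M" "W2 \<in> M" using assms by (auto simp: indep_def)
  obtain A1 A2 where "Q = A1 \<circ>\<^sub>p W1" "Q = A2 \<circ>\<^sub>p W2" using M unfolding M_def by blast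
  then obtain v where "W2 = v \<circ>\<^sub>p W1" using right_factor_of_dvd[OF _ _ Qpos dvd] by blast
  moreover from this have "degree v = 1" using M MD(2) unfolding M_def minimal_closed_def by blast
  ultimately show False using assms by (auto simp: indep_def affine_equiv_def)
qed

text \<open>Both degrees are at least 2 and neither divides the other. Below 6 the only proper
  divisor of \<open>l\<close> that is at least 2 is 2, so one degree would divide the other.\<close>

lemma indep_common_multiple:
  assumes "indep W1 W2" "\<alpha> \<noteq> \<beta>" "0 < l" "degree W1 dvd l" "degree W2 dvd l"
  shows "6 \<le> l"
proof (rule ccontr)
  assume l: "\<not> 6 \<le> l"
  have M: "W1 \<in> M" "W2 \<in> M" using assms by (auto simp: indep_def)
  have nd: "\<not> degree W1 dvd degree W2" "\<not> degree W2 dvd degree W1"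
    using indep_not_dvd assms(1) indep_sym by blast+
  have two: "degree W = 2" if W: "W \<in> M" "degree W dvd l" "degree W \<noteq> l" for W
  proof -
    obtain i where i: "l = degree W * i" using W(2) by blast
    have "i \<noteq> 0" "i \<noteq> 1" using i W(3) assms(3) by auto
    hence "degree W * 2 \<le> l" unfolding i by simp
    thus ?thesis using l M_degree_ge_2[OF W(1) assms(2)] by linarith
  qed
  have "degree W1 = 2" "degree W2 = 2" using two M assms(4,5) nd by blast+
  thus False using nd by simp
qed

text \<open>Vanishing at \<open>\<alpha>\<close> suffices: for a closed \<open>W\<close> it implies
  vanishing at \<open>\<beta>\<close>, and it excludes nonzero constants.\<close>

definition S where "S d W = {P. degree P \<le> d \<and> poly P \<alpha> = 0 \<and> (\<exists>P'. P = P' \<circ>\<^sub>p W)}"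

lemma S_subspace: "cpoly.subspace (S d W)"
proof (rule cpoly.subspaceI)
  show "0 \<in> S d W" by (auto simp: S_def intro!: exI[of _ 0])
  show "x + y \<in> S d W" if xy: "x \<in> S d W" "y \<in> S d W" for x y
  proof -
    obtain x' y' where "x = x' \<circ>\<^sub>p W" "y = y' \<circ>\<^sub>p W" using xy by (auto simp: S_def)
    hence "\<exists>P'. x + y = P' \<circ>\<^sub>p W" by (metis pcompose_add)
    thus ?thesis using xy by (simp add: S_def degree_add_le)
  qed
  show "smult c x \<in> S d W" if x: "x \<in> S d W" for c x
  proof -
    obtain x' where "x = x' \<circ>\<^sub>p W" using x by (auto simp: S_def)
    hence "\<exists>P'. smult c x = P' \<circ>\<^sub>p W" by (metis pcompose_smult)
    thus ?thesis using x by (simp add: S_def degree_smult_le[THEN le_trans])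
  qed
qed

lemma S_degree:
  assumes "P \<in> S d W" "P \<noteq> 0"
  shows "0 < degree P" "degree P \<le> d" "degree W dvd degree P"
proof -
  show "0 < degree P"
  proof (rule gr0I)
    assume "degree P = 0"
    then obtain x where "P = [:x:]" by (metis degree_eq_zeroE)
    thus False using assms by (simp add: S_def)
  qed
  show "degree P \<le> d" "degree W dvd degree P" using assms by (auto simp: S_def degree_pcompose)
qed

lemma S_subset: "W \<in> M \<Longrightarrow> S d W \<subseteq> poly_space \<alpha> \<beta> d"
  using MD(2) by (auto simp: S_def poly_space_def poly_pcompose)

text \<open>A \<open>W\<close> witnessing the composition condition may be replaced by a minimal
  closed right factor of it, since that only enlarges the set of polynomials in
  \<open>W\<close>.\<close>

lemma COS_eq_Union: "COS \<alpha> \<beta> d Q = \<Union> (S d ` M)"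
proof (rule set_eqI)
  fix P show "P \<in> COS \<alpha> \<beta> d Q \<longleftrightarrow> P \<in> \<Union> (S d ` M)"
  proof
    assume "P \<in> COS \<alpha> \<beta> d Q"
    then obtain P' Q' W where *: "P \<in> poly_space \<alpha> \<beta> d" "poly W \<alpha> = poly W \<beta>" "P = P' \<circ>\<^sub>p W" "Q = Q' \<circ>\<^sub>p W"
      by (auto simp: COS_def composition_condition_def)
    obtain V U where V: "V \<in> M" "W = U \<circ>\<^sub>p V" using minimal_factor_exists[OF *(4,2)] by blast
    have "P = (P' \<circ>\<^sub>p U) \<circ>\<^sub>p V" using *(3) V(2) by (simp add: pcompose_assoc)
    hence "P \<in> S d V" using *(1) unfolding S_def poly_space_def by blast
    thus "P \<in> \<Union> (S d ` M)" using V(1) by blast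
  next
    assume "P \<in> \<Union> (S d ` M)"
    then obtain W P' where *: "W \<in> M" "P \<in> S d W" "P = P' \<circ>\<^sub>p W" by (auto simp: S_def)
    obtain A where "Q = A \<circ>\<^sub>p W" using *(1) by (auto simp: M_def)
    thus "P \<in> COS \<alpha> \<beta> d Q" unfolding COS_def composition_condition_def
      using S_subset[OF *(1)] MD(2)[OF *(1)] *(2,3) by blast
  qed
qed

lemma S_mono: "affine_equiv W W' \<Longrightarrow> S d W' \<subseteq> S d W"
  by (auto simp: affine_equiv_def S_def pcompose_assoc)

lemma indep_if_S_neq: "W \<in> M \<Longrightarrow> W' \<in> M \<Longrightarrow> S d W \<noteq> S d W' \<Longrightarrow> indep W W'"
  using S_mono affine_equiv_sym unfolding indep_def by blast

lemma dim_S: "W \<in> M \<Longrightarrow> \<alpha> \<noteq> \<beta> \<Longrightarrow> cpoly.dim (S d W) \<le> d div 2"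
  by (rule dim_le_div[OF S_subspace, of 2 "degree W"]) (auto simp: M_degree_ge_2 S_degree)

lemma dim_S_pair:
  assumes "indep W1 W2" "\<alpha> \<noteq> \<beta>"
  shows "cpoly.dim (S d W1 \<inter> S d W2) \<le> d div 6"
proof -
  define l where "l = lcm (degree W1) (degree W2)"
  have "l > 0" using assms MD(1) by (auto simp: l_def indep_def intro!: lcm_pos_nat)
  hence "6 \<le> l" by (rule indep_common_multiple[OF assms]) (simp_all add: l_def)
  thus ?thesis
    by (intro dim_le_div[of _ 6 l] cpoly.subspace_inter S_subspace) (auto simp: l_def S_degree)
qed

lemma dim_S_triple:
  assumes "indep W1 W2" "indep W1 W3" "indep W2 W3"
  shows "cpoly.dim (S d W1 \<inter> S d W2 \<inter> S d W3) \<le> d div 90"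
proof -
  define l where "l = lcm (degree W1) (lcm (degree W2) (degree W3))"
  have "l > 0" using assms MD(1) by (auto simp: l_def indep_def intro!: lcm_pos_nat)
  hence "90 \<le> l" by (rule independent_triple_lcm[OF assms]) (auto simp: l_def)
  thus ?thesis
    by (intro dim_le_div[of _ 90 l] cpoly.subspace_inter S_subspace) (auto simp: l_def S_degree)
qed

lemma card_S_le_3: "finite (S d ` M) \<and> card (S d ` M) \<le> 3"
proof (rule finite_card_leI)
  fix T assume T: "T \<subseteq> S d ` M" "card T = Suc 3"
  obtain V T' where 1: "T = insert V T'" "V \<notin> T'" "card T' = 3" using T(2) unfolding card_Suc_eq by blast
  obtain V2 V3 V4 where 2: "T' = {V2, V3, V4}" "V2 \<noteq> V3" "V2 \<noteq> V4" "V3 \<noteq> V4" using 1(3) unfolding card_3_iff by blast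
  obtain W1 W2 W3 W4 where W: "W1 \<in> M" "W2 \<in> M" "W3 \<in> M" "W4 \<in> M" "V = S d W1" "V2 = S d W2" "V3 = S d W3" "V4 = S d W4"
    using T(1) 1(1) 2(1) by auto
  show False
    by (rule no_four_independent[of W1 W2 W3 W4]; rule indep_if_S_neq[of _ _ d]) (use W 1 2 in auto)
qed

lemma card_S_le_2:
  assumes "degree Q < 90" shows "card (S d ` M) \<le> 2"
proof -
  have "finite (S d ` M) \<and> card (S d ` M) \<le> 2"
  proof (rule finite_card_leI)
    fix T assume T: "T \<subseteq> S d ` M" "card T = Suc 2"
    obtain V1 V2 V3 where V: "T = {V1, V2, V3}" "V1 \<noteq> V2" "V1 \<noteq> V3" "V2 \<noteq> V3"
      using T(2) card_3_iff[of T] by auto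
    obtain W1 W2 W3 where W: "W1 \<in> M" "W2 \<in> M" "W3 \<in> M" "V1 = S d W1" "V2 = S d W2" "V3 = S d W3"
      using T(1) V(1) by auto
    have "indep W1 W2" "indep W1 W3" "indep W2 W3" using indep_if_S_neq W V by blast+
    hence "90 \<le> degree Q" using Qpos M_degree_dvd W by (intro independent_triple_lcm[of W1 W2 W3]) auto
    thus False using assms by simp
  qed
  thus ?thesis by blast
qed

text \<open>\<open>Q\<close> is a closed right factor of itself, so \<open>M\<close> is nonempty; a
  degree below 6 leaves no room for two independent elements.\<close>

lemma COS_eq_S:
  assumes "degree Q < 6" "\<alpha> \<noteq> \<beta>" "poly Q \<alpha> = poly Q \<beta>"
  shows "\<exists>W\<in>M. COS \<alpha> \<beta> d Q = S d W"
proof -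
  obtain W where W: "W \<in> M" using minimal_factor_exists[of "[:0, 1:]" Q] assms(3) pcompose_X[of Q] by auto
  have "S d V = S d W" if "V \<in> M" for V
  proof (rule ccontr)
    assume "S d V \<noteq> S d W"
    hence "indep V W" using that W indep_if_S_neq by blast
    hence "6 \<le> degree Q" using assms(2) Qpos M_degree_dvd that W by (intro indep_common_multiple) auto
    thus False using assms(1) by simp
  qed
  thus ?thesis using W COS_eq_Union by blast
qed

end

theorem theorem1p1:
  fixes a b :: complex and d :: nat and Q :: "complex poly"
  assumes "a \<noteq> b" and "d > 0"
    and "Q \<noteq> 0" and "poly Q a = 0" and "poly Q b = 0"
  shows "(degree Q \<le> 5 \<longrightarrow>
            linear_subspace_of (COS a b d Q) (poly_space a b d) \<and>
            cpoly.dim (COS a b d Q) \<le> d div 2) \<and>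
         (6 \<le> degree Q \<and> degree Q \<le> 89 \<longrightarrow>
            (\<exists>F. finite F \<and> card F \<le> 2 \<and> COS a b d Q = \<Union>F \<and>
               (\<forall>V\<in>F. linear_subspace_of V (poly_space a b d) \<and> cpoly.dim V \<le> d div 2) \<and>
               (\<forall>V1\<in>F. \<forall>V2\<in>F. V1 \<noteq> V2 \<longrightarrow> cpoly.dim (V1 \<inter> V2) \<le> d div 6 + 1))) \<and>
         (90 \<le> degree Q \<longrightarrow>
            (\<exists>F. finite F \<and> card F \<le> 3 \<and> COS a b d Q = \<Union>F \<and>
               (\<forall>V\<in>F. linear_subspace_of V (poly_space a b d) \<and> cpoly.dim V \<le> d div 2) \<and>
               (\<forall>V1\<in>F. \<forall>V2\<in>F. V1 \<noteq> V2 \<longrightarrow> cpoly.dim (V1 \<inter> V2) \<le> d div 6 + 1) \<and>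
               (\<forall>V1\<in>F. \<forall>V2\<in>F. \<forall>V3\<in>F. V1 \<noteq> V2 \<and> V1 \<noteq> V3 \<and> V2 \<noteq> V3 \<longrightarrow>
                  cpoly.dim (V1 \<inter> V2 \<inter> V3) \<le> d div 90)))"
proof -
  have "degree Q > 0"
  proof (rule gr0I)
    assume "degree Q = 0"
    then obtain x where "Q = [:x:]" by (metis degree_eq_zeroE)
    thus False using assms(3,4) by simp
  qed
  then interpret closed_factors a b Q by unfold_locales
  \<comment> \<open>One family serves both ranges; only the bound on its cardinality depends on
    \<open>degree Q\<close>.\<close>
  define F where "F = S d ` M"
  have F: "COS a b d Q = \<Union>F" "finite F" "card F \<le> 3" using COS_eq_Union card_S_le_3 by (auto simp: F_def)
  have sub: "\<forall>V\<in>F. linear_subspace_of V (poly_space a b d) \<and> cpoly.dim V \<le> d div 2"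
    using S_subspace S_subset dim_S assms(1) by (auto simp: F_def linear_subspace_of_def)
  have pair: "\<forall>V1\<in>F. \<forall>V2\<in>F. V1 \<noteq> V2 \<longrightarrow> cpoly.dim (V1 \<inter> V2) \<le> d div 6 + 1"
    using dim_S_pair[OF indep_if_S_neq[of _ _ d] assms(1), of _ _ d] unfolding F_def by (blast intro: trans_le_add1)
  have triple: "\<forall>V1\<in>F. \<forall>V2\<in>F. \<forall>V3\<in>F. V1 \<noteq> V2 \<and> V1 \<noteq> V3 \<and> V2 \<noteq> V3 \<longrightarrow>
      cpoly.dim (V1 \<inter> V2 \<inter> V3) \<le> d div 90"
    using dim_S_triple[OF indep_if_S_neq[of _ _ d] indep_if_S_neq[of _ _ d] indep_if_S_neq[of _ _ d], of _ _ _ d]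
    unfolding F_def by blast
  have "linear_subspace_of (COS a b d Q) (poly_space a b d) \<and> cpoly.dim (COS a b d Q) \<le> d div 2"
    if "degree Q \<le> 5"
    using COS_eq_S[of d] that assms(1,4,5) sub by (auto simp: F_def)
  moreover have "card F \<le> 2" if "degree Q \<le> 89" using card_S_le_2[of d] that by (simp add: F_def)
  ultimately show ?thesis
    by (intro conjI impI exI[of _ F]) (use F sub pair triple in simp_all)
qed

end
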